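(* Let $\ell\ge3$ be an integer and $q$ a fixed prime power with $q\equiv1\pmod{2\ell}$. Let $\lambda(N)$ be a family of complex numbers indexed by monic polynomials $N\in\mathbb{F}_q[t]$. Then for every $\varepsilon>0$ and all integers $m,n\ge0$, $$\sum_{M\in\mathcal{H}_m}\left|\sum_{N\in\mathcal{H}_n}\lambda(N)\left(\frac{M}{N}\right)_\ell\right|^2\ll q^{\varepsilon(m+n)}\left(q^m+q^n+q^{2(m+n)/3}\right)\sum_{N\in\mathcal{H}_n}|\lambda(N)|^2,$$ where the implied constant depends at most on $\varepsilon,q,\ell$ (not on $m,n,\lambda$).
   Context: $\mathcal{H}_d$ denotes the set of monic square-free polynomials of degree $d$ in $\mathbb{F}_q[t]$. Residue symbol: fix an isomorphism $\Omega$ from the group of $\ell$-th roots of unity in $\mathbb{F}_q^*$ to the group $\mu_\ell\subset\mathbb{C}^*$ of complex $\ell$-th roots of unity. For a monic irreducible $\pi\in\mathbb{F}_q[t]$ and $a\in\mathbb{F}_q[t]$, put $\left(\frac{a}{\pi}\right)_\ell=0$ if $\pi\mid a$, and otherwise $\left(\frac{a}{\pi}\right)_\ell$ is the unique $\alpha\in\mu_\ell$ with $a^{(q^{\deg \pi}-1)/\ell}\equiv\Omega^{-1}(\alpha)\pmod\pi$. For $c=\pi_1^{e_1}\cdots\pi_k^{e_k}$ monic put $\left(\frac{a}{c}\right)_\ell=\prod_i\left(\frac{a}{\pi_i}\right)_\ell^{e_i}$. *)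

theory Defs
  imports
    Complex_Main
    "HOL-Computational_Algebra.Computational_Algebra"
    "HOL-Library.Cardinality"
    "HOL-Number_Theory.Cong"
    "HOL-Algebra.Group"
begin

text \<open>
  The finite field with \<open>q\<close> elements is an arbitrary type \<open>'a\<close> of sort \<open>{field, finite}\<close>
  with \<open>q = CARD('a)\<close>; a finite field always has prime power order.
\<close>

definition sqfree_monic :: "nat \<Rightarrow> 'a::field poly set" where
  "sqfree_monic d = {f. lead_coeff f = 1 \<and> squarefree f \<and> degree f = d}"

definition roots_of_unity :: "nat \<Rightarrow> 'a::field set" where
  "roots_of_unity l = {x. x ^ l = 1}"

definition roots_of_unity_group :: "nat \<Rightarrow> 'a::field monoid" where
  "roots_of_unity_group l = \<lparr>carrier = roots_of_unity l, monoid.mult = (*), one = 1\<rparr>"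

text \<open>
  The parameter \<open>\<Omega>\<close> is meant to be an isomorphism from the \<open>l\<close>-th roots of unity of the
  finite field to those of the complex numbers; only its values on roots of unity matter, so
  its inverse is taken relative to that set. The exponent \<open>(q ^ degree \<pi> - 1) div l\<close> is an
  exact quotient as soon as \<open>l\<close> divides \<open>q - 1\<close>.
\<close>

definition residue_symbol_irred ::
  "('a::{field,finite} \<Rightarrow> complex) \<Rightarrow> nat \<Rightarrow> 'a poly \<Rightarrow> 'a poly \<Rightarrow> complex" where
  "residue_symbol_irred \<Omega> l a \<pi> =
     (if \<pi> dvd a then 0
      else (THE \<alpha>. \<alpha> \<in> roots_of_unity l \<and>
              [a ^ ((CARD('a) ^ degree \<pi> - 1) div l)
                 = [:inv_into (roots_of_unity l) \<Omega> \<alpha>:]] (mod \<pi>)))"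

text \<open>
  The exponent of \<open>\<pi>\<close> in \<open>c \<noteq> 0\<close>. This is what the library's \<open>multiplicity\<close> unfolds to; that
  constant is not available for polynomials whose coefficient type is merely of sort \<open>field\<close>.
\<close>

definition irred_exponent :: "'a::field poly \<Rightarrow> 'a poly \<Rightarrow> nat" where
  "irred_exponent \<pi> c = Max {e. \<pi> ^ e dvd c}"

definition residue_symbol ::
  "('a::{field,finite} \<Rightarrow> complex) \<Rightarrow> nat \<Rightarrow> 'a poly \<Rightarrow> 'a poly \<Rightarrow> complex" where
  "residue_symbol \<Omega> l a c =
     (\<Prod>\<pi> | lead_coeff \<pi> = 1 \<and> irreducible \<pi> \<and> \<pi> dvd c.
        residue_symbol_irred \<Omega> l a \<pi> ^ irred_exponent \<pi> c)"

end

theory Submission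
  imports Defs "HOL-Algebra.Algebraic_Closure_Type"
begin

hide_const (open) Polynomials.degree Polynomials.lead_coeff up_ring.coeff UnivPoly.monom
  Divisibility.irreducible Divisibility.prime Coset.order

text \<open>
  The argument follows Heath-Brown's large sieve for cubic symbols. Write \<open>B(m, n)\<close> for the norm of the
  sieve with \<open>M\<close> and \<open>N\<close> square-free of degrees \<open>m\<close> and \<open>n\<close>. Since \<open>q \<equiv> 1\<close> modulo \<open>2 l\<close>, reciprocity has no
  sign, so \<open>B\<close> is symmetric by duality. Opening the square and extending \<open>M\<close> to all monic polynomials, a pair
  of moduli with greatest common divisor \<open>G\<close> leads to the sum of \<open>\<chi>\<^sub>A\<close> times the conjugate of \<open>\<chi>\<^sub>B\<close> over \<open>M\<close>,
  with coprime \<open>A\<close> and \<open>B\<close> of equal degree \<open>k\<close>. This character is even and primitive, and Poisson summation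
  turns the sum into one of length \<open>2 k - m\<close>; by reciprocity its Gauss sum factors over \<open>A\<close> and \<open>B\<close>, so
  that a sieve of the same shape over all monic \<open>K\<close> reappears. Writing \<open>K\<close> as \<open>A B\<^sup>2 G\<^sup>4\<close>, one applies the
  bound already known to \<open>A\<close> if \<open>A\<close> has the larger degree, and orthogonality of the squared symbol
  (nontrivial as \<open>l \<ge> 3\<close>) to \<open>B\<close> otherwise. A bound with an additional term \<open>q\<close> to the power
  \<open>(4 / 3 + \<delta>) min m n\<close> is thereby improved to \<open>2 \<delta> / 3\<close> in place of \<open>\<delta>\<close>, and the orthogonality bound provides
  the start \<open>\<delta> = 2 / 3\<close>.
\<close>

section \<open>Monic polynomials and sets of irreducible factors\<close>

text \<open>Poisson summation needs the outer variable to run through all monic polynomials, while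
  duality with reciprocity needs both variables square-free; hence the two predicates
  \<open>sieve\<close> and \<open>sieve_sf\<close>. Passing from the first to the second is a mere
  restriction. The way back is the factorisation of \<open>K\<close> of degree \<open>j\<close>, and
  it costs up to \<open>q powr (j / 3)\<close>; the critical case is that of \<open>A\<close> and
  \<open>B\<close> of equal degree and trivial \<open>G\<close>. For \<open>n <= m\<close> the
  extreme dual degree is \<open>j = 2 * n - m\<close>, and Poisson summation turns this loss into
  exactly the exponent \<open>2 * (m + n) / 3\<close> of the theorem. On the diagonal this exponent
  is \<open>4 / 3 * n\<close>, so a further term with exponent \<open>4 / 3 * min m n\<close> is
  harmless and only the excess \<delta> has to be removed. Every step loses a constant and an
  arbitrarily small power; the number of steps depends on \<epsilon> alone, so these losses are
  affordable.\<close>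

definition mirr :: "'a::field poly set" where
  "mirr = {p. lead_coeff p = 1 \<and> irreducible p}"

definition monics :: "nat \<Rightarrow> 'a::field poly set" where
  "monics m = {f. lead_coeff f = 1 \<and> degree f = m}"

text \<open>Boxes of this kind are exchanged by Poisson summation: each is an additive group, and
  for \<open>j = degree c\<close> a complete residue system modulo \<open>c\<close>. Zero is listed
  separately because its degree is 0 by convention.\<close>

definition below :: "nat \<Rightarrow> 'a::field poly set" where
  "below j = {f. f = 0 \<or> degree f < j}"

text \<open>A square-free monic polynomial of degree \<open>n\<close> is encoded by its set of monic irreducible factors, so that
  greatest common divisors and coprimality become intersections and disjointness.\<close>

definition psets :: "nat \<Rightarrow> 'a::field poly set set" where
  "psets n = {S. finite S \<and> S \<subseteq> mirr \<and> sum degree S = n}"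

lemma below_0 [simp]: "below 0 = {0}"
  by (auto simp: below_def)

lemma zero_in_below [simp]: "0 \<in> below j"
  by (auto simp: below_def)

lemma below_Suc: "below (Suc j) = (\<lambda>(a, p). pCons a p) ` (UNIV \<times> below j)"
proof (intro equalityI subsetI)
  fix f :: "'a poly" assume f: "f \<in> below (Suc j)"
  obtain a p where "f = pCons a p" by (cases f) auto
  with f show "f \<in> (\<lambda>(a, p). pCons a p) ` (UNIV \<times> below j)"
    by (auto simp: below_def split: if_splits)
qed (auto simp: below_def split: if_splits)

lemma finite_below [simp, intro]: "finite (below j :: 'a::{field,finite} poly set)"
  by (induction j) (auto simp: below_Suc)

lemma card_below: "card (below j :: 'a::{field,finite} poly set) = CARD('a) ^ j"
proof (induction j)
  case (Suc j)
  have "inj_on (\<lambda>(a, p). pCons a p) (UNIV \<times> (below j :: 'a poly set))"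
    by (auto simp: inj_on_def)
  then show ?case
    using Suc by (simp add: below_Suc card_image card_cartesian_product)
qed simp

lemma below_mono: "i \<le> j \<Longrightarrow> below i \<subseteq> below j"
  by (auto simp: below_def)

lemma below_add: "x \<in> below j \<Longrightarrow> y \<in> below j \<Longrightarrow> x + y \<in> below j"
  by (auto simp: below_def intro: degree_add_less)

lemma below_diff: "x \<in> below j \<Longrightarrow> y \<in> below j \<Longrightarrow> x - y \<in> below j"
  by (auto simp: below_def intro: degree_diff_less)

lemma monics_eq: "monics m = (\<lambda>r. monom 1 m + r) ` below m"
proof (intro equalityI subsetI)
  fix f :: "'a poly" assume f: "f \<in> monics m"
  have "degree (f - monom 1 m) < m \<or> f - monom 1 m = 0"
  proof (cases "f - monom 1 m = 0")
    case False
    have "degree (f - monom 1 m) \<le> m" using f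
      by (intro degree_diff_le) (auto simp: monics_def degree_monom_le)
    moreover have "coeff (f - monom 1 m) m = 0"
      using f by (auto simp: monics_def)
    ultimately show ?thesis
      using False by (metis le_neq_implies_less leading_coeff_0_iff)
  qed simp
  then show "f \<in> (\<lambda>r. monom 1 m + r) ` below m"
    by (intro image_eqI[of _ _ "f - monom 1 m"]) (auto simp: below_def)
next
  fix f :: "'a poly" assume "f \<in> (\<lambda>r. monom 1 m + r) ` below m"
  then obtain r where r: "f = monom 1 m + r" "r \<in> below m" by auto
  show "f \<in> monics m"
  proof (cases "r = 0")
    case False
    with r have "degree r < degree (monom (1::'a) m)" by (auto simp: below_def degree_monom_eq)
    then have "degree f = m" "coeff f m = 1"
      using r by (auto simp: degree_add_eq_left degree_monom_eq coeff_eq_0)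
    then show ?thesis by (auto simp: monics_def)
  qed (use r in \<open>auto simp: monics_def degree_monom_eq\<close>)
qed

lemma finite_monics [simp, intro]: "finite (monics j :: 'a::{field,finite} poly set)"
  by (auto simp: monics_eq)

lemma card_monics: "card (monics j :: 'a::{field,finite} poly set) = CARD('a) ^ j"
  by (simp add: monics_eq card_image inj_on_def card_below)

lemma monics_nz: "x \<in> monics i \<Longrightarrow> x \<noteq> 0"
  by (auto simp: monics_def)

lemma monics_mult: "x \<in> monics i \<Longrightarrow> y \<in> monics j \<Longrightarrow> x * y \<in> monics (i + j)"
  using lead_coeff_mult[of x y] degree_mult_eq[OF monics_nz monics_nz, of x i y j]
  by (auto simp: monics_def)

lemma monics_power: "x \<in> monics i \<Longrightarrow> x ^ k \<in> monics (i * k)"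
  using lead_coeff_power[of x k] degree_power_eq[OF monics_nz, of x i k] by (auto simp: monics_def mult.commute)

lemma mod_below: "c \<noteq> 0 \<Longrightarrow> x mod c \<in> below (degree c)"
  using degree_mod_less[of c x] by (auto simp: below_def)

lemma below_mod: "x \<in> below (degree c) \<Longrightarrow> x mod c = x"
  by (auto simp: below_def mod_poly_less)

section \<open>Monic irreducible polynomials and factorisation of square-free ones\<close>

lemma mirrD:
  assumes p: "p \<in> mirr"
  shows "lead_coeff p = 1" "irreducible p" "p \<noteq> 0" "prime_elem p" "\<not> is_unit p" "degree p > 0"
proof -
  show 1: "lead_coeff p = 1" "irreducible p" using p by (auto simp: mirr_def)
  then show "p \<noteq> 0" "prime_elem p" by (auto intro: field_poly_irreducible_imp_prime)
  then show "\<not> is_unit p" "degree p > 0" using is_unit_iff_degree[of p] by (auto simp: prime_elem_def)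
qed

lemma mirr_monics: "p \<in> mirr \<Longrightarrow> p \<in> monics (degree p)"
  by (auto simp: mirr_def monics_def)

lemma prod_monics: "finite A \<Longrightarrow> (\<And>p. p \<in> A \<Longrightarrow> f p \<in> monics (d p)) \<Longrightarrow> prod f A \<in> monics (sum d A)"
proof (induction A rule: finite_induct)
  case empty
  then show ?case by (simp add: monics_def)
next
  case (insert p A)
  then have "f p * prod f A \<in> monics (d p + sum d A)" by (intro monics_mult) blast+
  then show ?case using insert by simp
qed

lemma pset_monics: "S \<in> psets n \<Longrightarrow> \<Prod>S \<in> monics n"
proof -
  assume S: "S \<in> psets n"
  have "\<Prod>S \<in> monics (sum degree S)"
    by (rule prod_monics) (use S in \<open>auto simp: psets_def intro!: mirr_monics\<close>)
  then show ?thesis using S by (simp add: psets_def)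
qed

lemma monic_degree_0:
  assumes "lead_coeff k = 1" "degree k = 0" shows "k = (1::'a::field poly)"
proof -
  obtain c where "k = [:c:]" using degree_eq_zeroE[OF assms(2)] by blast
  then show ?thesis using assms by (simp add: one_pCons)
qed

lemma monic_dvd_eq:
  assumes "lead_coeff p = 1" "lead_coeff r = 1" "p dvd r" "degree p = degree (r::'a::field poly)"
  shows "p = r"
proof -
  obtain k where k: "r = p * k" using assms(3) by (auto simp: dvd_def)
  have nz: "p \<noteq> 0" "r \<noteq> 0" using assms(1,2) by auto
  then have "k \<noteq> 0" using k by auto
  then have "degree r = degree p + degree k" using nz k by (simp add: degree_mult_eq)
  then have "degree k = 0" using assms(4) by linarith
  moreover have "lead_coeff k = 1" using lead_coeff_mult[of p k] assms(1,2) unfolding k by simp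
  ultimately have "k = 1" using monic_degree_0 by blast
  then show ?thesis using k by simp
qed

lemma mirr_dvd_eq: "p \<in> mirr \<Longrightarrow> r \<in> mirr \<Longrightarrow> p dvd r \<Longrightarrow> p = r"
proof -
  assume a: "p \<in> mirr" "r \<in> mirr" "p dvd r"
  then obtain k where k: "r = p * k" by (auto simp: dvd_def)
  then have "is_unit k" using a mirrD(2)[of r] mirrD(5)[of p] Factorial_Ring.irreducibleD by blast
  then have "degree k = 0" using is_unit_iff_degree[of k] by fastforce
  then have "degree p = degree r" using k degree_mult_eq[of p k] mirrD(3)[OF a(2)] by auto
  then show ?thesis using a by (intro monic_dvd_eq) (auto simp: mirr_def)
qed

lemma prime_elem_dvd_prod:
  "finite A \<Longrightarrow> prime_elem p \<Longrightarrow> p dvd prod f A \<Longrightarrow> \<exists>a\<in>A. p dvd f a"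
proof (induction A rule: finite_induct)
  case empty
  then show ?case by (simp add: prime_elem_def)
next
  case (insert x A)
  then show ?case using prime_elem_dvd_mult_iff[of p "f x" "prod f A"] by auto
qed

lemma mirr_not_dvd_prod: "finite A \<Longrightarrow> A \<subseteq> mirr \<Longrightarrow> p \<in> mirr \<Longrightarrow> p dvd \<Prod>A \<Longrightarrow> p \<in> A"
  using prime_elem_dvd_prod[of A p "\<lambda>x. x"] mirr_dvd_eq mirrD(4) by blast

lemma prod_mirr_dvd:
  "finite A \<Longrightarrow> A \<subseteq> mirr \<Longrightarrow> (\<And>p. p \<in> A \<Longrightarrow> p dvd y) \<Longrightarrow> \<Prod>A dvd y"
proof (induction A rule: finite_induct)
  case (insert p A)
  then obtain w where w: "y = \<Prod>A * w" by (auto simp: dvd_def)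
  have "\<not> p dvd \<Prod>A" using insert mirr_not_dvd_prod[of A p] by auto
  moreover have "p dvd \<Prod>A * w" using insert.prems w by auto
  ultimately have "p dvd w" using insert.prems mirrD(4)[of p] prime_elem_dvd_mult_iff by blast
  then show ?case using insert w by (auto simp: dvd_def algebra_simps)
qed auto

lemma exists_mirr_dvd:
  fixes f :: "'a::field poly"
  assumes "degree f > 0" shows "\<exists>p\<in>mirr. p dvd f"
  using assms
proof (induction "degree f" arbitrary: f rule: less_induct)
  case less
  show ?case
  proof (cases "irreducible f")
    case True
    define g where "g = [:inverse (lead_coeff f):] * f"
    have f0: "f \<noteq> 0" using less by auto
    have "is_unit [:inverse (lead_coeff f):]" using f0 by (simp add: is_unit_triv)
    then have "irreducible g" using True unfolding g_def by (simp only: irreducible_mult_unit_left)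
    then have "g \<in> mirr" using f0 by (auto simp: mirr_def g_def)
    moreover have "g dvd f" using f0 by (auto simp: g_def smult_dvd_iff)
    ultimately show ?thesis by auto
  next
    case False
    have f0: "f \<noteq> 0" using less.prems by auto
    have nu: "\<not> is_unit f" using less.prems is_unit_iff_degree[OF f0] by simp
    then obtain a b where ab: "f = a * b" "\<not> is_unit a" "\<not> is_unit b"
      using False f0 nu Factorial_Ring.irreducibleI[of f] by blast
    then have "a \<noteq> 0" "b \<noteq> 0" "degree a > 0" "degree b > 0" using f0 by (auto simp: is_unit_iff_degree)
    then have "degree a < degree f" using ab by (simp add: degree_mult_eq)
    then obtain p where "p \<in> mirr" "p dvd a" using less \<open>degree a > 0\<close> by blast
    then show ?thesis using ab dvd_mult2 by blast
  qed
qed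

lemma monic_factor:
  assumes "lead_coeff (p * w) = 1" "lead_coeff p = 1"
  shows "lead_coeff (w :: 'a::field poly) = 1"
  using lead_coeff_mult[of p w] assms by auto

text \<open>The inverse sends \<open>N\<close> to its monic irreducible divisors. Their product
  divides \<open>N\<close> with a monic cofactor; an irreducible divisor of the cofactor would
  divide \<open>N\<close> twice, so the cofactor is 1.\<close>

lemma bij_betw_psets: "bij_betw (\<lambda>S. \<Prod>S) (psets n :: 'a::field poly set set) (sqfree_monic n)"
proof (rule bij_betwI[where g = "\<lambda>N. {p \<in> mirr. p dvd N}"])
  have "\<Prod>S \<in> sqfree_monic n" if S: "S \<in> psets n" for S :: "'a poly set"
  proof -
    have fin: "finite S" "S \<subseteq> mirr" using S by (auto simp: psets_def)
    have "squarefree (\<Prod>S)"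
    proof (rule squarefreeI)
      fix x assume x: "x\<^sup>2 dvd \<Prod>S"
      show "is_unit x"
      proof (rule ccontr)
        assume "\<not> is_unit x"
        moreover have "x \<noteq> 0" using x pset_monics[OF S] monics_nz by fastforce
        ultimately have "degree x > 0" by (simp add: is_unit_iff_degree)
        then obtain p where p: "p \<in> mirr" "p dvd x" using exists_mirr_dvd by blast
        have "p * p dvd \<Prod>S" using p(2) x by (metis dvd_trans mult_dvd_mono power2_eq_square)
        moreover from this have "p \<in> S" using mirr_not_dvd_prod[OF fin p(1)] by (auto dest: dvd_mult_left)
        moreover have "\<Prod>S = p * \<Prod>(S - {p})" using fin \<open>p \<in> S\<close> by (simp add: prod.remove)
        ultimately have "p dvd \<Prod>(S - {p})" using mirrD(3)[OF p(1)] by simp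
        then show False using mirr_not_dvd_prod[of "S - {p}" p] fin p by auto
      qed
    qed
    then show ?thesis using pset_monics[OF S] by (auto simp: sqfree_monic_def monics_def)
  qed
  then show "(\<lambda>S. \<Prod>S) \<in> (psets n :: 'a poly set set) \<rightarrow> sqfree_monic n" by auto
  show inv2: "{p \<in> mirr. p dvd \<Prod>S} = S" if "S \<in> psets n" for S :: "'a poly set"
    using that mirr_not_dvd_prod[of S] by (auto simp: psets_def dvd_prodI)
  have key: "finite {p \<in> mirr. p dvd N} \<and> \<Prod>{p \<in> mirr. p dvd N} = N" if N: "N \<in> sqfree_monic n" for N :: "'a poly"
  proof -
    define S where "S = {p \<in> mirr. p dvd N}"
    have N0: "N \<noteq> 0" using N by (auto simp: sqfree_monic_def)
    \<comment> \<open>The field may be infinite here, so the number of irreducible divisors is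
      bounded through their degrees, each at least 1.\<close>
    have bound: "card F \<le> degree N" if "F \<subseteq> S" "finite F" for F
    proof -
      have "\<Prod>F dvd N" using that prod_mirr_dvd[of F N] by (auto simp: S_def)
      then have "degree (\<Prod>F) \<le> degree N" using N0 by (simp add: dvd_imp_degree_le)
      moreover have "degree (\<Prod>F) = sum degree F"
        using that mirrD(3) by (intro degree_prod_sum_eq) (auto simp: S_def)
      moreover have "sum (\<lambda>_. 1) F \<le> sum degree F" using that mirrD(6) by (intro sum_mono) (force simp: S_def)
      ultimately show ?thesis by simp
    qed
    have fin: "finite S"
    proof (rule ccontr)
      assume "infinite S"
      then obtain F where "finite F" "card F = Suc (degree N)" "F \<subseteq> S"
        using infinite_arbitrarily_large by blast
      then show False using bound[of F] by simp
    qed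
    have sub: "S \<subseteq> mirr" by (auto simp: S_def)
    obtain w where w: "N = \<Prod>S * w" using prod_mirr_dvd[OF fin sub, of N] by (auto simp: S_def dvd_def)
    have lw: "lead_coeff w = 1"
    proof (rule monic_factor)
      show "lead_coeff (\<Prod>S * w) = 1" using N w by (auto simp: sqfree_monic_def)
      show "lead_coeff (\<Prod>S) = 1" using sub by (auto simp: lead_coeff_prod mirr_def intro!: prod.neutral)
    qed
    have "degree w = 0"
    proof (rule ccontr)
      assume "degree w \<noteq> 0"
      then obtain p where p: "p \<in> mirr" "p dvd w" using exists_mirr_dvd[of w] by blast
      have "p dvd N" by (subst w) (use p in simp)
      then have "p \<in> S" using p by (auto simp: S_def)
      then have "p dvd \<Prod>S" using fin by (auto intro: dvd_prodI)
      then have "p\<^sup>2 dvd N" by (subst w) (use p in \<open>auto simp: power2_eq_square intro: mult_dvd_mono\<close>)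
      then have "is_unit p" using N by (auto simp: sqfree_monic_def squarefree_def)
      then show False using mirrD(5)[OF p(1)] by simp
    qed
    then have "w = 1" using monic_degree_0[OF lw] by blast
    then show ?thesis using fin w unfolding S_def[symmetric] by simp
  qed
  show "\<Prod>{p \<in> mirr. p dvd N} = N" if "N \<in> sqfree_monic n" for N :: "'a poly" using key[OF that] by simp
  have "{p \<in> mirr. p dvd N} \<in> psets n" if N: "N \<in> sqfree_monic n" for N :: "'a poly"
  proof -
    have "sum degree {p \<in> mirr. p dvd N} = degree (\<Prod>{p \<in> mirr. p dvd N})"
      using mirrD(3) by (intro degree_prod_sum_eq[symmetric]) auto
    then show ?thesis using key[OF N] N by (auto simp: psets_def sqfree_monic_def)
  qed
  then show "(\<lambda>N. {p \<in> mirr. p dvd N}) \<in> (sqfree_monic n :: 'a poly set) \<rightarrow> psets n" by auto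
qed

lemma sqfree_sub_monics: "sqfree_monic n \<subseteq> monics n"
  by (auto simp: sqfree_monic_def monics_def)

lemma finite_psets [simp, intro]: "finite (psets n :: 'a::{field,finite} poly set set)"
  using bij_betw_finite[OF bij_betw_psets] finite_subset[OF sqfree_sub_monics] finite_monics by blast

lemma card_psets: "card (psets n :: 'a::{field,finite} poly set set) \<le> CARD('a) ^ n"
proof -
  have "card (psets n :: 'a poly set set) = card (sqfree_monic n :: 'a poly set)"
    by (rule bij_betw_same_card[OF bij_betw_psets])
  also have "\<dots> \<le> card (monics n :: 'a poly set)" by (intro card_mono) (auto simp: sqfree_sub_monics)
  finally show ?thesis by (simp add: card_monics)
qed

lemma irred_exponent_pset:
  assumes "S \<in> psets n" "p \<in> S"
  shows "irred_exponent p (\<Prod>S) = 1"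
proof -
  have fin: "finite S" "S \<subseteq> mirr" and p: "p \<in> mirr" using assms by (auto simp: psets_def)
  have S: "\<Prod>S = p * \<Prod>(S - {p})" using fin assms by (simp add: prod.remove)
  have nd: "\<not> p dvd \<Prod>(S - {p})" using mirr_not_dvd_prod[of "S - {p}" p] fin p by auto
  have "{e. p ^ e dvd \<Prod>S} = {0, 1}"
  proof (intro equalityI subsetI)
    fix e assume e: "e \<in> {e. p ^ e dvd \<Prod>S}"
    show "e \<in> {0, 1}"
    proof (rule ccontr)
      assume "e \<notin> {0, 1}"
      then have "p ^ 2 dvd p ^ e" by (intro le_imp_power_dvd) auto
      then have "p * p dvd p * \<Prod>(S - {p})" using e S by (metis dvd_trans mem_Collect_eq power2_eq_square)
      then show False using nd mirrD(3)[OF p] by simp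
    qed
  qed (auto simp: S)
  then show ?thesis by (simp add: irred_exponent_def)
qed

section \<open>Additive characters\<close>

text \<open>The construction maps a maximal proper additive subgroup \<open>K\<close> to 1 and an element outside of it to a
  primitive \<open>p\<close>-th root of unity, where \<open>p\<close> is the characteristic.\<close>

lemma ex_addchar:
  "\<exists>f :: 'a::{field,finite} \<Rightarrow> complex. (\<forall>x y. f (x + y) = f x * f y) \<and> (\<forall>x. cmod (f x) = 1) \<and> (\<exists>x. f x \<noteq> 1)"
proof -
  define sub where "sub = (\<lambda>K::'a set. 0 \<in> K \<and> (\<forall>x\<in>K. \<forall>y\<in>K. x - y \<in> K))"
  define p where "p = int CHAR('a)"
  have fin: "finite {K. sub K \<and> K \<noteq> UNIV}" by simp
  have "(1::'a) \<notin> {0}" by simp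
  then have "{0} \<noteq> (UNIV :: 'a set)" by blast
  moreover have "sub {0}" by (simp add: sub_def)
  ultimately have ne: "{K. sub K \<and> K \<noteq> UNIV} \<noteq> {}" by blast
  obtain K where K: "sub K" "K \<noteq> UNIV" and Kmax: "\<And>L. sub L \<Longrightarrow> L \<noteq> UNIV \<Longrightarrow> card L \<le> card K"
  proof -
    have "Max (card ` {K. sub K \<and> K \<noteq> UNIV}) \<in> card ` {K. sub K \<and> K \<noteq> UNIV}"
      using fin ne by (intro Max_in) auto
    then obtain K where "K \<in> {K. sub K \<and> K \<noteq> UNIV}" "card K = Max (card ` {K. sub K \<and> K \<noteq> UNIV})"
      by (metis (no_types, lifting) imageE)
    moreover have "card L \<le> Max (card ` {K. sub K \<and> K \<noteq> UNIV})" if "sub L" "L \<noteq> UNIV" for L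
      using that fin by (intro Max_ge) auto
    ultimately show ?thesis using that[of K] by auto
  qed
  obtain v where v: "v \<notin> K" using K by auto
  have K0: "0 \<in> K" and Kd: "\<And>x y. x \<in> K \<Longrightarrow> y \<in> K \<Longrightarrow> x - y \<in> K" using K by (auto simp: sub_def)
  have Kn: "- x \<in> K" if "x \<in> K" for x using Kd[OF K0 that] by simp
  have Ka: "x + y \<in> K" if "x \<in> K" "y \<in> K" for x y using Kd[OF that(1) Kn[OF that(2)]] by simp
  have Kz: "of_nat i * x \<in> K" if "x \<in> K" for x i
    by (induction i) (auto simp: K0 algebra_simps intro: Ka that)
  have Ki: "of_int i * x \<in> K" if "x \<in> K" for x i
    using Kz[OF that, of "nat \<bar>i\<bar>"] Kn[of "of_nat (nat \<bar>i\<bar>) * x"]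
    by (cases "i \<ge> 0") (auto simp: of_nat_nat)
  have pp: "prime (nat p)" unfolding p_def
    using prime_CHAR_semidom[where ?'a = 'a] finite_imp_CHAR_pos[where ?'a = 'a] by simp
  \<comment> \<open>Otherwise \<open>i\<close> is invertible modulo the characteristic, and Bezout
    recovers \<open>v\<close> from \<open>of_int i * v\<close>, so \<open>v\<close> would lie in
    \<open>K\<close>.\<close>
  have dv: "p dvd i" if "of_int i * v \<in> K" for i
  proof (rule ccontr)
    assume "\<not> p dvd i"
    moreover have "prime p" using pp by (simp add: p_def)
    ultimately have "coprime p i" by (simp add: prime_imp_coprime)
    then obtain a b where "a * p + b * i = 1" by (metis bezout_int coprime_iff_gcd_eq_1)
    then have "of_int (a * p + b * i) = (1::'a)" by simp
    then have "of_int b * of_int i = (1::'a)" by (simp add: p_def)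
    then have "of_int b * (of_int i * v) = v" by (simp only: mult.assoc[symmetric] mult_1)
    then show False using Ki[OF that, of b] v by metis
  qed
  have all: "\<exists>i::int. x - of_int i * v \<in> K" for x
  proof -
    \<comment> \<open>\<open>L\<close> is the subgroup generated by \<open>K\<close> and
      \<open>v\<close>; it is strictly larger than \<open>K\<close>, hence everything by
      maximality.\<close>
    define L where "L = {x. \<exists>i::int. x - of_int i * v \<in> K}"
    have "sub L" unfolding sub_def
    proof (intro conjI ballI)
      show "0 \<in> L" using K0 by (auto simp: L_def intro!: exI[of _ 0])
      fix x y assume "x \<in> L" "y \<in> L"
      then obtain i j where "x - of_int i * v \<in> K" "y - of_int j * v \<in> K" by (auto simp: L_def)
      from Kd[OF this] have "(x - y) - of_int (i - j) * v \<in> K" by (simp add: algebra_simps)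
      then show "x - y \<in> L" unfolding L_def by blast
    qed
    moreover have "K \<subseteq> L" by (auto simp: L_def intro!: exI[of _ 0])
    moreover have "v \<in> L" using K0 by (auto simp: L_def intro!: exI[of _ 1])
    then have "card K < card L" using v \<open>K \<subseteq> L\<close> by (intro psubset_card_mono) auto
    ultimately have "L = UNIV" using Kmax[of L] by fastforce
    then show ?thesis by (auto simp: L_def)
  qed
  define g where "g = (\<lambda>i::int. cis (2 * pi * real_of_int i / real_of_int p))"
  have p2: "p \<ge> 2" using prime_ge_2_nat[OF pp] by simp
  have gadd: "g (i + j) = g i * g j" for i j by (simp add: g_def cis_mult add_divide_distrib distrib_left)
  have gp: "g (k * p) = 1" for k
    using p2 cis_multiple_2pi[of "real_of_int k"] by (simp add: g_def mult_ac)
  have gcong: "g i = g j" if ij: "p dvd i - j" for i j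
  proof -
    obtain k where "i - j = p * k" using ij by (elim dvdE)
    then have "i = j + k * p" by (simp add: algebra_simps)
    then show ?thesis by (simp add: gadd gp)
  qed
  \<comment> \<open>The multiple of \<open>v\<close> is determined only modulo \<open>p\<close> (by
    \<open>dv\<close>), but \<open>p\<close> is a period of \<open>g\<close>, so the choice does not
    matter.\<close>
  define f where "f = (\<lambda>x. g (SOME i. x - of_int i * v \<in> K))"
  have fI: "f x = g i" if "x - of_int i * v \<in> K" for x i
  proof -
    define j where "j = (SOME i. x - of_int i * v \<in> K)"
    have "x - of_int j * v \<in> K" unfolding j_def using that by (rule someI)
    from Kd[OF that this] have "of_int (j - i) * v \<in> K" by (simp add: algebra_simps)
    then show ?thesis unfolding f_def j_def[symmetric] by (intro gcong dv)
  qed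
  show ?thesis
  proof (intro exI[of _ f] conjI allI)
    fix x y
    obtain i j where ij: "x - of_int i * v \<in> K" "y - of_int j * v \<in> K" using all by blast
    from Ka[OF this] have "(x + y) - of_int (i + j) * v \<in> K" by (simp add: algebra_simps)
    from fI[OF this] show "f (x + y) = f x * f y" by (simp add: fI[OF ij(1)] fI[OF ij(2)] gadd)
  next
    fix x show "cmod (f x) = 1" by (simp add: f_def g_def)
  next
    have "f v = g 1" by (rule fI) (simp add: K0)
    moreover have "g 1 \<noteq> 1"
    proof
      assume a: "g 1 = 1"
      have "inj_on (\<lambda>k. cis (2 * pi * real k / real (nat p))) {..<nat p}"
        using bij_betw_roots_unity[of "nat p"] p2 by (auto simp: bij_betw_def)
      then have "(1::nat) = 0" by (rule inj_onD) (use p2 a in \<open>auto simp: g_def\<close>)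
      then show False by simp
    qed
    ultimately have "f v \<noteq> 1" by simp
    then show "\<exists>x. f x \<noteq> 1" by blast
  qed
qed

definition addchar :: "'a::{field,finite} \<Rightarrow> complex" where
  "addchar = (SOME f. (\<forall>x y. f (x + y) = f x * f y) \<and> (\<forall>x. cmod (f x) = 1) \<and> (\<exists>x. f x \<noteq> 1))"

lemma addchar_add: "addchar (x + y) = addchar x * addchar y"
  and addchar_norm: "cmod (addchar x) = 1"
  and addchar_nontriv: "\<exists>x::'a::{field,finite}. addchar x \<noteq> 1"
  using someI_ex[OF ex_addchar] by (auto simp: addchar_def)

lemma addchar_0 [simp]: "addchar (0::'a::{field,finite}) = 1"
proof -
  have "addchar (0::'a) \<noteq> 0" using addchar_norm[of "0::'a"] by (metis norm_zero zero_neq_one)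
  then show ?thesis using addchar_add[of "0::'a" 0] by simp
qed

lemma addchar_minus: "addchar (- x) = cnj (addchar x)"
proof -
  have "addchar (- x) * addchar x = 1" using addchar_add[of "-x" x] by simp
  moreover have "cnj (addchar x) * addchar x = 1"
    using addchar_norm[of x] by (simp add: complex_norm_square[symmetric] mult.commute)
  moreover have "addchar x \<noteq> 0" using addchar_norm[of x] by auto
  ultimately show ?thesis by (metis mult_right_cancel)
qed

text \<open>For monic \<open>c\<close> the coefficient taken here is the residue of \<open>x / c\<close> at infinity.\<close>

definition res_char :: "'a::{field,finite} poly \<Rightarrow> 'a poly \<Rightarrow> complex" where
  "res_char c x = addchar (coeff (x mod c) (degree c - 1))"

lemma res_char_add: "res_char c (x + y) = res_char c x * res_char c y"
  by (simp add: res_char_def poly_mod_add_left addchar_add)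

lemma res_char_0 [simp]: "res_char c 0 = 1"
  by (simp add: res_char_def)

lemma res_char_mod: "res_char c (x mod c) = res_char c x"
  by (simp add: res_char_def)

lemma res_char_minus: "res_char c (- x) = cnj (res_char c x)"
  by (simp add: res_char_def poly_mod_minus_left addchar_minus)

text \<open>The fractions \<open>x * b / (a * b)\<close> and \<open>x / a\<close> coincide. Since
  \<open>res_char\<close> reads a coefficient of the remainder without normalising it, the cancelled
  factor is taken monic.\<close>

lemma res_char_scale:
  assumes a: "a \<noteq> 0" and b: "lead_coeff b = 1"
  shows "res_char (a * b) (x * b) = res_char a x"
\<comment> \<open>Here \<open>degree a - 1\<close> truncates to 0, but both remainders are zero, so
  the coefficient that is read vanishes anyway.\<close>
proof (cases "degree a = 0")
  case True
  then have "is_unit a" using a by (simp add: is_unit_iff_degree)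
  then have "x mod a = 0" by (simp add: unit_imp_mod_eq_0)
  then show ?thesis by (simp add: res_char_def mod_mult_mult2)
next
  case False
  have b0: "b \<noteq> 0" using b by auto
  define r where "r = x mod a"
  have r: "degree r \<le> degree a - 1" using degree_mod_less'[of a x] a False by (cases "r = 0") (auto simp: r_def)
  have "coeff (r * b) (degree a - 1 + degree b) = coeff r (degree a - 1)"
  proof (cases "degree r = degree a - 1")
    case True then show ?thesis using coeff_mult_degree_sum[of r b] b by simp
  next
    case False
    with r have "degree r < degree a - 1" by simp
    moreover have "degree (r * b) \<le> degree r + degree b" by (rule degree_mult_le)
    ultimately show ?thesis by (simp add: coeff_eq_0)
  qed
  moreover have "degree (a * b) - 1 = degree a - 1 + degree b" using a b0 False by (simp add: degree_mult_eq)
  ultimately show ?thesis by (simp add: res_char_def mod_mult_mult2 r_def)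
qed

text \<open>The annihilator of the box \<open>below i\<close> is a box as well: for short
  \<open>x\<close> the products do not reach the coefficient that is read, while a longer
  \<open>x\<close> gives a nontrivial character of the additive group
  \<open>below i\<close>.\<close>

lemma res_char_orthogonality:
  fixes c :: "'a::{field,finite} poly"
  assumes x: "x \<in> below (degree c)" and i: "i \<le> degree c"
  shows "(\<Sum>K\<in>below i. res_char c (K * x)) = (if x \<in> below (degree c - i) then of_nat CARD('a) ^ i else 0)"
proof (cases "x \<in> below (degree c - i)")
  case True
  have "res_char c (K * x) = 1" if K: "K \<in> below i" for K
  proof (cases "K = 0 \<or> x = 0")
    case False
    then have "degree K < i" "degree x < degree c - i" "degree (K * x) = degree K + degree x"
      using K True by (auto simp: below_def degree_mult_eq)
    then have "degree (K * x) < degree c - 1" by linarith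
    moreover from this have "(K * x) mod c = K * x" by (intro mod_poly_less) auto
    ultimately show ?thesis by (simp add: res_char_def coeff_eq_0)
  qed auto
  then show ?thesis using True by (simp add: card_below)
next
  case False
  then have x0: "x \<noteq> 0" "degree c - i \<le> degree x" "degree x < degree c" using x by (auto simp: below_def)
  obtain w :: 'a where w: "addchar w \<noteq> 1" using addchar_nontriv by blast
  \<comment> \<open>Multiplication by \<open>K0\<close> moves the leading term of \<open>x\<close>
    exactly to position \<open>degree c - 1\<close> and gives it the coefficient \<open>w\<close>,
    so the character takes the value \<open>addchar w\<close>, different from 1.\<close>
  define e where "e = degree c - 1 - degree x"
  define K0 where "K0 = monom (w / lead_coeff x) e"
  have w0: "w \<noteq> 0" using w by auto
  then have d0: "degree K0 = e" "K0 \<noteq> 0" using x0 by (auto simp: K0_def degree_monom_eq)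
  have K0: "K0 \<in> below i" using d0 x0 i by (auto simp: below_def e_def)
  have deg: "degree (K0 * x) = degree c - 1" using d0 x0 by (simp add: degree_mult_eq e_def)
  then have "(K0 * x) mod c = K0 * x" using x0 by (intro mod_poly_less) auto
  moreover have "coeff (K0 * x) (degree c - 1) = w"
    using coeff_mult_degree_sum[of K0 x] deg d0 x0 by (simp add: degree_mult_eq K0_def)
  ultimately have ne: "res_char c (K0 * x) \<noteq> 1" using w by (simp add: res_char_def)
  have "(\<Sum>K\<in>below i. res_char c (K * x)) = (\<Sum>K\<in>below i. res_char c ((K0 + K) * x))"
    by (rule sum.reindex_bij_witness[of _ "\<lambda>K. K0 + K" "\<lambda>K. K - K0"])
       (auto intro: below_add below_diff K0)
  also have "\<dots> = res_char c (K0 * x) * (\<Sum>K\<in>below i. res_char c (K * x))"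
    by (simp add: distrib_right res_char_add sum_distrib_left)
  finally have "(1 - res_char c (K0 * x)) * (\<Sum>K\<in>below i. res_char c (K * x)) = 0" by (simp add: algebra_simps)
  then show ?thesis using ne False by simp
qed

section \<open>Systems of multiplicative characters and their Gauss sums\<close>

type_synonym 'a symbol = "'a poly \<Rightarrow> 'a poly \<Rightarrow> complex"

definition chi :: "'a symbol \<Rightarrow> 'a::field poly set \<Rightarrow> 'a poly \<Rightarrow> complex" where
  "chi \<chi> A x = (\<Prod>p\<in>A. \<chi> p x)"

abbreviation (input) corr :: "'a::{field,finite} symbol \<Rightarrow> nat \<Rightarrow> 'a poly set \<Rightarrow> 'a poly set \<Rightarrow> complex" where
  "corr \<chi> m S T \<equiv> (\<Sum>M\<in>monics m. chi \<chi> S M * cnj (chi \<chi> T M))"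

abbreviation (input) dual_corr :: "'a::{field,finite} symbol \<Rightarrow> nat \<Rightarrow> 'a poly set \<Rightarrow> 'a poly set \<Rightarrow> complex" where
  "dual_corr \<chi> i A B \<equiv> (\<Sum>K\<in>monics i. cnj (chi \<chi> A K) * chi \<chi> B K)"

abbreviation (input) sqnorm :: "'b set \<Rightarrow> ('b \<Rightarrow> complex) \<Rightarrow> real" where
  "sqnorm U f \<equiv> (\<Sum>i\<in>U. (cmod (f i))\<^sup>2)"

abbreviation (input) char_form :: "'a::{field,finite} symbol \<Rightarrow> 'a poly set set \<Rightarrow> ('a poly set \<Rightarrow> complex) \<Rightarrow> 'a poly \<Rightarrow> complex" where
  "char_form \<chi> U f M \<equiv> (\<Sum>S\<in>U. f S * chi \<chi> S M)"

abbreviation (input) restr :: "('a set \<Rightarrow> complex) \<Rightarrow> 'a set \<Rightarrow> 'a set \<Rightarrow> complex" where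
  "restr f G A \<equiv> (if A \<inter> G = {} then f (G \<union> A) else 0)"

text \<open>The part of the opened square that belongs to pairs with greatest common divisor exactly
  \<open>\<Prod>G\<close> and cofactors of degree \<open>k\<close>; \<open>restr\<close> discards
  cofactors that meet \<open>G\<close>.\<close>

abbreviation (input) disjoint_form ::
    "'a::{field,finite} symbol \<Rightarrow> nat \<Rightarrow> ('a poly set \<Rightarrow> complex) \<Rightarrow> 'a poly set \<Rightarrow> nat \<Rightarrow> complex" where
  "disjoint_form \<chi> m f G k \<equiv> (\<Sum>A\<in>psets k. \<Sum>B\<in>psets k. if A \<inter> B = {} then
     restr f G A * cnj (restr f G B) * corr \<chi> m (G \<union> A) (G \<union> B) else 0)"

definition gauss :: "'a symbol \<Rightarrow> 'a::{field,finite} poly set \<Rightarrow> 'a poly \<Rightarrow> complex" where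
  "gauss \<chi> A K = (\<Sum>x\<in>below (degree (\<Prod>A)). chi \<chi> A x * res_char (\<Prod>A) (K * x))"

text \<open>The intended instance of \<open>\<chi> p x\<close> is the residue symbol of \<open>x\<close> modulo \<open>p\<close>; the square of this symbol and
  mixtures of it with its complex conjugate occur as well.\<close>

locale charsys =
  fixes \<chi> :: "'a::{field,finite} symbol"
  assumes X_mult: "p \<in> mirr \<Longrightarrow> \<chi> p (x * y) = \<chi> p x * \<chi> p y"
    and X_cong: "p \<in> mirr \<Longrightarrow> p dvd x - y \<Longrightarrow> \<chi> p x = \<chi> p y"
    and X_zero: "p \<in> mirr \<Longrightarrow> p dvd x \<Longrightarrow> \<chi> p x = 0"
    and X_norm: "p \<in> mirr \<Longrightarrow> \<not> p dvd x \<Longrightarrow> cmod (\<chi> p x) = 1"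
    and X_nontriv: "p \<in> mirr \<Longrightarrow> \<exists>v. \<not> p dvd v \<and> \<chi> p v \<noteq> 1"
begin

lemma chi_mult: "A \<subseteq> mirr \<Longrightarrow> chi \<chi> A (x * y) = chi \<chi> A x * chi \<chi> A y"
  unfolding chi_def prod.distrib[symmetric] by (intro prod.cong) (auto simp: X_mult)

lemma chi_cong: "finite A \<Longrightarrow> A \<subseteq> mirr \<Longrightarrow> \<Prod>A dvd x - y \<Longrightarrow> chi \<chi> A x = chi \<chi> A y"
  unfolding chi_def by (intro prod.cong refl X_cong) (auto intro: dvd_trans[OF dvd_prodI])

lemma chi_zero: "finite A \<Longrightarrow> A \<subseteq> mirr \<Longrightarrow> p \<in> A \<Longrightarrow> p dvd x \<Longrightarrow> chi \<chi> A x = 0"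
  unfolding chi_def by (auto simp: prod_zero_iff intro!: bexI[of _ p] X_zero)

lemma chi_norm: "A \<subseteq> mirr \<Longrightarrow> (\<And>p. p \<in> A \<Longrightarrow> \<not> p dvd x) \<Longrightarrow> cmod (chi \<chi> A x) = 1"
  unfolding chi_def prod_norm[symmetric] by (intro prod.neutral) (auto simp: X_norm)

lemma X_le: "p \<in> mirr \<Longrightarrow> cmod (\<chi> p x) \<le> 1"
  by (cases "p dvd x") (auto simp: X_zero X_norm)

lemma chi_le: "A \<subseteq> mirr \<Longrightarrow> cmod (chi \<chi> A x) \<le> 1"
  unfolding chi_def prod_norm[symmetric] by (intro prod_le_1) (auto simp: X_le)

lemma X_1: "p \<in> mirr \<Longrightarrow> \<chi> p 1 = 1"
proof -
  assume p: "p \<in> mirr"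
  have "\<chi> p 1 \<noteq> 0" using X_norm[OF p, of 1] mirrD(5)[OF p] by auto
  then show ?thesis using X_mult[OF p, of 1 1] by simp
qed

lemma chi_1: "A \<subseteq> mirr \<Longrightarrow> chi \<chi> A 1 = 1"
  unfolding chi_def by (intro prod.neutral) (auto simp: X_1)

lemma chi_power: "A \<subseteq> mirr \<Longrightarrow> chi \<chi> A (x ^ n) = chi \<chi> A x ^ n"
  by (induction n) (auto simp: chi_mult chi_1)

end

lemma chi_union: "finite A \<Longrightarrow> finite B \<Longrightarrow> A \<inter> B = {} \<Longrightarrow> chi \<chi> (A \<union> B) x = chi \<chi> A x * chi \<chi> B x"
  by (simp add: chi_def prod.union_disjoint)

lemma prod_mirr_lead: "A \<subseteq> mirr \<Longrightarrow> lead_coeff (\<Prod>A) = 1"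
  by (auto simp: lead_coeff_prod mirr_def intro!: prod.neutral)

lemma prod_mirr_nz: "A \<subseteq> mirr \<Longrightarrow> \<Prod>A \<noteq> (0::'a::field poly)"
  using prod_mirr_lead[of A] by auto

text \<open>Chinese remainder theorem in the form \<open>x / (a b) = y / a + z / b\<close>, which
  splits the multiplicative and the additive character at once. The map is injective, and both sides
  have the same number of elements.\<close>

lemma crt_sum:
  fixes A B :: "'a::{field,finite} poly set"
  assumes A: "finite A" "A \<subseteq> mirr" and B: "finite B" "B \<subseteq> mirr" and AB: "A \<inter> B = {}"
  shows "(\<Sum>x\<in>below (degree (\<Prod>A) + degree (\<Prod>B)). f x) =
         (\<Sum>y\<in>below (degree (\<Prod>A)). \<Sum>z\<in>below (degree (\<Prod>B)). f (y * \<Prod>B + z * \<Prod>A))"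
proof -
  let ?a = "\<Prod>A" and ?b = "\<Prod>B"
  let ?D = "below (degree ?a) \<times> below (degree ?b) :: ('a poly \<times> 'a poly) set"
  let ?h = "\<lambda>(y, z). y * ?b + z * ?a"
  have nz: "?a \<noteq> 0" "?b \<noteq> 0" using prod_mirr_nz[OF A(2)] prod_mirr_nz[OF B(2)] by blast+
  have key: "y = 0" if y: "y \<in> below (degree (\<Prod>U))" and e: "y * \<Prod>V = z * \<Prod>U"
    and U: "finite U" "U \<subseteq> mirr" and V: "finite V" "V \<subseteq> mirr" and UV: "U \<inter> V = {}"
    for y z :: "'a poly" and U V
  proof -
    have "p dvd y" if p: "p \<in> U" for p
    proof -
      have "p dvd \<Prod>U" using p U by (intro dvd_prodI) auto
      then have "p dvd y * \<Prod>V" unfolding e by (rule dvd_mult)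
      moreover have "\<not> p dvd \<Prod>V" using mirr_not_dvd_prod[OF V, of p] p U UV by blast
      moreover have "prime_elem p" using p U mirrD(4) by blast
      ultimately show ?thesis by (simp add: prime_elem_dvd_mult_iff)
    qed
    then have "\<Prod>U dvd y" using U by (intro prod_mirr_dvd) auto
    then have "y mod \<Prod>U = 0" by (rule dvd_imp_mod_0)
    then show ?thesis using below_mod[OF y] by simp
  qed
  have inj: "inj_on ?h ?D"
  proof (rule inj_onI)
    fix s t assume st: "s \<in> ?D" "t \<in> ?D" "?h s = ?h t"
    obtain y z y' z' where yz: "s = (y, z)" "t = (y', z')" by (cases s, cases t)
    from st yz have mem: "y - y' \<in> below (degree ?a)" "z - z' \<in> below (degree ?b)" by (auto intro: below_diff)
    have e: "(y - y') * ?b = (z' - z) * ?a" "(z - z') * ?a = (y' - y) * ?b"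
      using st(3) yz by (auto simp: algebra_simps)
    have "y - y' = 0" by (rule key[OF mem(1) e(1) A B AB])
    moreover have "z - z' = 0" by (rule key[OF mem(2) e(2) B A]) (use AB in auto)
    ultimately show "s = t" using yz by simp
  qed
  have sub: "?h ` ?D \<subseteq> below (degree ?a + degree ?b)"
  proof clarify
    fix y z :: "'a poly" assume y: "y \<in> below (degree ?a)" and z: "z \<in> below (degree ?b)"
    have "y * ?b \<in> below (degree ?a + degree ?b)" "z * ?a \<in> below (degree ?a + degree ?b)"
      using y z degree_mult_le[of y ?b] degree_mult_le[of z ?a] by (auto simp: below_def)
    then show "y * ?b + z * ?a \<in> below (degree ?a + degree ?b)" by (rule below_add)
  qed
  have "?h ` ?D = below (degree ?a + degree ?b)"
    by (rule card_subset_eq) (use sub inj in \<open>auto simp: card_image card_cartesian_product card_below power_add\<close>)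
  then have "(\<Sum>x\<in>below (degree ?a + degree ?b). f x) = (\<Sum>x\<in>?h ` ?D. f x)" by simp
  also have "\<dots> = (\<Sum>s\<in>?D. f (?h s))" using inj by (subst sum.reindex) auto
  also have "\<dots> = (\<Sum>y\<in>below (degree ?a). \<Sum>z\<in>below (degree ?b). f (y * ?b + z * ?a))"
    by (simp add: sum.cartesian_product case_prod_unfold)
  finally show ?thesis .
qed

text \<open>Modulo \<open>\<Prod>A\<close> the variable becomes \<open>y * \<Prod>B\<close>, and
  symmetrically modulo \<open>\<Prod>B\<close>. This is the origin of the two twisting factors,
  which do not involve \<open>K\<close>.\<close>

lemma (in charsys) gauss_union:
  assumes A: "finite A" "A \<subseteq> mirr" and B: "finite B" "B \<subseteq> mirr" and AB: "A \<inter> B = {}"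
  shows "gauss \<chi> (A \<union> B) K = chi \<chi> A (\<Prod>B) * chi \<chi> B (\<Prod>A) * gauss \<chi> A K * gauss \<chi> B K"
proof -
  let ?a = "\<Prod>A" and ?b = "\<Prod>B"
  have nz: "?a \<noteq> 0" "?b \<noteq> 0" using prod_mirr_nz[OF A(2)] prod_mirr_nz[OF B(2)] by blast+
  have P: "\<Prod>(A \<union> B) = ?a * ?b" using A B AB by (simp add: prod.union_disjoint)
  have *: "chi \<chi> (A \<union> B) (y * ?b + z * ?a) * res_char (?a * ?b) (K * (y * ?b + z * ?a))
     = (chi \<chi> A ?b * (chi \<chi> A y * res_char ?a (K * y))) * (chi \<chi> B ?a * (chi \<chi> B z * res_char ?b (K * z)))" for y z
  proof -
    have "chi \<chi> A (y * ?b + z * ?a) = chi \<chi> A (y * ?b)" by (rule chi_cong[OF A]) simp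
    moreover have "chi \<chi> B (y * ?b + z * ?a) = chi \<chi> B (z * ?a)" by (rule chi_cong[OF B]) simp
    moreover have "res_char (?a * ?b) (K * (y * ?b + z * ?a)) = res_char (?a * ?b) ((K * y) * ?b) * res_char (?b * ?a) ((K * z) * ?a)"
      by (simp add: res_char_add[symmetric] algebra_simps)
    moreover have "res_char (?a * ?b) ((K * y) * ?b) = res_char ?a (K * y)" using nz B by (intro res_char_scale prod_mirr_lead)
    moreover have "res_char (?b * ?a) ((K * z) * ?a) = res_char ?b (K * z)" using nz A by (intro res_char_scale prod_mirr_lead)
    ultimately show ?thesis using A B AB by (simp add: chi_union chi_mult)
  qed
  have "gauss \<chi> (A \<union> B) K = (\<Sum>y\<in>below (degree ?a). \<Sum>z\<in>below (degree ?b).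
     chi \<chi> (A \<union> B) (y * ?b + z * ?a) * res_char (?a * ?b) (K * (y * ?b + z * ?a)))"
    unfolding gauss_def P using nz crt_sum[OF A B AB] by (simp add: degree_mult_eq)
  also have "\<dots> = (\<Sum>y\<in>below (degree ?a). chi \<chi> A ?b * (chi \<chi> A y * res_char ?a (K * y)))
      * (\<Sum>z\<in>below (degree ?b). chi \<chi> B ?a * (chi \<chi> B z * res_char ?b (K * z)))"
    unfolding * by (simp only: sum_product)
  also have "\<dots> = (chi \<chi> A ?b * gauss \<chi> A K) * (chi \<chi> B ?a * gauss \<chi> B K)"
    by (simp only: gauss_def sum_distrib_left)
  finally show ?thesis by (simp add: mult_ac)
qed

section \<open>Primitive Gauss sums and Poisson summation\<close>

context charsys begin

lemma bij_mult_mod: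
  fixes p :: "'a poly"
  assumes p: "p \<in> mirr" and K: "\<not> p dvd K"
  shows "bij_betw (\<lambda>x. (K * x) mod p) (below (degree p)) (below (degree p))"
proof -
  let ?h = "\<lambda>x. (K * x) mod p"
  have inj: "inj_on ?h (below (degree p))"
  proof (rule inj_onI)
    fix x y assume xy: "x \<in> below (degree p)" "y \<in> below (degree p)" "?h x = ?h y"
    then have "p dvd K * x - K * y" by (simp add: mod_eq_dvd_iff)
    then have "p dvd K * (x - y)" by (simp add: algebra_simps)
    then have "p dvd x - y" using K mirrD(4)[OF p] by (simp add: prime_elem_dvd_mult_iff)
    then have "x mod p = y mod p" by (simp add: mod_eq_dvd_iff)
    then show "x = y" using xy by (simp add: below_mod)
  qed
  have "?h ` below (degree p) \<subseteq> below (degree p)" using mod_below mirrD(3)[OF p] by auto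
  from endo_inj_surj[OF finite_below this inj] show ?thesis using inj by (simp add: bij_betw_def)
qed

lemma X_mod: "p \<in> mirr \<Longrightarrow> \<chi> p (x mod p) = \<chi> p x"
  by (rule X_cong) (auto simp: mod_eq_dvd_iff[symmetric])

lemma sum_X: assumes p: "p \<in> mirr" shows "(\<Sum>x\<in>below (degree p). \<chi> p x) = 0"
proof -
  obtain v where v: "\<not> p dvd v" "\<chi> p v \<noteq> 1" using X_nontriv[OF p] by blast
  have "(\<Sum>x\<in>below (degree p). \<chi> p x) = (\<Sum>x\<in>below (degree p). \<chi> p ((v * x) mod p))"
    using sum.reindex_bij_betw[OF bij_mult_mod[OF p v(1)], of "\<chi> p"] by simp
  also have "\<dots> = \<chi> p v * (\<Sum>x\<in>below (degree p). \<chi> p x)"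
    by (simp add: X_mod[OF p] X_mult[OF p] sum_distrib_left)
  finally have "(1 - \<chi> p v) * (\<Sum>x\<in>below (degree p). \<chi> p x) = 0" by (simp add: algebra_simps)
  then show ?thesis using v by simp
qed

lemma gauss_prime:
  assumes p: "p \<in> mirr" shows "gauss \<chi> {p} K = cnj (chi \<chi> {p} K) * gauss \<chi> {p} 1"
proof (cases "p dvd K")
  case True
  have "res_char p (K * x) = 1" for x
  proof -
    have "(K * x) mod p = 0" using True by (simp add: dvd_mult2 dvd_imp_mod_0)
    then show ?thesis by (simp add: res_char_def)
  qed
  then show ?thesis using True p by (simp add: gauss_def chi_def sum_X X_zero)
next
  case False
  have n: "cnj (\<chi> p K) * \<chi> p K = 1"
    using X_norm[OF p False] by (simp add: complex_norm_square[symmetric] mult.commute)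
  have "gauss \<chi> {p} 1 = (\<Sum>x\<in>below (degree p). \<chi> p ((K * x) mod p) * res_char p ((K * x) mod p))"
    using sum.reindex_bij_betw[OF bij_mult_mod[OF p False], of "\<lambda>x. \<chi> p x * res_char p x"]
    by (simp add: gauss_def chi_def)
  also have "\<dots> = \<chi> p K * gauss \<chi> {p} K"
    by (simp add: X_mod[OF p] X_mult[OF p] res_char_mod gauss_def chi_def sum_distrib_left mult_ac)
  finally show ?thesis using n by (simp add: chi_def mult.assoc[symmetric])
qed

text \<open>Primitivity: the character is nontrivial at every prime, so both sides vanish when
  \<open>K\<close> shares a factor with the modulus (see \<open>gauss_prime\<close>), and the
  formula holds for all \<open>K\<close>. The twists in \<open>gauss_union\<close> are the same for
  \<open>K\<close> and for 1.\<close>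

lemma gauss_eq: "finite A \<Longrightarrow> A \<subseteq> mirr \<Longrightarrow> gauss \<chi> A K = cnj (chi \<chi> A K) * gauss \<chi> A 1"
proof (induction A rule: finite_induct)
  case empty
  then show ?case by (simp add: gauss_def chi_def)
next
  case (insert p A)
  have u: "gauss \<chi> (insert p A) L = chi \<chi> {p} (\<Prod>A) * chi \<chi> A p * gauss \<chi> {p} L * gauss \<chi> A L" for L
    using gauss_union[of "{p}" A L] insert by simp
  have c: "chi \<chi> (insert p A) K = chi \<chi> {p} K * chi \<chi> A K" using insert by (simp add: chi_def)
  show ?case using insert gauss_prime[of p K] by (simp add: u[of K] u[of 1] c mult_ac)
qed

lemma degree_prod_mirr: "A \<subseteq> mirr \<Longrightarrow> degree (\<Prod>A) = sum degree (A::'a poly set)"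
  using mirrD(3) by (intro degree_prod_sum_eq) auto

text \<open>Expand the Gauss sums \<open>gauss \<chi> A K\<close> and sum over \<open>K\<close>
  first: orthogonality confines \<open>x\<close> to the complementary box.\<close>

lemma poisson:
  assumes A: "finite A" "A \<subseteq> mirr" and ij: "i + j = degree (\<Prod>A)"
  shows "gauss \<chi> A 1 * cnj (\<Sum>K\<in>below i. chi \<chi> A K) = of_nat CARD('a) ^ i * (\<Sum>x\<in>below j. chi \<chi> A x)"
proof -
  let ?a = "\<Prod>A"
  have "gauss \<chi> A 1 * cnj (\<Sum>K\<in>below i. chi \<chi> A K) = (\<Sum>K\<in>below i. gauss \<chi> A K)"
    by (subst gauss_eq[OF A]) (simp add: sum_distrib_left mult_ac)
  also have "\<dots> = (\<Sum>x\<in>below (degree ?a). chi \<chi> A x * (\<Sum>K\<in>below i. res_char ?a (K * x)))"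
    unfolding gauss_def by (subst sum.swap) (simp add: sum_distrib_left)
  also have "\<dots> = (\<Sum>x\<in>below (degree ?a). if x \<in> below j then of_nat CARD('a) ^ i * chi \<chi> A x else 0)"
  proof (rule sum.cong)
    fix x :: "'a poly" assume "x \<in> below (degree ?a)"
    moreover have "degree ?a - i = j" using ij by simp
    ultimately show "chi \<chi> A x * (\<Sum>K\<in>below i. res_char ?a (K * x)) = (if x \<in> below j then of_nat CARD('a) ^ i * chi \<chi> A x else 0)"
      using res_char_orthogonality[of x ?a i] ij by simp
  qed simp
  also have "\<dots> = (\<Sum>x\<in>below (degree ?a) \<inter> below j. of_nat CARD('a) ^ i * chi \<chi> A x)"
    by (rule sum.inter_restrict[symmetric]) simp
  also have "below (degree ?a) \<inter> below j = (below j :: 'a poly set)" using below_mono[of j "degree ?a"] ij by auto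
  finally show ?thesis by (simp add: sum_distrib_left)
qed

text \<open>Fourier inversion at the point 1: by \<open>gauss_eq\<close> the squared modulus is the
  sum of \<open>gauss \<chi> A K\<close> against \<open>res_char\<close> at \<open>- K\<close>, and
  orthogonality leaves only \<open>x = 1\<close>. The empty set is separate because 1 does not lie
  in \<open>below 0\<close>.\<close>

lemma gauss_norm:
  assumes A: "finite A" "A \<subseteq> mirr"
  shows "(cmod (gauss \<chi> A 1))\<^sup>2 = real CARD('a) ^ degree (\<Prod>A)"
proof (cases "A = {}")
  case True
  then show ?thesis by (simp add: gauss_def chi_def)
next
  case False
  let ?a = "\<Prod>A" and ?d = "degree (\<Prod>A)"
  obtain p where p: "p \<in> A" using False by auto
  have "degree p \<le> ?d" using degree_prod_mirr[OF A(2)] member_le_sum[of p A degree] p A by simp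
  then have d: "?d > 0" using mirrD(6) p A by fastforce
  have "(\<Sum>K\<in>below ?d. gauss \<chi> A K * res_char ?a (- K)) = (\<Sum>K\<in>below ?d. gauss \<chi> A 1 * cnj (chi \<chi> A K * res_char ?a K))"
    by (subst gauss_eq[OF A]) (simp add: res_char_minus mult_ac)
  also have "\<dots> = gauss \<chi> A 1 * cnj (gauss \<chi> A 1)"
    by (simp add: sum_distrib_left[symmetric] gauss_def)
  finally have 1: "gauss \<chi> A 1 * cnj (gauss \<chi> A 1) = (\<Sum>K\<in>below ?d. gauss \<chi> A K * res_char ?a (- K))" by simp
  also have "\<dots> = (\<Sum>K\<in>below ?d. \<Sum>x\<in>below ?d. chi \<chi> A x * res_char ?a (K * (x - 1)))"
  proof (rule sum.cong)
    fix K
    have "res_char ?a (K * x) * res_char ?a (- K) = res_char ?a (K * (x - 1))" for x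
      by (simp add: res_char_add[symmetric] algebra_simps)
    then show "gauss \<chi> A K * res_char ?a (- K) = (\<Sum>x\<in>below ?d. chi \<chi> A x * res_char ?a (K * (x - 1)))"
      by (simp add: gauss_def sum_distrib_right mult.assoc)
  qed simp
  also have "\<dots> = (\<Sum>x\<in>below ?d. chi \<chi> A x * (\<Sum>K\<in>below ?d. res_char ?a (K * (x - 1))))"
    by (subst sum.swap) (simp add: sum_distrib_left)
  also have "\<dots> = (\<Sum>x\<in>(below ?d :: 'a poly set). if x = 1 then of_nat CARD('a) ^ ?d else 0)"
  proof (rule sum.cong)
    fix x :: "'a poly" assume x: "x \<in> below ?d"
    have "(1::'a poly) \<in> below ?d" using d by (auto simp: below_def)
    from below_diff[OF x this] show "chi \<chi> A x * (\<Sum>K\<in>below ?d. res_char ?a (K * (x - 1))) = (if x = 1 then of_nat CARD('a) ^ ?d else 0)"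
      using res_char_orthogonality[of "x - 1" ?a ?d] chi_1[OF A(2)] by auto
  qed simp
  also have "\<dots> = of_nat CARD('a) ^ ?d"
  proof -
    have "(1::'a poly) \<in> below ?d" using d by (auto simp: below_def)
    then show ?thesis by (simp add: sum.delta)
  qed
  finally have "complex_of_real ((cmod (gauss \<chi> A 1))\<^sup>2) = complex_of_real (real CARD('a) ^ ?d)"
    unfolding complex_norm_square by simp
  then show ?thesis by (simp only: of_real_eq_iff)
qed

end

section \<open>The dual character sum\<close>

text \<open>Division with remainder by \<open>c\<close>; it cuts a box longer than the modulus into
  full periods.\<close>

lemma sum_below_blocks:
  fixes c :: "'a::{field,finite} poly"
  assumes c: "c \<noteq> 0"
  shows "(\<Sum>x\<in>below (e + degree c). f x) = (\<Sum>w\<in>below e. \<Sum>r\<in>below (degree c). f (w * c + r))"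
proof -
  let ?D = "below e \<times> below (degree c) :: ('a poly \<times> 'a poly) set"
  let ?h = "\<lambda>(w, r). w * c + r"
  have inj: "inj_on ?h ?D"
  proof (rule inj_onI)
    fix s t assume st: "s \<in> ?D" "t \<in> ?D" "?h s = ?h t"
    obtain w r w' r' where wr: "s = (w, r)" "t = (w', r')" by (cases s, cases t)
    have "(w * c + r) mod c = (w' * c + r') mod c" using st wr by simp
    then have "r = r'" using st wr by (simp add: below_mod)
    then show "s = t" using st wr c by simp
  qed
  have sub: "?h ` ?D \<subseteq> below (e + degree c)"
  proof clarify
    fix w r :: "'a poly" assume w: "w \<in> below e" and r: "r \<in> below (degree c)"
    have "w * c \<in> below (e + degree c)" using w degree_mult_le[of w c] by (auto simp: below_def)
    moreover have "r \<in> below (e + degree c)" using r by (auto simp: below_def)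
    ultimately show "w * c + r \<in> below (e + degree c)" by (rule below_add)
  qed
  have "?h ` ?D = below (e + degree c)"
    by (rule card_subset_eq) (use sub inj in \<open>auto simp: card_image card_cartesian_product card_below power_add\<close>)
  then have "(\<Sum>x\<in>below (e + degree c). f x) = (\<Sum>x\<in>?h ` ?D. f x)" by simp
  also have "\<dots> = (\<Sum>s\<in>?D. f (?h s))" using inj by (subst sum.reindex) auto
  finally show ?thesis by (simp add: sum.cartesian_product case_prod_unfold)
qed

lemma const_mult_degree: "u \<noteq> 0 \<Longrightarrow> degree ([:u:] * M) = degree (M::'a::field poly)"
  by (cases "M = 0") (simp_all add: degree_mult_eq)

text \<open>Nonzero polynomials of degree \<open>j\<close> are the scalar multiples of the monic
  ones, and an even function does not see the scalar. This converts between boxes, on which Poisson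
  summation acts, and the monic ranges of the sieve.\<close>

lemma sum_below_Suc_even:
  fixes f :: "'a::{field,finite} poly \<Rightarrow> complex"
  assumes f: "\<And>u M. u \<noteq> 0 \<Longrightarrow> f ([:u:] * M) = f M"
  shows "(\<Sum>x\<in>below (Suc j). f x) = (\<Sum>x\<in>below j. f x) + (of_nat CARD('a) - 1) * (\<Sum>M\<in>monics j. f M)"
proof -
  let ?E = "{x :: 'a poly. x \<noteq> 0 \<and> degree x = j}"
  let ?D = "(UNIV - {0}) \<times> monics j :: ('a \<times> 'a poly) set"
  have un: "below (Suc j) = below j \<union> ?E" and dis: "below j \<inter> ?E = {}" by (auto simp: below_def)
  have "?E \<subseteq> below (Suc j)" by (auto simp: below_def)
  then have fin: "finite ?E" by (rule finite_subset[OF _ finite_below])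
  have bij: "bij_betw (\<lambda>(u, M). [:u:] * M) ?D ?E"
  proof (rule bij_betw_byWitness[where f' = "\<lambda>x. (lead_coeff x, [:inverse (lead_coeff x):] * x)"])
    show "\<forall>s\<in>?D. (\<lambda>x. (lead_coeff x, [:inverse (lead_coeff x):] * x)) ((\<lambda>(u, M). [:u:] * M) s) = s"
    proof (intro ballI)
      fix s :: "'a \<times> 'a poly" assume "s \<in> ?D"
      then obtain u M where s: "s = (u, M)" and u: "u \<noteq> 0" "M \<in> monics j" by (cases s) auto
      have "lead_coeff ([:u:] * M) = u"
      proof -
        have "lead_coeff M = 1" using u(2) unfolding monics_def by blast
        then show ?thesis unfolding lead_coeff_mult by simp
      qed
      moreover have "[:inverse u:] * ([:u:] * M) = M" using u by (simp add: mult.assoc[symmetric] one_pCons[symmetric])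
      ultimately have "(lead_coeff ([:u:] * M), [:inverse (lead_coeff ([:u:] * M)):] * ([:u:] * M)) = (u, M)" by (simp only:)
      then show "(\<lambda>x. (lead_coeff x, [:inverse (lead_coeff x):] * x)) ((\<lambda>(u, M). [:u:] * M) s) = s"
        by (simp only: s prod.case)
    qed
    show "\<forall>x\<in>?E. (\<lambda>(u, M). [:u:] * M) (lead_coeff x, [:inverse (lead_coeff x):] * x) = x"
      by (auto simp: one_pCons[symmetric])
    have "[:u:] * M \<in> ?E" if u: "u \<noteq> 0" "M \<in> monics j" for u :: 'a and M :: "'a poly"
      using const_mult_degree[OF u(1), of M] monics_nz[OF u(2)] u by (simp add: monics_def del: mult_pCons_left)
    then show "(\<lambda>(u, M). [:u:] * M) ` ?D \<subseteq> ?E" by (auto simp del: mult_pCons_left)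
    have "(lead_coeff x, [:inverse (lead_coeff x):] * x) \<in> ?D" if x: "x \<in> ?E" for x :: "'a poly"
    proof -
      have x0: "lead_coeff x \<noteq> 0" and i: "inverse (lead_coeff x) \<noteq> 0" using x by auto
      have "lead_coeff ([:inverse (lead_coeff x):] * x) = 1"
        unfolding lead_coeff_mult using x0 by simp
      moreover have "degree ([:inverse (lead_coeff x):] * x) = j"
        using x const_mult_degree[OF i, of x] by (simp del: mult_pCons_left)
      ultimately show ?thesis using x0 unfolding monics_def by blast
    qed
    then show "(\<lambda>x. (lead_coeff x, [:inverse (lead_coeff x):] * x)) ` ?E \<subseteq> ?D" by blast
  qed
  have "(\<Sum>x\<in>below (Suc j). f x) = (\<Sum>x\<in>below j. f x) + (\<Sum>x\<in>?E. f x)"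
    unfolding un by (rule sum.union_disjoint) (use fin dis in auto)
  also have "(\<Sum>x\<in>?E. f x) = (\<Sum>s\<in>?D. f ((\<lambda>(u, M). [:u:] * M) s))"
    by (rule sum.reindex_bij_betw[OF bij, symmetric])
  also have "\<dots> = (\<Sum>s\<in>?D. f (snd s))" by (rule sum.cong) (auto simp del: mult_pCons_left intro!: f)
  also have "\<dots> = (\<Sum>u\<in>UNIV - {0::'a}. \<Sum>M\<in>monics j. f M)"
    by (simp only: sum.cartesian_product case_prod_unfold)
  also have "\<dots> = of_nat (CARD('a) - 1) * (\<Sum>M\<in>monics j. f M)" by (simp add: card_Diff_singleton)
  also have "of_nat (CARD('a) - 1) = (of_nat CARD('a) - 1 :: complex)"
    by (simp add: of_nat_diff Suc_leI)
  finally show ?thesis .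
qed

text \<open>Fourier weights of a monic range, with \<open>n\<close> the degree of the modulus minus
  the degree of the range. They arise from subtracting the Poisson formula for
  \<open>below j\<close> from that for \<open>below (Suc j)\<close>: the top dual degree
  \<open>n - 1\<close> occurs only in the subtracted one, hence the sign.\<close>

definition dual_weight :: "nat \<Rightarrow> nat \<Rightarrow> nat \<Rightarrow> real" where
  "dual_weight q n i = (if Suc i = n then - 1 else real q - 1) / real q ^ n"

lemma dual_weight_bound: "q > 1 \<Longrightarrow> \<bar>dual_weight q n i\<bar> \<le> real q / real q ^ n"
  by (auto simp: dual_weight_def abs_mult field_simps)

text \<open>The difference of two Poisson formulas, in which evenness isolates the monic polynomials
  of degree \<open>j\<close>. The zero frequency contributes nothing because \<open>C\<close> is
  nonempty, so there is no main term.\<close>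

lemma (in charsys) monic_sum_dual:
  assumes C: "finite C" "C \<subseteq> mirr" "C \<noteq> {}"
    and even: "\<And>u. u \<noteq> 0 \<Longrightarrow> chi \<chi> C [:u:] = 1"
  shows "(\<Sum>M\<in>monics j. chi \<chi> C M) = gauss \<chi> C 1 *
     (\<Sum>i<degree (\<Prod>C) - j. of_real (dual_weight CARD('a) (degree (\<Prod>C) - j) i) * cnj (\<Sum>K\<in>monics i. chi \<chi> C K))"
proof -
  define f where "f = chi \<chi> C"
  define h where "h = degree (\<Prod>C)"
  define U where "U j = (\<Sum>x\<in>below j. f x)" for j
  define S where "S j = (\<Sum>M\<in>monics j. f M)" for j
  define q where "q = (of_nat CARD('a) :: complex)"
  define W where "W = gauss \<chi> C 1"
  have card2: "CARD('a) \<ge> 2" using card_mono[of UNIV "{0, 1::'a}"] by simp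
  then have q: "q \<noteq> 0" "q - 1 \<noteq> 0" by (auto simp: q_def)
  have f: "u \<noteq> 0 \<Longrightarrow> f ([:u:] * M) = f M" for u M
    using even[of u] by (simp add: f_def chi_mult[OF C(2)] del: mult_pCons_left)
  have Us: "U (Suc j) = U j + (q - 1) * S j" for j
    unfolding U_def S_def q_def by (rule sum_below_Suc_even) (rule f)
  obtain p where p: "p \<in> C" using C by auto
  have U0: "U 0 = 0" using chi_zero[OF C(1,2) p, of 0] by (simp add: U_def f_def)
  have Ui: "U i = (q - 1) * (\<Sum>r<i. S r)" for i
    by (induction i) (simp_all add: U0 Us distrib_left)
  have P: "W * cnj (U i) = q ^ i * U j" if "i + j = h" for i j
    using poisson[OF C(1,2), of i j] that by (simp add: U_def q_def W_def f_def h_def)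
  have Uh: "U h = 0" using P[of 0 h] U0 by simp
  \<comment> \<open>Boxes beyond the modulus consist of full periods, whose sum is zero; a monic
    range with \<open>j \<ge> h\<close> thus sums to zero, in agreement with the empty dual
    sum.\<close>
  have Ubig: "U j = 0" if "j \<ge> h" for j
  proof -
    have per: "f (w * \<Prod>C + r) = f r" for w r
      unfolding f_def by (rule chi_cong[OF C(1,2)]) simp
    have "U j = (\<Sum>w\<in>below (j - h). \<Sum>r\<in>below h. f (w * \<Prod>C + r))"
      using sum_below_blocks[OF prod_mirr_nz[OF C(2)], of f "j - h"] that by (simp add: U_def h_def)
    also have "\<dots> = 0" using Uh by (simp add: per U_def)
    finally show ?thesis .
  qed
  have "S j = W * (\<Sum>i<h - j. of_real (dual_weight CARD('a) (h - j) i) * cnj (S i))"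
  proof (cases "j < h")
    case False
    then have "(q - 1) * S j = 0" using Ubig[of j] Ubig[of "Suc j"] Us[of j] by simp
    then show ?thesis using q False by simp
  next
    case True
    define n where "n = h - Suc j"
    have hn: "h - j = Suc n" using True by (simp add: n_def)
    have 1: "W * cnj (U n) = q ^ n * U (Suc j)" by (rule P) (use True in \<open>simp add: n_def\<close>)
    have 2: "W * cnj (U (Suc n)) = q ^ Suc n * U j" by (rule P) (use True in \<open>simp add: n_def\<close>)
    have "q ^ Suc n * ((q - 1) * S j) = q * (q ^ n * U (Suc j)) - q ^ Suc n * U j"
      by (simp add: Us algebra_simps)
    also have "\<dots> = W * (q * cnj (U n) - cnj (U (Suc n)))"
      unfolding 1[symmetric] 2[symmetric] by (simp add: algebra_simps)
    also have "\<dots> = (q - 1) * (W * ((q - 1) * (\<Sum>r<n. cnj (S r)) - cnj (S n)))"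
      by (simp add: Ui q_def algebra_simps)
    finally have "(q - 1) * (q ^ Suc n * S j) = (q - 1) * (W * ((q - 1) * (\<Sum>r<n. cnj (S r)) - cnj (S n)))"
      by (simp add: mult_ac)
    then have "q ^ Suc n * S j = W * ((q - 1) * (\<Sum>r<n. cnj (S r)) - cnj (S n))" using q by simp
    then have "S j = W * (((q - 1) * (\<Sum>r<n. cnj (S r)) - cnj (S n)) / q ^ Suc n)"
      using q by (simp add: field_simps)
    also have "((q - 1) * (\<Sum>r<n. cnj (S r)) - cnj (S n)) / q ^ Suc n
        = (\<Sum>i<Suc n. of_real (dual_weight CARD('a) (Suc n) i) * cnj (S i))"
    proof -
      have "(\<Sum>i<n. of_real (dual_weight CARD('a) (Suc n) i) * cnj (S i)) = (\<Sum>i<n. (q - 1) / q ^ Suc n * cnj (S i))"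
        by (rule sum.cong) (auto simp: dual_weight_def q_def)
      moreover have "of_real (dual_weight CARD('a) (Suc n) n) = - 1 / q ^ Suc n" by (simp add: dual_weight_def q_def)
      moreover have "((q - 1) * a - b) / Q = (q - 1) / Q * a + - 1 / Q * b" for a b Q
        by (simp add: diff_divide_distrib left_diff_distrib)
      ultimately show ?thesis by (simp only: sum.lessThan_Suc sum_distrib_left[symmetric])
    qed
    finally show ?thesis by (simp only: hn)
  qed
  then show ?thesis by (simp add: S_def W_def f_def h_def)
qed

text \<open>By \<open>X_const\<close> the value at a constant depends on \<open>p\<close> only
  through its degree, with the prime \<open>t = [:0, 1:]\<close> of degree 1 as reference. For
  \<open>A\<close> and \<open>B\<close> of equal degree these values cancel, which makes the product
  character even.\<close>

locale recip_charsys = charsys +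
  assumes X_recip: "p \<in> mirr \<Longrightarrow> r \<in> mirr \<Longrightarrow> \<chi> p r = \<chi> r p"
    and X_const: "p \<in> mirr \<Longrightarrow> u \<noteq> 0 \<Longrightarrow> \<chi> p [:u:] = \<chi> [:0, 1:] [:u:] ^ degree p"
begin

lemma chi_prod: "A \<subseteq> mirr \<Longrightarrow> chi \<chi> A (\<Prod>B) = (\<Prod>r\<in>B. chi \<chi> A r)"
  by (induction B rule: infinite_finite_induct) (auto simp: chi_mult chi_1)

lemma chi_recip: "A \<subseteq> mirr \<Longrightarrow> B \<subseteq> mirr \<Longrightarrow> chi \<chi> A (\<Prod>B) = chi \<chi> B (\<Prod>A)"
proof -
  assume AB: "A \<subseteq> mirr" "B \<subseteq> mirr"
  have "chi \<chi> A (\<Prod>B) = (\<Prod>r\<in>B. \<Prod>p\<in>A. \<chi> p r)" using AB by (simp add: chi_prod) (simp add: chi_def)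
  also have "\<dots> = (\<Prod>p\<in>A. \<Prod>r\<in>B. \<chi> p r)" by (rule prod.swap)
  also have "\<dots> = (\<Prod>p\<in>A. \<Prod>r\<in>B. \<chi> r p)" using AB by (intro prod.cong refl X_recip) auto
  also have "\<dots> = chi \<chi> B (\<Prod>A)" using AB by (simp add: chi_prod) (simp add: chi_def)
  finally show ?thesis .
qed

text \<open>Allows \<chi> on \<open>A\<close> times its conjugate on a disjoint \<open>B\<close> to
  be treated as one primitive character modulo the product of both sets.\<close>

lemma mixed_charsys: "charsys (\<lambda>p x. if p \<in> A then \<chi> p x else cnj (\<chi> p x))"
proof
  fix p x y :: "'a poly" assume p: "p \<in> mirr"
  show "(if p \<in> A then \<chi> p (x * y) else cnj (\<chi> p (x * y))) =
      (if p \<in> A then \<chi> p x else cnj (\<chi> p x)) * (if p \<in> A then \<chi> p y else cnj (\<chi> p y))"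
    using p by (simp add: X_mult)
next
  fix p x y :: "'a poly" assume p: "p \<in> mirr" "p dvd x - y"
  from X_cong[OF this] show "(if p \<in> A then \<chi> p x else cnj (\<chi> p x)) = (if p \<in> A then \<chi> p y else cnj (\<chi> p y))" by simp
next
  fix p x :: "'a poly" assume p: "p \<in> mirr" "p dvd x"
  from X_zero[OF this] show "(if p \<in> A then \<chi> p x else cnj (\<chi> p x)) = 0" by simp
next
  fix p x :: "'a poly" assume p: "p \<in> mirr" "\<not> p dvd x"
  from X_norm[OF this] show "cmod (if p \<in> A then \<chi> p x else cnj (\<chi> p x)) = 1" by simp
next
  fix p :: "'a poly" assume p: "p \<in> mirr"
  from X_nontriv[OF this] show "\<exists>v. \<not> p dvd v \<and> (if p \<in> A then \<chi> p v else cnj (\<chi> p v)) \<noteq> 1"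
    by (metis complex_cnj_cancel_iff complex_cnj_one)
qed

lemma gauss_cong: "(\<And>p x. p \<in> A \<Longrightarrow> \<chi>1 p x = \<chi>2 p x) \<Longrightarrow> gauss \<chi>1 A K = gauss \<chi>2 A K"
  by (simp add: gauss_def chi_def)

text \<open>Reciprocity makes the Gauss sum of \<open>\<chi>\<^sub>A\<close> times the conjugate of \<open>\<chi>\<^sub>B\<close> split into a factor for \<open>A\<close> and a factor for \<open>B\<close>;
  the weights \<open>dual_weight\<close> do not depend on the sets, so that the dual sum is again a bilinear form of sieve type.\<close>

lemma pair_sum_dual:
  assumes A: "finite A" "A \<subseteq> mirr" "sum degree A = k" and B: "finite B" "B \<subseteq> mirr" "sum degree B = k"
    and AB: "A \<inter> B = {}" and k: "k > 0"
  shows "(corr \<chi> j A B) = gauss \<chi> A 1 * gauss (\<lambda>p x. cnj (\<chi> p x)) B 1 *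
     (\<Sum>i<2 * k - j. of_real (dual_weight CARD('a) (2 * k - j) i) * (dual_corr \<chi> i A B))"
proof -
  define Z where "Z = (\<lambda>p x. if p \<in> A then \<chi> p x else cnj (\<chi> p x))"
  interpret Z: charsys Z unfolding Z_def by (rule mixed_charsys)
  let ?C = "A \<union> B"
  have C: "finite ?C" "?C \<subseteq> mirr" "?C \<noteq> {}" using A B k by auto
  have ZA: "chi Z A x = chi \<chi> A x" for x by (simp add: chi_def Z_def)
  have ZB: "chi Z B x = cnj (chi \<chi> B x)" for x
    unfolding chi_def cnj_prod by (rule prod.cong) (use AB in \<open>auto simp: Z_def\<close>)
  have ZC: "chi Z ?C x = chi \<chi> A x * cnj (chi \<chi> B x)" for x
    using chi_union[OF A(1) B(1) AB, of Z x] by (simp add: ZA ZB)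
  have deg: "degree (\<Prod>?C) = 2 * k"
    using degree_prod_mirr[OF C(2)] A B AB by (simp add: sum.union_disjoint)
  have cA: "chi \<chi> D [:u:] = \<chi> [:0, 1:] [:u:] ^ k" if "u \<noteq> 0" "D \<subseteq> mirr" "sum degree D = k" for u D
  proof -
    have "chi \<chi> D [:u:] = (\<Prod>p\<in>D. \<chi> [:0, 1:] [:u:] ^ degree p)"
      unfolding chi_def using that by (intro prod.cong) (auto intro: X_const)
    then show ?thesis using that by (simp add: power_sum[symmetric])
  qed
  have ev: "chi Z ?C [:u:] = 1" if u: "u \<noteq> 0" for u
  proof -
    have "\<not> p dvd [:u:]" if "p \<in> A" for p
    proof
      assume "p dvd [:u:]"
      then have "degree p \<le> degree [:u:]" by (rule dvd_imp_degree_le) (use u in simp)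
      moreover have "p \<in> mirr" using that A(2) by auto
      ultimately show False using mirrD(6)[of p] by simp
    qed
    then have "cmod (chi \<chi> A [:u:]) = 1" by (intro chi_norm A)
    then have "chi \<chi> A [:u:] * cnj (chi \<chi> A [:u:]) = 1" using complex_norm_square[of "chi \<chi> A [:u:]"] by simp
    then show ?thesis using cA[OF u A(2,3)] cA[OF u B(2,3)] by (simp add: ZC)
  qed
  \<comment> \<open>By reciprocity the twists of \<open>gauss_union\<close> multiply to the squared
    modulus of \<open>chi \<chi> A (\<Prod>B)\<close>, which is 1 since \<open>A\<close> and
    \<open>B\<close> are disjoint.\<close>
  have "\<not> p dvd \<Prod>B" if "p \<in> A" for p using mirr_not_dvd_prod[OF B(1,2), of p] that A AB by blast
  then have "cmod (chi \<chi> A (\<Prod>B)) = 1" by (intro chi_norm A)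
  then have "chi \<chi> A (\<Prod>B) * cnj (chi \<chi> A (\<Prod>B)) = 1" using complex_norm_square[of "chi \<chi> A (\<Prod>B)"] by simp
  then have "chi Z A (\<Prod>B) * chi Z B (\<Prod>A) = 1" using chi_recip[OF A(2) B(2)] by (simp add: ZA ZB)
  then have "gauss Z ?C 1 = gauss Z A 1 * gauss Z B 1" using Z.gauss_union[OF A(1,2) B(1,2) AB, of 1] by simp
  also have "gauss Z A 1 = gauss \<chi> A 1" by (rule gauss_cong) (simp add: Z_def)
  also have "gauss Z B 1 = gauss (\<lambda>p x. cnj (\<chi> p x)) B 1" by (rule gauss_cong) (use AB in \<open>auto simp: Z_def\<close>)
  finally have G: "gauss Z ?C 1 = gauss \<chi> A 1 * gauss (\<lambda>p x. cnj (\<chi> p x)) B 1" .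
  show ?thesis using Z.monic_sum_dual[OF C ev, of j] by (simp add: ZC deg G)
qed

lemma cnj_gauss_norm: "finite A \<Longrightarrow> A \<subseteq> mirr \<Longrightarrow> (cmod (gauss (\<lambda>p x. cnj (\<chi> p x)) A 1))\<^sup>2 = real CARD('a) ^ degree (\<Prod>A)"
  using charsys.gauss_norm[OF mixed_charsys[of "{}"], of A] by simp

end

section \<open>The sieve inequality obtained from Poisson summation\<close>

definition sieve :: "'a::{field,finite} symbol \<Rightarrow> nat \<Rightarrow> nat \<Rightarrow> real \<Rightarrow> bool" where
  "sieve \<chi> m n c \<longleftrightarrow> (\<forall>lam. (\<Sum>M\<in>monics m. (cmod (char_form \<chi> (psets n) lam M))\<^sup>2)
      \<le> c * (sqnorm (psets n) lam))"

section \<open>Inclusion and exclusion over sets of primes\<close>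

lemma alternating_sum_Pow:
  "finite S \<Longrightarrow> (\<Sum>E\<in>Pow S. (- 1) ^ card E) = (if S = {} then 1 else (0::complex))"
proof (induction S rule: finite_induct)
  case (insert x F)
  have inj: "inj_on (insert x) (Pow F)" using insert(2) by (auto simp: inj_on_def)
  have "(\<Sum>E\<in>Pow (insert x F). (- 1) ^ card E) =
      (\<Sum>E\<in>Pow F. (- 1) ^ card E) + (\<Sum>E\<in>insert x ` Pow F. (- 1) ^ card E :: complex)"
    unfolding Pow_insert by (rule sum.union_disjoint) (use insert in auto)
  also have "(\<Sum>E\<in>insert x ` Pow F. (- 1) ^ card E :: complex) = (\<Sum>E\<in>Pow F. - ((- 1) ^ card E))"
    unfolding sum.reindex[OF inj]
  proof (rule sum.cong)
    fix E assume "E \<in> Pow F"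
    then have "finite E" "x \<notin> E" using insert finite_subset by auto
    then show "((\<lambda>E. (- 1) ^ card E) \<circ> insert x) E = - ((- 1) ^ card E :: complex)" by simp
  qed simp
  finally show ?case by (simp add: sum_negf)
qed simp

lemma sum_rotate: "(\<Sum>K\<in>U. \<Sum>A\<in>V. \<Sum>B\<in>W. f K A B) = (\<Sum>A\<in>V. \<Sum>B\<in>W. \<Sum>K\<in>U. f K A B)"
  by (subst sum.swap, intro sum.cong refl, rule sum.swap)

lemma finite_pset: "S \<in> psets n \<Longrightarrow> finite S"
  by (simp add: psets_def)

lemma sum_subsets_psets:
  fixes f :: "'a::{field,finite} poly set \<Rightarrow> real"
  assumes E: "finite E" "\<And>A. A \<in> psets k \<Longrightarrow> Pow A \<subseteq> E"
  shows "(\<Sum>G\<in>E. \<Sum>A\<in>psets k. if G \<subseteq> A then f A else 0) = (\<Sum>A\<in>psets k. 2 ^ card A * f A)"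
proof -
  have "(\<Sum>G\<in>E. \<Sum>A\<in>psets k. if G \<subseteq> A then f A else 0) = (\<Sum>A\<in>psets k. \<Sum>G\<in>E. if G \<subseteq> A then f A else 0)"
    by (rule sum.swap)
  also have "\<dots> = (\<Sum>A\<in>psets k. 2 ^ card A * f A)"
  proof (rule sum.cong)
    fix A :: "'a poly set" assume A: "A \<in> psets k"
    have "(\<Sum>G\<in>E. if G \<subseteq> A then f A else 0) = (\<Sum>G\<in>{G\<in>E. G \<subseteq> A}. f A)"
      by (rule sum.inter_filter[symmetric]) (rule E)
    also have "{G\<in>E. G \<subseteq> A} = Pow A" using E(2)[OF A] by auto
    finally show "(\<Sum>G\<in>E. if G \<subseteq> A then f A else 0) = 2 ^ card A * f A"
      using finite_pset[OF A] by (simp add: card_Pow)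
  qed simp
  finally show ?thesis .
qed

text \<open>Disjointness is detected by the alternating sum over all \<open>F\<close> contained in
  both sets. For fixed \<open>F\<close> the form is a product of a sum over \<open>A\<close> and a
  sum over \<open>B\<close>, to which the sieve applies; each \<open>A\<close> is counted once for
  each of its \<open>2 ^ card A\<close> subsets.\<close>

lemma disjoint_bilinear:
  fixes \<chi> :: "'a::{field,finite} symbol"
  assumes sieve: "sieve \<chi> i k \<beta>"
  shows "cmod (\<Sum>A\<in>psets k. \<Sum>B\<in>psets k.
      if A \<inter> B = {} then p A * r B * (dual_corr \<chi> i A B) else 0)
    \<le> \<beta> * (\<Sum>A\<in>psets k. 2 ^ card A * (((cmod (p A))\<^sup>2 + (cmod (r A))\<^sup>2) / 2))"
proof -
  define P where "P = (psets k :: 'a poly set set)"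
  define E where "E = \<Union> (Pow ` P)"
  have finE: "finite E" by (auto simp: E_def P_def finite_pset)
  have PowE: "Pow A \<subseteq> E" if "A \<in> P" for A using that by (auto simp: E_def)
  define s where "s F = ((- 1) ^ card F :: complex)" for F :: "'a poly set"
  define c where "c F x A = (if F \<subseteq> A then x A else (0::complex))" for F A :: "'a poly set" and x
  define a where "a F K = (\<Sum>A\<in>P. c F p A * cnj (chi \<chi> A K))" for F K
  define b where "b F K = (\<Sum>B\<in>P. c F r B * chi \<chi> B K)" for F K
  have ind: "(if A \<inter> B = {} then z else 0) = (\<Sum>F\<in>E. s F * (if F \<subseteq> A then if F \<subseteq> B then z else 0 else 0))"
    if A: "A \<in> P" and B: "B \<in> P" for A B z
  proof -
    have "(\<Sum>F\<in>E. s F * (if F \<subseteq> A then if F \<subseteq> B then z else 0 else 0)) = (\<Sum>F\<in>E. if F \<subseteq> A \<inter> B then s F * z else 0)"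
      by (rule sum.cong) auto
    also have "\<dots> = (\<Sum>F\<in>{F\<in>E. F \<subseteq> A \<inter> B}. s F * z)" by (rule sum.inter_filter[symmetric]) (rule finE)
    also have "{F\<in>E. F \<subseteq> A \<inter> B} = Pow (A \<inter> B)" using PowE[OF A] by auto
    also have "(\<Sum>F\<in>Pow (A \<inter> B). s F * z) = (\<Sum>F\<in>Pow (A \<inter> B). s F) * z" by (rule sum_distrib_right[symmetric])
    also have "(\<Sum>F\<in>Pow (A \<inter> B). s F) = (if A \<inter> B = {} then 1 else 0)"
      unfolding s_def by (rule alternating_sum_Pow) (use A in \<open>auto simp: P_def finite_pset\<close>)
    finally show ?thesis by simp
  qed
  have "(\<Sum>A\<in>P. \<Sum>B\<in>P. if A \<inter> B = {} then p A * r B * (dual_corr \<chi> i A B) else 0)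
    = (\<Sum>A\<in>P. \<Sum>B\<in>P. \<Sum>F\<in>E. s F * (\<Sum>K\<in>monics i. (c F p A * cnj (chi \<chi> A K)) * (c F r B * chi \<chi> B K)))"
  proof (intro sum.cong refl)
    fix A B assume A: "A \<in> P" and B: "B \<in> P"
    show "(if A \<inter> B = {} then p A * r B * (dual_corr \<chi> i A B) else 0)
      = (\<Sum>F\<in>E. s F * (\<Sum>K\<in>monics i. (c F p A * cnj (chi \<chi> A K)) * (c F r B * chi \<chi> B K)))"
      unfolding ind[OF A B]
      by (intro sum.cong refl) (auto simp: c_def sum_distrib_left mult_ac)
  qed
  also have "\<dots> = (\<Sum>F\<in>E. \<Sum>A\<in>P. \<Sum>B\<in>P. s F * (\<Sum>K\<in>monics i. (c F p A * cnj (chi \<chi> A K)) * (c F r B * chi \<chi> B K)))"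
    by (rule sum_rotate[symmetric])
  also have "\<dots> = (\<Sum>F\<in>E. s F * (\<Sum>K\<in>monics i. a F K * b F K))"
  proof (intro sum.cong refl)
    fix F
    have "(\<Sum>K\<in>monics i. a F K * b F K) = (\<Sum>K\<in>monics i. \<Sum>A\<in>P. \<Sum>B\<in>P. (c F p A * cnj (chi \<chi> A K)) * (c F r B * chi \<chi> B K))"
      unfolding a_def b_def sum_product ..
    also have "\<dots> = (\<Sum>A\<in>P. \<Sum>B\<in>P. \<Sum>K\<in>monics i. (c F p A * cnj (chi \<chi> A K)) * (c F r B * chi \<chi> B K))"
      by (rule sum_rotate)
    finally show "(\<Sum>A\<in>P. \<Sum>B\<in>P. s F * (\<Sum>K\<in>monics i. (c F p A * cnj (chi \<chi> A K)) * (c F r B * chi \<chi> B K)))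
      = s F * (\<Sum>K\<in>monics i. a F K * b F K)" by (simp only: sum_distrib_left)
  qed
  finally have eq: "(\<Sum>A\<in>P. \<Sum>B\<in>P. if A \<inter> B = {} then p A * r B * (dual_corr \<chi> i A B) else 0)
    = (\<Sum>F\<in>E. s F * (\<Sum>K\<in>monics i. a F K * b F K))" .
  have b_le: "(\<Sum>K\<in>monics i. (cmod (b F K))\<^sup>2) \<le> \<beta> * (\<Sum>A\<in>P. (cmod (c F r A))\<^sup>2)" for F
    using spec[OF sieve[unfolded sieve_def], of "c F r"] unfolding b_def P_def .
  \<comment> \<open>The sieve is stated for \<chi>; the conjugate characters in \<open>a\<close> are
    reached by conjugating the whole sum together with its coefficients.\<close>
  have "cmod (a F K) = cmod (\<Sum>A\<in>P. cnj (c F p A) * chi \<chi> A K)" for F K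
  proof -
    have "cnj (a F K) = (\<Sum>A\<in>P. cnj (c F p A) * chi \<chi> A K)" by (simp add: a_def)
    then show ?thesis by (metis complex_mod_cnj)
  qed
  moreover have "(\<Sum>K\<in>monics i. (cmod (\<Sum>A\<in>P. cnj (c F p A) * chi \<chi> A K))\<^sup>2) \<le> \<beta> * (\<Sum>A\<in>P. (cmod (cnj (c F p A)))\<^sup>2)" for F
    using spec[OF sieve[unfolded sieve_def], of "\<lambda>A. cnj (c F p A)"] unfolding P_def .
  ultimately have a_le: "(\<Sum>K\<in>monics i. (cmod (a F K))\<^sup>2) \<le> \<beta> * (\<Sum>A\<in>P. (cmod (c F p A))\<^sup>2)" for F by simp
  have "cmod (\<Sum>F\<in>E. s F * (\<Sum>K\<in>monics i. a F K * b F K)) \<le> (\<Sum>F\<in>E. cmod (\<Sum>K\<in>monics i. a F K * b F K))"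
    by (rule order_trans[OF norm_sum]) (simp add: norm_mult s_def norm_power)
  also have "\<dots> \<le> (\<Sum>F\<in>E. \<beta> * (\<Sum>A\<in>P. if F \<subseteq> A then ((cmod (p A))\<^sup>2 + (cmod (r A))\<^sup>2) / 2 else 0))"
  proof (rule sum_mono)
    fix F
    \<comment> \<open>The inequality of arithmetic and geometric means keeps the estimate linear in
      the squared coefficients, so that the sum over \<open>F\<close> can be carried out
      inside.\<close>
    have "cmod (\<Sum>K\<in>monics i. a F K * b F K) \<le> (\<Sum>K\<in>monics i. ((cmod (a F K))\<^sup>2 + (cmod (b F K))\<^sup>2) / 2)"
    proof (rule order_trans[OF norm_sum], rule sum_mono)
      fix K
      have "0 \<le> (cmod (a F K) - cmod (b F K))\<^sup>2" by simp
      then show "cmod (a F K * b F K) \<le> ((cmod (a F K))\<^sup>2 + (cmod (b F K))\<^sup>2) / 2"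
        by (simp add: norm_mult power2_diff)
    qed
    also have "\<dots> = ((\<Sum>K\<in>monics i. (cmod (a F K))\<^sup>2) + (\<Sum>K\<in>monics i. (cmod (b F K))\<^sup>2)) / 2"
      by (simp add: sum.distrib sum_divide_distrib[symmetric])
    also have "\<dots> \<le> (\<beta> * (\<Sum>A\<in>P. (cmod (c F p A))\<^sup>2) + \<beta> * (\<Sum>A\<in>P. (cmod (c F r A))\<^sup>2)) / 2"
      by (intro divide_right_mono add_mono a_le b_le) simp
    also have "\<dots> = \<beta> * (\<Sum>A\<in>P. ((cmod (c F p A))\<^sup>2 + (cmod (c F r A))\<^sup>2) / 2)"
      by (simp add: sum.distrib sum_divide_distrib[symmetric] distrib_left)
    also have "(\<Sum>A\<in>P. ((cmod (c F p A))\<^sup>2 + (cmod (c F r A))\<^sup>2) / 2) = (\<Sum>A\<in>P. if F \<subseteq> A then ((cmod (p A))\<^sup>2 + (cmod (r A))\<^sup>2) / 2 else 0)"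
      by (rule sum.cong) (auto simp: c_def)
    finally show "cmod (\<Sum>K\<in>monics i. a F K * b F K) \<le> \<beta> * (\<Sum>A\<in>P. if F \<subseteq> A then ((cmod (p A))\<^sup>2 + (cmod (r A))\<^sup>2) / 2 else 0)" .
  qed
  also have "\<dots> = \<beta> * (\<Sum>F\<in>E. \<Sum>A\<in>P. if F \<subseteq> A then ((cmod (p A))\<^sup>2 + (cmod (r A))\<^sup>2) / 2 else 0)"
    by (rule sum_distrib_left[symmetric])
  also have "(\<Sum>F\<in>E. \<Sum>A\<in>P. if F \<subseteq> A then ((cmod (p A))\<^sup>2 + (cmod (r A))\<^sup>2) / 2 else 0) =
      (\<Sum>A\<in>P. 2 ^ card A * (((cmod (p A))\<^sup>2 + (cmod (r A))\<^sup>2) / 2))"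
    unfolding P_def by (rule sum_subsets_psets[OF finE]) (use PowE in \<open>auto simp: P_def\<close>)
  finally show ?thesis unfolding eq[symmetric] P_def[symmetric] .
qed

lemma sum_monics_dvd:
  fixes f :: "'a::{field,finite} poly \<Rightarrow> complex"
  assumes d: "d \<in> monics e"
  shows "(\<Sum>M\<in>monics m. if d dvd M then f M else 0) = (if e \<le> m then \<Sum>M\<in>monics (m - e). f (d * M) else 0)"
proof -
  have "(\<Sum>M\<in>monics m. if d dvd M then f M else 0) = (\<Sum>M\<in>{M\<in>monics m. d dvd M}. f M)"
    by (rule sum.inter_filter[symmetric]) simp
  also have "\<dots> = (if e \<le> m then \<Sum>M\<in>monics (m - e). f (d * M) else 0)"
  proof (cases "e \<le> m")
    case True
    have inj: "inj_on ((*) d) (monics (m - e))" using monics_nz[OF d] by (auto simp: inj_on_def)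
    have "{M\<in>monics m. d dvd M} = (*) d ` monics (m - e)"
    proof (intro equalityI subsetI)
      fix M assume M: "M \<in> {M\<in>monics m. d dvd M}"
      then obtain w where w: "M = d * w" by (auto elim: dvdE)
      have "lead_coeff (d * w) = 1" using M unfolding w monics_def by blast
      moreover have "lead_coeff d = 1" using d unfolding monics_def by blast
      ultimately have lw: "lead_coeff w = 1" by (rule monic_factor)
      then have "w \<noteq> 0" by auto
      then have "degree (d * w) = degree d + degree w" using monics_nz[OF d] by (simp add: degree_mult_eq)
      moreover have "degree (d * w) = m" using M unfolding w monics_def by blast
      moreover have "degree d = e" using d unfolding monics_def by blast
      ultimately have "degree w = m - e" by linarith
      with lw have "w \<in> monics (m - e)" unfolding monics_def by blast
      then show "M \<in> (*) d ` monics (m - e)" using w by blast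
    next
      fix M assume "M \<in> (*) d ` monics (m - e)"
      then show "M \<in> {M\<in>monics m. d dvd M}" using monics_mult[OF d, of _ "m - e"] True by auto
    qed
    then show ?thesis using True by (simp add: sum.reindex[OF inj])
  next
    case False
    have empty: "{M\<in>monics m. d dvd M} = {}"
    proof -
      have False if M: "M \<in> monics m" "d dvd M" for M
        using dvd_imp_degree_le[OF M(2) monics_nz[OF M(1)]] M(1) d False by (simp add: monics_def)
      then show ?thesis by blast
    qed
    show ?thesis using False by (simp only: empty sum.empty if_False)
  qed
  finally show ?thesis .
qed

text \<open>The left side is the indicator of \<open>M\<close> being coprime to
  \<open>\<Prod>G\<close>. The divisors of \<open>M\<close> among the \<open>\<Prod>D\<close>
  correspond to subsets of \<open>H\<close>, and their alternating sum vanishes unless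
  \<open>H\<close> is empty.\<close>

lemma (in charsys) chi_sq_coprime:
  assumes G: "finite G" "G \<subseteq> mirr"
  shows "chi \<chi> G M * cnj (chi \<chi> G M) = (\<Sum>D\<in>Pow G. (- 1) ^ card D * (if \<Prod>D dvd M then 1 else 0))"
proof -
  define H where "H = {p\<in>G. p dvd M}"
  have H: "finite H" "H \<subseteq> G" using G by (auto simp: H_def)
  have dv: "\<Prod>D dvd M \<longleftrightarrow> D \<subseteq> H" if D: "D \<in> Pow G" for D
  proof
    assume a: "\<Prod>D dvd M"
    have "finite D" using D G finite_subset by auto
    then have "p dvd M" if "p \<in> D" for p using dvd_trans[OF dvd_prodI a] that by blast
    then show "D \<subseteq> H" using D by (auto simp: H_def)
  next
    assume "D \<subseteq> H"
    then show "\<Prod>D dvd M" using D G finite_subset[of D G] by (intro prod_mirr_dvd) (auto simp: H_def)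
  qed
  have "(\<Sum>D\<in>Pow G. (- 1) ^ card D * (if \<Prod>D dvd M then 1 else 0)) = (\<Sum>D\<in>Pow G. if D \<subseteq> H then (- 1) ^ card D else (0::complex))"
    by (rule sum.cong) (simp_all add: dv)
  also have "\<dots> = (\<Sum>D\<in>{D\<in>Pow G. D \<subseteq> H}. (- 1) ^ card D)"
    by (rule sum.inter_filter[symmetric]) (use G in simp)
  also have "{D\<in>Pow G. D \<subseteq> H} = Pow H" using H by auto
  also have "(\<Sum>D\<in>Pow H. (- 1) ^ card D :: complex) = (if H = {} then 1 else 0)"
    by (rule alternating_sum_Pow) (rule H)
  also have "\<dots> = chi \<chi> G M * cnj (chi \<chi> G M)"
  proof (cases "H = {}")
    case True
    then have "cmod (chi \<chi> G M) = 1" by (intro chi_norm G) (auto simp: H_def)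
    then show ?thesis using True complex_norm_square[of "chi \<chi> G M"] by simp
  next
    case False
    then obtain p where "p \<in> G" "p dvd M" by (auto simp: H_def)
    then have "chi \<chi> G M = 0" by (rule chi_zero[OF G])
    then show ?thesis using False by simp
  qed
  finally show ?thesis by simp
qed

lemma psets_Un:
  assumes "G \<in> psets g" "A \<in> psets k" "A \<inter> G = {}"
  shows "G \<union> A \<in> psets (g + k)"
  using assms by (auto simp: psets_def sum.union_disjoint Int_commute)

lemma psets_Diff:
  assumes "S \<in> psets n" "G \<subseteq> S"
  shows "S - G \<in> psets (n - sum degree G)" "sum degree G \<le> n"
proof -
  have "finite S" "sum degree S = n" "S \<subseteq> mirr" using assms by (auto simp: psets_def)
  moreover from this have "sum degree S = sum degree G + sum degree (S - G)"
    using assms(2) by (metis sum.subset_diff add.commute)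
  ultimately show "S - G \<in> psets (n - sum degree G)" "sum degree G \<le> n" by (auto simp: psets_def)
qed

lemma pset_degree_pos: "finite S \<Longrightarrow> S \<subseteq> mirr \<Longrightarrow> S \<noteq> {} \<Longrightarrow> sum degree S > 0"
  by (rule sum_pos) (use mirrD(6) in blast)+

context recip_charsys begin

text \<open>The contribution of all pairs with greatest common divisor \<open>\<Prod>G\<close>: coprimality to \<open>G\<close> is removed by
  inclusion and exclusion, and the disjointness of \<open>A\<close> and \<open>B\<close> is restored in \<open>disjoint_bilinear\<close>.\<close>

lemma fixed_gcd_bound:
  fixes lam :: "'a poly set \<Rightarrow> complex"
  assumes G: "finite G" "G \<subseteq> mirr" "sum degree G + k = n" and k: "k > 0"
    and \<beta>: "\<And>i. sieve \<chi> i k (\<beta> i)"  "\<And>i. 0 \<le> \<beta> i"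
    and Y: "\<And>d i. d \<le> sum degree G \<Longrightarrow> d \<le> m \<Longrightarrow> i + (m - d) < 2 * k \<Longrightarrow>
          real CARD('a) / real CARD('a) ^ (2 * k - (m - d)) * real CARD('a) ^ k * \<beta> i \<le> Y" and Y0: "0 \<le> Y"
  shows "cmod (disjoint_form \<chi> m lam G k)
    \<le> 2 ^ card G * (2 * real n * Y) * (\<Sum>A\<in>psets k. 2 ^ card A * (if A \<inter> G = {} then (cmod (lam (G \<union> A)))\<^sup>2 else 0))"
proof -
  define q where "q = real CARD('a)"
  define P where "P = (psets k :: 'a poly set set)"
  define mu where "mu A = (restr lam G A)" for A
  define v where "v A = (if A \<inter> G = {} then (cmod (lam (G \<union> A)))\<^sup>2 else 0)" for A
  define s where "s D = ((- 1) ^ card D :: complex)" for D :: "'a poly set"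
  \<comment> \<open>Length of the dual sum: the modulus degree \<open>2 * k\<close> minus the degree
    that remains after dividing \<open>M\<close> by \<open>\<Prod>D\<close>.\<close>
  define N where "N D = 2 * k - (m - sum degree D)" for D :: "'a poly set"
  define \<D> where "\<D> = {D\<in>Pow G. sum degree D \<le> m}"
  \<comment> \<open>\<open>p\<close> and \<open>r\<close> absorb whatever depends on
    \<open>A\<close> alone or on \<open>B\<close> alone: coefficient, Gauss sum and value at
    \<open>\<Prod>D\<close>. What remains is a bilinear form in \<open>dual_corr\<close>.\<close>
  define p where "p D A = mu A * chi \<chi> A (\<Prod>D) * gauss \<chi> A 1" for D A
  define r where "r D B = cnj (mu B) * cnj (chi \<chi> B (\<Prod>D)) * gauss (\<lambda>p x. cnj (\<chi> p x)) B 1" for D B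
  define T where "T D i = (\<Sum>A\<in>P. \<Sum>B\<in>P. if A \<inter> B = {} then p D A * r D B * (dual_corr \<chi> i A B) else 0)" for D i
  have q1: "q > 1" using card_mono[of UNIV "{0, 1::'a}"] by (simp add: q_def)
  have fin\<D>: "finite \<D>" using G by (simp add: \<D>_def)
  have vnn: "v A \<ge> 0" for A by (simp add: v_def)
  have inner: "mu A * cnj (mu B) * (corr \<chi> m (G \<union> A) (G \<union> B))
     = (\<Sum>D\<in>\<D>. s D * (\<Sum>i<N D. of_real (dual_weight CARD('a) (N D) i) * (p D A * r D B * (dual_corr \<chi> i A B))))"
    if A: "A \<in> P" and B: "B \<in> P" and AB: "A \<inter> B = {}" for A B
  proof (cases "A \<inter> G = {} \<and> B \<inter> G = {}")
    case False
    then have "mu A * cnj (mu B) = 0" "p D A * r D B = 0" for D by (auto simp: mu_def p_def r_def)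
    then show ?thesis by (simp only: mult_zero_left mult_zero_right sum.neutral_const)
  next
    case True
    have fA: "finite A" "A \<subseteq> mirr" "sum degree A = k" and fB: "finite B" "B \<subseteq> mirr" "sum degree B = k"
      using A B by (auto simp: P_def psets_def)
    have "(corr \<chi> m (G \<union> A) (G \<union> B))
       = (\<Sum>M\<in>monics m. chi \<chi> A M * cnj (chi \<chi> B M) * (chi \<chi> G M * cnj (chi \<chi> G M)))"
      using True G fA fB by (intro sum.cong refl) (simp add: chi_union Int_commute mult_ac)
    also have "\<dots> = (\<Sum>M\<in>monics m. \<Sum>D\<in>Pow G. s D * (if \<Prod>D dvd M then chi \<chi> A M * cnj (chi \<chi> B M) else 0))"
      unfolding chi_sq_coprime[OF G(1,2)] sum_distrib_left
      by (intro sum.cong refl) (auto simp: s_def)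
    also have "\<dots> = (\<Sum>D\<in>Pow G. s D * (\<Sum>M\<in>monics m. if \<Prod>D dvd M then chi \<chi> A M * cnj (chi \<chi> B M) else 0))"
      by (subst sum.swap) (simp only: sum_distrib_left)
    also have "\<dots> = (\<Sum>D\<in>Pow G. if sum degree D \<le> m then
        s D * (\<Sum>M\<in>monics (m - sum degree D). chi \<chi> A (\<Prod>D * M) * cnj (chi \<chi> B (\<Prod>D * M))) else 0)"
    proof (intro sum.cong refl)
      fix D assume D: "D \<in> Pow G"
      then have "D \<in> psets (sum degree D)" using G finite_subset[of D G] by (auto simp: psets_def)
      from sum_monics_dvd[OF pset_monics[OF this], where m = m and f = "\<lambda>M. chi \<chi> A M * cnj (chi \<chi> B M)"]
      show "s D * (\<Sum>M\<in>monics m. if \<Prod>D dvd M then chi \<chi> A M * cnj (chi \<chi> B M) else 0) = (if sum degree D \<le> m then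
        s D * (\<Sum>M\<in>monics (m - sum degree D). chi \<chi> A (\<Prod>D * M) * cnj (chi \<chi> B (\<Prod>D * M))) else 0)" by simp
    qed
    also have "\<dots> = (\<Sum>D\<in>\<D>. s D * (\<Sum>M\<in>monics (m - sum degree D). chi \<chi> A (\<Prod>D * M) * cnj (chi \<chi> B (\<Prod>D * M))))"
      unfolding \<D>_def by (rule sum.inter_filter[symmetric]) (use G in simp)
    also have "\<dots> = (\<Sum>D\<in>\<D>. s D * (chi \<chi> A (\<Prod>D) * cnj (chi \<chi> B (\<Prod>D)) * (corr \<chi> (m - sum degree D) A B)))"
      by (intro sum.cong refl arg_cong2[where f = "(*)"]) (simp add: chi_mult[OF fA(2)] chi_mult[OF fB(2)] sum_distrib_left mult_ac)
    also have "\<dots> = (\<Sum>D\<in>\<D>. s D * (chi \<chi> A (\<Prod>D) * cnj (chi \<chi> B (\<Prod>D)) * (gauss \<chi> A 1 * gauss (\<lambda>p x. cnj (\<chi> p x)) B 1 *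
        (\<Sum>i<N D. of_real (dual_weight CARD('a) (N D) i) * (dual_corr \<chi> i A B)))))"
      unfolding pair_sum_dual[OF fA fB AB k] N_def ..
    finally show ?thesis
      by (simp only:) (simp add: p_def r_def sum_distrib_left mult_ac)
  qed
  have "(\<Sum>A\<in>P. \<Sum>B\<in>P. if A \<inter> B = {} then mu A * cnj (mu B) *
         (corr \<chi> m (G \<union> A) (G \<union> B)) else 0)
     = (\<Sum>A\<in>P. \<Sum>B\<in>P. \<Sum>D\<in>\<D>. s D * (\<Sum>i<N D. of_real (dual_weight CARD('a) (N D) i) *
          (if A \<inter> B = {} then p D A * r D B * (dual_corr \<chi> i A B) else 0)))"
    using inner by (intro sum.cong refl) (auto simp del: Pow_iff)
  also have "\<dots> = (\<Sum>D\<in>\<D>. \<Sum>A\<in>P. \<Sum>B\<in>P. s D * (\<Sum>i<N D. of_real (dual_weight CARD('a) (N D) i) *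
          (if A \<inter> B = {} then p D A * r D B * (dual_corr \<chi> i A B) else 0)))"
    by (rule sum_rotate[symmetric])
  also have "\<dots> = (\<Sum>D\<in>\<D>. s D * (\<Sum>i<N D. of_real (dual_weight CARD('a) (N D) i) * T D i))"
  proof (intro sum.cong refl)
    fix D
    have "(\<Sum>A\<in>P. \<Sum>B\<in>P. s D * (\<Sum>i<N D. of_real (dual_weight CARD('a) (N D) i) *
          (if A \<inter> B = {} then p D A * r D B * (dual_corr \<chi> i A B) else 0)))
      = s D * (\<Sum>A\<in>P. \<Sum>B\<in>P. \<Sum>i<N D. of_real (dual_weight CARD('a) (N D) i) *
          (if A \<inter> B = {} then p D A * r D B * (dual_corr \<chi> i A B) else 0))"
      by (simp only: sum_distrib_left)
    also have "(\<Sum>A\<in>P. \<Sum>B\<in>P. \<Sum>i<N D. of_real (dual_weight CARD('a) (N D) i) *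
          (if A \<inter> B = {} then p D A * r D B * (dual_corr \<chi> i A B) else 0))
       = (\<Sum>i<N D. of_real (dual_weight CARD('a) (N D) i) * T D i)"
      unfolding T_def sum_distrib_left by (rule sum_rotate[symmetric])
    finally show "(\<Sum>A\<in>P. \<Sum>B\<in>P. s D * (\<Sum>i<N D. of_real (dual_weight CARD('a) (N D) i) *
          (if A \<inter> B = {} then p D A * r D B * (dual_corr \<chi> i A B) else 0)))
      = s D * (\<Sum>i<N D. of_real (dual_weight CARD('a) (N D) i) * T D i)" .
  qed
  finally have eq: "(\<Sum>A\<in>P. \<Sum>B\<in>P. if A \<inter> B = {} then mu A * cnj (mu B) *
         (corr \<chi> m (G \<union> A) (G \<union> B)) else 0)
     = (\<Sum>D\<in>\<D>. s D * (\<Sum>i<N D. of_real (dual_weight CARD('a) (N D) i) * T D i))" .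
  define V where "V = (\<Sum>A\<in>P. 2 ^ card A * v A)"
  have V0: "V \<ge> 0" by (auto simp: V_def vnn intro!: sum_nonneg)
  have T_le: "cmod (T D i) \<le> \<beta> i * (q ^ k * V)" for D i
  proof -
    have "cmod (T D i) \<le> \<beta> i * (\<Sum>A\<in>P. 2 ^ card A * (((cmod (p D A))\<^sup>2 + (cmod (r D A))\<^sup>2) / 2))"
      unfolding T_def P_def by (rule disjoint_bilinear[OF \<beta>(1)])
    also have "\<dots> \<le> \<beta> i * (\<Sum>A\<in>P. 2 ^ card A * (q ^ k * v A))"
    proof (intro mult_left_mono sum_mono \<beta>(2))
      fix A assume "A \<in> P"
      then have fA: "finite A" "A \<subseteq> mirr" "sum degree A = k" by (auto simp: P_def psets_def)
      have "degree (\<Prod>A) = k" using degree_prod_mirr[OF fA(2)] fA by simp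
      then have W: "(cmod (gauss \<chi> A 1))\<^sup>2 = q ^ k" "(cmod (gauss (\<lambda>p x. cnj (\<chi> p x)) A 1))\<^sup>2 = q ^ k"
        using gauss_norm[OF fA(1,2)] cnj_gauss_norm[OF fA(1,2)] by (simp_all add: q_def)
      have c: "(cmod (chi \<chi> A (\<Prod>D)))\<^sup>2 \<le> 1" using chi_le[OF fA(2)] by (simp add: power_le_one)
      have m: "(cmod (mu A))\<^sup>2 = v A" by (simp add: mu_def v_def)
      have "v A * (cmod (chi \<chi> A (\<Prod>D)))\<^sup>2 * q ^ k \<le> v A * 1 * q ^ k"
        using c vnn q1 by (intro mult_right_mono mult_left_mono) auto
      then have "(cmod (p D A))\<^sup>2 \<le> q ^ k * v A" "(cmod (r D A))\<^sup>2 \<le> q ^ k * v A"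
        by (simp_all add: p_def r_def norm_mult power_mult_distrib W m mult_ac)
      then show "((cmod (p D A))\<^sup>2 + (cmod (r D A))\<^sup>2) / 2 \<le> q ^ k * v A" by simp
    qed simp
    also have "(\<Sum>A\<in>P. 2 ^ card A * (q ^ k * v A)) = q ^ k * V"
      by (simp add: V_def sum_distrib_left mult_ac)
    finally show ?thesis .
  qed
  have "cmod (\<Sum>D\<in>\<D>. s D * (\<Sum>i<N D. of_real (dual_weight CARD('a) (N D) i) * T D i))
      \<le> (\<Sum>D\<in>\<D>. cmod (\<Sum>i<N D. of_real (dual_weight CARD('a) (N D) i) * T D i))"
    by (rule order_trans[OF norm_sum]) (simp add: norm_mult s_def norm_power)
  also have "\<dots> \<le> (\<Sum>D\<in>\<D>. 2 * real n * Y * V)"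
  proof (rule sum_mono)
    fix D assume D: "D \<in> \<D>"
    then have dG: "sum degree D \<le> sum degree G" using G by (auto simp: \<D>_def intro!: sum_mono2)
    have dm: "sum degree D \<le> m" using D by (simp add: \<D>_def)
    have "cmod (\<Sum>i<N D. of_real (dual_weight CARD('a) (N D) i) * T D i) \<le> (\<Sum>i<N D. Y * V)"
    proof (rule order_trans[OF norm_sum], rule sum_mono)
      fix i assume i: "i \<in> {..<N D}"
      have "cmod (of_real (dual_weight CARD('a) (N D) i) * T D i) = \<bar>dual_weight CARD('a) (N D) i\<bar> * cmod (T D i)"
        by (simp add: norm_mult)
      also have "\<dots> \<le> (q / q ^ N D) * (\<beta> i * (q ^ k * V))"
        using dual_weight_bound[of "CARD('a)" "N D" i] q1 T_le[of D i] V0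
        by (intro mult_mono) (auto simp: q_def)
      also have "\<dots> = (q / q ^ N D * q ^ k * \<beta> i) * V" by (simp add: mult_ac)
      also have "\<dots> \<le> Y * V"
      proof (rule mult_right_mono[OF _ V0])
        have "i + (m - sum degree D) < 2 * k" using i by (auto simp: N_def)
        from Y[OF dG dm this] show "q / q ^ N D * q ^ k * \<beta> i \<le> Y" by (simp add: q_def N_def)
      qed
      finally show "cmod (of_real (dual_weight CARD('a) (N D) i) * T D i) \<le> Y * V" .
    qed
    also have "\<dots> = real (N D) * (Y * V)" by simp
    also have "\<dots> \<le> (2 * real n) * (Y * V)"
    proof (rule mult_right_mono)
      have "N D \<le> 2 * n" using G(3) by (simp add: N_def)
      then show "real (N D) \<le> 2 * real n" by linarith
    qed (use V0 Y0 in simp)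
    finally show "cmod (\<Sum>i<N D. of_real (dual_weight CARD('a) (N D) i) * T D i) \<le> 2 * real n * Y * V" by (simp add: mult_ac)
  qed
  also have "\<dots> = real (card \<D>) * (2 * real n * Y * V)" by simp
  also have "\<dots> \<le> 2 ^ card G * (2 * real n * Y * V)"
  proof (rule mult_right_mono)
    have "card \<D> \<le> card (Pow G)" using G by (intro card_mono) (auto simp: \<D>_def)
    then have "card \<D> \<le> 2 ^ card G" using G by (simp add: card_Pow)
    then show "real (card \<D>) \<le> 2 ^ card G" by (metis of_nat_le_iff of_nat_numeral of_nat_power)
  qed (use V0 Y0 in simp)
  finally have "cmod (\<Sum>A\<in>P. \<Sum>B\<in>P. if A \<inter> B = {} then mu A * cnj (mu B) *
         (corr \<chi> m (G \<union> A) (G \<union> B)) else 0) \<le> 2 ^ card G * (2 * real n * Y) * V"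
    unfolding eq by (simp add: mult_ac)
  then show ?thesis by (simp only: P_def V_def v_def mu_def)
qed

end

lemma real_sum_cmod_sq:
  fixes f :: "'b \<Rightarrow> 'c \<Rightarrow> complex"
  shows "complex_of_real (\<Sum>M\<in>U. (cmod (\<Sum>S\<in>P. f S M))\<^sup>2) = (\<Sum>S\<in>P. \<Sum>T\<in>P. \<Sum>M\<in>U. f S M * cnj (f T M))"
proof -
  have "complex_of_real (\<Sum>M\<in>U. (cmod (\<Sum>S\<in>P. f S M))\<^sup>2) = (\<Sum>M\<in>U. (\<Sum>S\<in>P. f S M) * cnj (\<Sum>T\<in>P. f T M))"
    unfolding of_real_sum by (intro sum.cong refl complex_norm_square)
  also have "\<dots> = (\<Sum>M\<in>U. \<Sum>S\<in>P. \<Sum>T\<in>P. f S M * cnj (f T M))"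
    by (simp add: sum_product)
  also have "\<dots> = (\<Sum>S\<in>P. \<Sum>T\<in>P. \<Sum>M\<in>U. f S M * cnj (f T M))" by (rule sum_rotate)
  finally show ?thesis .
qed

text \<open>The diagonal \<open>S = T\<close> gives \<open>q ^ m\<close>. The quantity bounded by
  \<open>Y\<close> collects the dual weight, the two Gauss sums of squared modulus
  \<open>q ^ k\<close> each, and the norm of the dual sieve. \<open>D\<close> pays for subsets of
  \<open>G\<close> and of \<open>A\<close>, together \<open>2 ^ card S\<close>, and for the choice
  of \<open>G\<close> inside \<open>S\<close>.\<close>

lemma (in recip_charsys) poisson_sieve:
  assumes D: "\<And>S. S \<in> (psets n :: 'a poly set set) \<Longrightarrow> 4 ^ card S \<le> (D :: real)"
    and \<beta>: "\<And>i k. sieve \<chi> i k (\<beta> i k)"  "\<And>i k. 0 \<le> \<beta> i k"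
    and Y: "\<And>k d i. 0 < k \<Longrightarrow> k + d \<le> n \<Longrightarrow> d \<le> m \<Longrightarrow> i + (m - d) < 2 * k \<Longrightarrow>
          real CARD('a) / real CARD('a) ^ (2 * k - (m - d)) * real CARD('a) ^ k * \<beta> i k \<le> Y"
    and Y0: "0 \<le> Y"
  shows "sieve \<chi> m n (real CARD('a) ^ m + 2 * real n * D * Y)"
  unfolding sieve_def
proof (intro allI)
  fix lam :: "'a poly set \<Rightarrow> complex"
  define P where "P = (psets n :: 'a poly set set)"
  define q where "q = real CARD('a)"
  define L where "L = (sqnorm P lam)"
  define g where "g S T = lam S * cnj (lam T) * (corr \<chi> m S T)" for S T
  define H where "H = (\<Union>h<n. psets h :: 'a poly set set)"
  have finP: "finite P" by (simp add: P_def)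
  have finH: "finite H" by (simp add: H_def)
  have Psub: "S \<in> P \<Longrightarrow> S \<subseteq> mirr" "S \<in> P \<Longrightarrow> finite S" "S \<in> P \<Longrightarrow> sum degree S = n" for S by (auto simp: P_def psets_def)
  have "complex_of_real (\<Sum>M\<in>monics m. (cmod (char_form \<chi> P lam M))\<^sup>2) = (\<Sum>S\<in>P. \<Sum>T\<in>P. g S T)"
    unfolding real_sum_cmod_sq g_def by (simp add: sum_distrib_left mult_ac)
  also have "\<dots> = (\<Sum>(S, T)\<in>P \<times> P. g S T)" by (rule sum.cartesian_product)
  also have "P \<times> P = (\<lambda>S. (S, S)) ` P \<union> {(S, T)\<in>P \<times> P. S \<noteq> T}" by auto
  also have "(\<Sum>(S, T)\<in>(\<lambda>S. (S, S)) ` P \<union> {(S, T)\<in>P \<times> P. S \<noteq> T}. g S T) =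
      (\<Sum>(S, T)\<in>(\<lambda>S. (S, S)) ` P. g S T) + (\<Sum>(S, T)\<in>{(S, T)\<in>P \<times> P. S \<noteq> T}. g S T)"
    by (rule sum.union_disjoint) (use finP in \<open>auto intro: finite_subset[of _ "P \<times> P"]\<close>)
  also have "(\<Sum>(S, T)\<in>(\<lambda>S. (S, S)) ` P. g S T) = (\<Sum>S\<in>P. g S S)"
    by (subst sum.reindex) (auto simp: inj_on_def)
  finally have split: "complex_of_real (\<Sum>M\<in>monics m. (cmod (char_form \<chi> P lam M))\<^sup>2) =
    (\<Sum>S\<in>P. g S S) + (\<Sum>(S, T)\<in>{(S, T)\<in>P \<times> P. S \<noteq> T}. g S T)" .
  have diag: "cmod (\<Sum>S\<in>P. g S S) \<le> q ^ m * L"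
  proof -
    have "cmod (\<Sum>S\<in>P. g S S) \<le> (\<Sum>S\<in>P. q ^ m * (cmod (lam S))\<^sup>2)"
    proof (rule order_trans[OF norm_sum], rule sum_mono)
      fix S assume S: "S \<in> P"
      have "cmod (corr \<chi> m S S) \<le> (\<Sum>M\<in>(monics m :: 'a poly set). 1)"
        using chi_le[OF Psub(1)[OF S]]
        by (intro order_trans[OF norm_sum] sum_mono) (simp add: norm_mult mult_le_one)
      also have "\<dots> = q ^ m" by (simp add: q_def card_monics)
      finally have "cmod (corr \<chi> m S S) \<le> q ^ m" .
      then have "(cmod (lam S))\<^sup>2 * cmod (corr \<chi> m S S) \<le> (cmod (lam S))\<^sup>2 * q ^ m"
        by (rule mult_left_mono) simp
      then show "cmod (g S S) \<le> q ^ m * (cmod (lam S))\<^sup>2"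
        by (simp add: g_def norm_mult power2_eq_square mult_ac)
    qed
    then show ?thesis by (simp add: L_def sum_distrib_left)
  qed
  \<comment> \<open>Distinct sets of equal total degree meet in a set of smaller degree, so the
    cofactor degree \<open>k\<close> is positive, as the dual formula requires.\<close>
  have sub: "(\<lambda>(S, T). S \<inter> T) ` {(S, T)\<in>P \<times> P. S \<noteq> T} \<subseteq> H"
  proof clarify
    fix S T assume S: "S \<in> P" and T: "T \<in> P" and ne: "S \<noteq> T"
    have "S - T \<noteq> {}"
    proof
      assume e: "S - T = {}"
      then have "T - S \<noteq> {}" using ne by auto
      then have "sum degree (T - S) > 0" using Psub[OF T] by (intro pset_degree_pos) auto
      moreover have "sum degree T = sum degree S + sum degree (T - S)"
        using e Psub[OF T] by (metis Diff_eq_empty_iff add.commute sum.subset_diff)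
      ultimately show False using Psub[OF S] Psub[OF T] by simp
    qed
    then have "sum degree (S - T) > 0" using Psub[OF S] by (intro pset_degree_pos) auto
    moreover have "sum degree S = sum degree (S \<inter> T) + sum degree (S - T)"
      using Psub(2)[OF S] by (subst sum.union_disjoint[symmetric]) (auto simp: Int_Diff_Un)
    ultimately have "sum degree (S \<inter> T) < n" using Psub[OF S] by simp
    then show "S \<inter> T \<in> H" using Psub[OF S] by (auto simp: H_def psets_def)
  qed
  have "(\<Sum>(S, T)\<in>{(S, T)\<in>P \<times> P. S \<noteq> T}. g S T) =
     (\<Sum>G\<in>H. \<Sum>(S, T)\<in>{x\<in>{(S, T)\<in>P \<times> P. S \<noteq> T}. (\<lambda>(S, T). S \<inter> T) x = G}. g S T)"
    by (rule sum.group[symmetric]) (use finP finH sub in \<open>auto intro: finite_subset[of _ "P \<times> P"]\<close>)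
  also have "\<dots> = (\<Sum>G\<in>H. \<Sum>A\<in>psets (n - sum degree G). \<Sum>B\<in>psets (n - sum degree G). if A \<inter> B = {} then
       (restr lam G A) * cnj (restr lam G B) *
         (corr \<chi> m (G \<union> A) (G \<union> B)) else 0)"
  proof (rule sum.cong[OF refl])
    fix G assume "G \<in> H"
    then have G: "finite G" "G \<subseteq> mirr" "sum degree G < n" by (auto simp: H_def psets_def)
    define k where "k = n - sum degree G"
    have Gk: "G \<in> psets (n - k)" "k > 0" "n - k + k = n" using G by (auto simp: psets_def k_def)
    let ?Q = "{x\<in>psets k \<times> psets k. fst x \<inter> snd x = {} \<and> fst x \<inter> G = {} \<and> snd x \<inter> G = {}}"
    have "(\<Sum>(S, T)\<in>{x\<in>{(S, T)\<in>P \<times> P. S \<noteq> T}. (\<lambda>(S, T). S \<inter> T) x = G}. g S T)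
        = (\<Sum>(A, B)\<in>?Q. g (G \<union> A) (G \<union> B))"
    proof (rule sum.reindex_bij_witness[where i = "\<lambda>(A, B). (G \<union> A, G \<union> B)" and j = "\<lambda>(S, T). (S - G, T - G)"], goal_cases)
      case (1 x) then show ?case by auto
    next
      case (2 x)
      then obtain S T where x: "x = (S, T)" "S \<in> P" "T \<in> P" "S \<inter> T = G" by auto
      have "S - G \<in> psets k" "T - G \<in> psets k"
        using psets_Diff(1)[of S n G] psets_Diff(1)[of T n G] x by (auto simp: P_def k_def)
      then show ?case using x by auto
    next
      case (3 x) then show ?case by auto
    next
      case (4 x)
      then obtain A B where x: "x = (A, B)" "A \<in> psets k" "B \<in> psets k" "A \<inter> B = {}" "A \<inter> G = {}" "B \<inter> G = {}" by (cases x) auto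
      have "G \<union> A \<in> P" "G \<union> B \<in> P"
        using psets_Un[OF Gk(1) x(2,5)] psets_Un[OF Gk(1) x(3,6)] Gk(3) by (auto simp: P_def)
      moreover have "A \<noteq> {}" using x(2) Gk(2) by (auto simp: psets_def)
      ultimately show ?case using x by auto
    next
      case (5 x) then show ?case by auto
    qed
    also have "\<dots> = (\<Sum>x\<in>psets k \<times> psets k. if fst x \<inter> snd x = {} \<and> fst x \<inter> G = {} \<and> snd x \<inter> G = {} then g (G \<union> fst x) (G \<union> snd x) else 0)"
      unfolding case_prod_unfold by (rule sum.inter_filter) simp
    also have "\<dots> = (\<Sum>A\<in>psets k. \<Sum>B\<in>psets k. if A \<inter> B = {} \<and> A \<inter> G = {} \<and> B \<inter> G = {} then g (G \<union> A) (G \<union> B) else 0)"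
      by (simp only: sum.cartesian_product case_prod_unfold)
    also have "\<dots> = (disjoint_form \<chi> m lam G k)"
      by (intro sum.cong refl) (simp add: g_def)
    finally show "(\<Sum>(S, T)\<in>{x\<in>{(S, T)\<in>P \<times> P. S \<noteq> T}. (\<lambda>(S, T). S \<inter> T) x = G}. g S T) =
      (disjoint_form \<chi> m lam G (n - sum degree G))"
      unfolding k_def .
  qed
  finally have "cmod (\<Sum>(S, T)\<in>{(S, T)\<in>P \<times> P. S \<noteq> T}. g S T) \<le>
      (\<Sum>G\<in>H. cmod (disjoint_form \<chi> m lam G (n - sum degree G)))"
    by (simp only: norm_sum)
  also have "\<dots> \<le> (\<Sum>G\<in>H. (2 * real n * Y) * (\<Sum>S\<in>P. if G \<subseteq> S then 2 ^ card S * (cmod (lam S))\<^sup>2 else 0))"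
  proof (rule sum_mono)
    fix G assume "G \<in> H"
    then have G: "finite G" "G \<subseteq> mirr" "sum degree G < n" by (auto simp: H_def psets_def)
    define k where "k = n - sum degree G"
    have Gk: "G \<in> psets (n - k)" "k > 0" "n - k + k = n" "sum degree G + k = n" using G by (auto simp: psets_def k_def)
    let ?A = "{A\<in>psets k. A \<inter> G = {}}"
    have inj: "inj_on ((\<union>) G) ?A" by (auto simp: inj_on_def)
    have "2 ^ card G * (\<Sum>A\<in>psets k. 2 ^ card A * (if A \<inter> G = {} then (cmod (lam (G \<union> A)))\<^sup>2 else 0))
        = (\<Sum>A\<in>psets k. if A \<inter> G = {} then 2 ^ card (G \<union> A) * (cmod (lam (G \<union> A)))\<^sup>2 else 0)"
      unfolding sum_distrib_left
    proof (intro sum.cong refl)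
      fix A :: "'a poly set" assume A: "A \<in> psets k"
      have "card (G \<union> A) = card G + card A" if "A \<inter> G = {}"
        using that finite_pset[OF A] G(1) by (intro card_Un_disjoint) auto
      then show "2 ^ card G * (2 ^ card A * (if A \<inter> G = {} then (cmod (lam (G \<union> A)))\<^sup>2 else 0))
        = (if A \<inter> G = {} then 2 ^ card (G \<union> A) * (cmod (lam (G \<union> A)))\<^sup>2 else 0)"
        by (simp add: power_add)
    qed
    also have "\<dots> = (\<Sum>A\<in>?A. 2 ^ card (G \<union> A) * (cmod (lam (G \<union> A)))\<^sup>2)"
      by (rule sum.inter_filter[OF finite_psets, symmetric])
    also have "\<dots> = (\<Sum>S\<in>(\<union>) G ` ?A. 2 ^ card S * (cmod (lam S))\<^sup>2)"
      unfolding sum.reindex[OF inj] comp_def ..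
    also have "\<dots> \<le> (\<Sum>S\<in>{S\<in>P. G \<subseteq> S}. 2 ^ card S * (cmod (lam S))\<^sup>2)"
    proof (rule sum_mono2)
      have "G \<union> A \<in> P" if "A \<in> psets k" "A \<inter> G = {}" for A
        using psets_Un[OF Gk(1) that] by (simp only: P_def Gk(3))
      then show "(\<union>) G ` ?A \<subseteq> {S\<in>P. G \<subseteq> S}" by auto
    qed (use finP in auto)
    also have "\<dots> = (\<Sum>S\<in>P. if G \<subseteq> S then 2 ^ card S * (cmod (lam S))\<^sup>2 else 0)"
      by (rule sum.inter_filter) (rule finP)
    finally have le: "2 ^ card G * (\<Sum>A\<in>psets k. 2 ^ card A * (if A \<inter> G = {} then (cmod (lam (G \<union> A)))\<^sup>2 else 0))
       \<le> (\<Sum>S\<in>P. if G \<subseteq> S then 2 ^ card S * (cmod (lam S))\<^sup>2 else 0)" .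
    have "cmod (disjoint_form \<chi> m lam G k)
      \<le> 2 ^ card G * (2 * real n * Y) * (\<Sum>A\<in>psets k. 2 ^ card A * (if A \<inter> G = {} then (cmod (lam (G \<union> A)))\<^sup>2 else 0))"
      by (rule fixed_gcd_bound[OF G(1,2) Gk(4,2) \<beta>(1)[of _ k] \<beta>(2)[of _ k]])
         (use Y[of k] Gk Y0 in auto)
    also have "\<dots> = (2 * real n * Y) * (2 ^ card G * (\<Sum>A\<in>psets k. 2 ^ card A * (if A \<inter> G = {} then (cmod (lam (G \<union> A)))\<^sup>2 else 0)))"
      by (simp only: mult_ac)
    also have "\<dots> \<le> (2 * real n * Y) * (\<Sum>S\<in>P. if G \<subseteq> S then 2 ^ card S * (cmod (lam S))\<^sup>2 else 0)"
      by (rule mult_left_mono[OF le]) (use Y0 in simp)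
    finally show "cmod (disjoint_form \<chi> m lam G (n - sum degree G))
      \<le> (2 * real n * Y) * (\<Sum>S\<in>P. if G \<subseteq> S then 2 ^ card S * (cmod (lam S))\<^sup>2 else 0)"
      unfolding k_def .
  qed
  also have "\<dots> = (2 * real n * Y) * (\<Sum>G\<in>H. \<Sum>S\<in>P. if G \<subseteq> S then 2 ^ card S * (cmod (lam S))\<^sup>2 else 0)"
    by (rule sum_distrib_left[symmetric])
  \<comment> \<open>All subsets of members of \<open>P\<close> are added to the range of
    \<open>G\<close>, so that each \<open>S\<close> is met by exactly its \<open>2 ^ card S\<close>
    subsets.\<close>
  also have "\<dots> \<le> (2 * real n * Y) * (\<Sum>G\<in>H \<union> \<Union> (Pow ` P). \<Sum>S\<in>P. if G \<subseteq> S then 2 ^ card S * (cmod (lam S))\<^sup>2 else 0)"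
    using Y0 finH finP Psub(2) by (intro mult_left_mono sum_mono2) (auto intro!: sum_nonneg)
  also have "(\<Sum>G\<in>H \<union> \<Union> (Pow ` P). \<Sum>S\<in>P. if G \<subseteq> S then 2 ^ card S * (cmod (lam S))\<^sup>2 else 0)
      = (\<Sum>S\<in>P. 2 ^ card S * (2 ^ card S * (cmod (lam S))\<^sup>2))"
    unfolding P_def by (rule sum_subsets_psets) (use finH finP Psub(2) in \<open>auto simp: P_def\<close>)
  also have "(2 * real n * Y) * (\<Sum>S\<in>P. 2 ^ card S * (2 ^ card S * (cmod (lam S))\<^sup>2)) \<le>
      (2 * real n * Y) * (\<Sum>S\<in>P. D * (cmod (lam S))\<^sup>2)"
  proof (intro mult_left_mono sum_mono)
    fix S assume "S \<in> P"
    then have "4 ^ card S \<le> D" using D by (simp add: P_def)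
    then have "4 ^ card S * (cmod (lam S))\<^sup>2 \<le> D * (cmod (lam S))\<^sup>2" by (rule mult_right_mono) simp
    moreover have "(4::real) ^ card S = 2 ^ card S * 2 ^ card S" by (simp add: power_mult_distrib[symmetric])
    ultimately show "2 ^ card S * (2 ^ card S * (cmod (lam S))\<^sup>2) \<le> D * (cmod (lam S))\<^sup>2" by (simp add: mult.assoc)
  qed (use Y0 in simp)
  finally have off: "cmod (\<Sum>(S, T)\<in>{(S, T)\<in>P \<times> P. S \<noteq> T}. g S T) \<le> (2 * real n * D * Y) * L"
    by (simp only: L_def sum_distrib_left[symmetric] mult_ac)
  have nn: "0 \<le> (\<Sum>M\<in>monics m. (cmod (char_form \<chi> P lam M))\<^sup>2)" by (intro sum_nonneg) simp
  have "(\<Sum>M\<in>monics m. (cmod (char_form \<chi> P lam M))\<^sup>2) =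
     cmod (complex_of_real (\<Sum>M\<in>monics m. (cmod (char_form \<chi> P lam M))\<^sup>2))"
    using nn by (simp only: norm_of_real abs_of_nonneg)
  also have "\<dots> \<le> q ^ m * L + (2 * real n * D * Y) * L"
    unfolding split by (rule norm_triangle_le[OF add_mono[OF diag off]])
  finally show "(\<Sum>M\<in>monics m. (cmod (char_form \<chi> (psets n) lam M))\<^sup>2)
     \<le> (real CARD('a) ^ m + 2 * real n * D * Y) * (sqnorm (psets n) lam)"
    by (simp only: P_def L_def q_def distrib_right)
qed

section \<open>Duality and monotonicity\<close>

text \<open>Both indices range over \<open>psets\<close>, so that duality and reciprocity can
  exchange their roles.\<close>

definition sieve_sf :: "'a::{field,finite} symbol \<Rightarrow> nat \<Rightarrow> nat \<Rightarrow> real \<Rightarrow> bool" where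
  "sieve_sf \<chi> m n c \<longleftrightarrow> (\<forall>lam. (\<Sum>R\<in>psets m. (cmod (char_form \<chi> (psets n) lam (\<Prod>R)))\<^sup>2)
      \<le> c * (sqnorm (psets n) lam))"

lemma sieve_imp_sieve_sf:
  fixes \<chi> :: "'a::{field,finite} symbol"
  assumes "sieve \<chi> m n c" shows "sieve_sf \<chi> m n c"
  unfolding sieve_sf_def
proof
  fix lam :: "'a poly set \<Rightarrow> complex"
  let ?F = "\<lambda>M. (cmod (char_form \<chi> (psets n) lam M))\<^sup>2"
  have inj: "inj_on (\<lambda>S. \<Prod>S) (psets m :: 'a poly set set)"
    using bij_betw_psets by (rule bij_betw_imp_inj_on)
  have "(\<Sum>R\<in>psets m. ?F (\<Prod>R)) = (\<Sum>M\<in>(\<lambda>S. \<Prod>S) ` psets m. ?F M)"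
    unfolding sum.reindex[OF inj] comp_def ..
  also have "\<dots> \<le> (\<Sum>M\<in>monics m. ?F M)"
    by (rule sum_mono2) (auto intro: pset_monics)
  also have "\<dots> \<le> c * (sqnorm (psets n) lam)" using assms unfolding sieve_def by (rule spec)
  finally show "(\<Sum>R\<in>psets m. ?F (\<Prod>R)) \<le> c * (sqnorm (psets n) lam)" .
qed

lemma sieve_mono:
  fixes \<chi> :: "'a::{field,finite} symbol"
  assumes "sieve \<chi> m n c" "c \<le> c'" shows "sieve \<chi> m n c'"
  unfolding sieve_def
proof
  fix lam :: "'a poly set \<Rightarrow> complex"
  have "c * (sqnorm (psets n) lam) \<le> c' * (sqnorm (psets n) lam)"
    by (rule mult_right_mono[OF assms(2)]) (simp add: sum_nonneg)
  then show "(\<Sum>M\<in>monics m. (cmod (char_form \<chi> (psets n) lam M))\<^sup>2) \<le> c' * (sqnorm (psets n) lam)"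
    using spec[OF assms(1)[unfolded sieve_def], of lam] by (rule order_trans[rotated])
qed

lemma sieve_sf_mono:
  fixes \<chi> :: "'a::{field,finite} symbol"
  assumes "sieve_sf \<chi> m n c" "c \<le> c'" shows "sieve_sf \<chi> m n c'"
  unfolding sieve_sf_def
proof
  fix lam :: "'a poly set \<Rightarrow> complex"
  have "c * (sqnorm (psets n) lam) \<le> c' * (sqnorm (psets n) lam)"
    by (rule mult_right_mono[OF assms(2)]) (simp add: sum_nonneg)
  then show "(\<Sum>R\<in>psets m. (cmod (char_form \<chi> (psets n) lam (\<Prod>R)))\<^sup>2) \<le> c' * (sqnorm (psets n) lam)"
    using spec[OF assms(1)[unfolded sieve_sf_def], of lam] by (rule order_trans[rotated])
qed

section \<open>Transposition of the sieve matrix\<close>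

lemma Cauchy_Schwarz_real_sum:
  fixes a b :: "'b \<Rightarrow> real"
  shows "(\<Sum>i\<in>I. a i * b i)\<^sup>2 \<le> (\<Sum>i\<in>I. (a i)\<^sup>2) * (\<Sum>i\<in>I. (b i)\<^sup>2)"
proof -
  have "0 \<le> (\<Sum>i\<in>I. \<Sum>j\<in>I. (a i * b j - a j * b i)\<^sup>2)" by (intro sum_nonneg) simp
  also have "\<dots> = (\<Sum>i\<in>I. \<Sum>j\<in>I. (a i)\<^sup>2 * (b j)\<^sup>2) + (\<Sum>i\<in>I. \<Sum>j\<in>I. (b i)\<^sup>2 * (a j)\<^sup>2) - 2 * (\<Sum>i\<in>I. \<Sum>j\<in>I. (a i * b i) * (a j * b j))"
    by (simp add: power2_diff power_mult_distrib sum.distrib sum_subtractf sum_distrib_left mult_ac)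
  also have "\<dots> = 2 * ((\<Sum>i\<in>I. (a i)\<^sup>2) * (\<Sum>i\<in>I. (b i)\<^sup>2)) - 2 * (\<Sum>i\<in>I. a i * b i)\<^sup>2"
    unfolding sum_product[symmetric] by (simp add: power2_eq_square)
  finally show ?thesis by simp
qed

lemma Cauchy_Schwarz_cmod_sum:
  "(cmod (\<Sum>i\<in>I. u i * z i))\<^sup>2 \<le> (sqnorm I u) * (sqnorm I z)"
proof -
  have "cmod (\<Sum>i\<in>I. u i * z i) \<le> (\<Sum>i\<in>I. cmod (u i) * cmod (z i))"
    by (rule order_trans[OF norm_sum]) (simp add: norm_mult)
  then have "(cmod (\<Sum>i\<in>I. u i * z i))\<^sup>2 \<le> (\<Sum>i\<in>I. cmod (u i) * cmod (z i))\<^sup>2"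
    by (rule power_mono) simp
  then show ?thesis using Cauchy_Schwarz_real_sum by (rule order_trans)
qed

text \<open>A matrix and its transpose have the same norm: test the given bound with the conjugates
  of the transposed values \<open>v\<close>, apply Cauchy-Schwarz, and cancel one factor
  \<open>N\<close>.\<close>

lemma duality_principle:
  fixes \<Gamma> :: "'b \<Rightarrow> 'c \<Rightarrow> complex"
  assumes c: "0 \<le> c"
    and bound: "\<And>lam. (\<Sum>R\<in>U. (cmod (\<Sum>S\<in>V. lam S * \<Gamma> R S))\<^sup>2) \<le> c * (sqnorm V lam)"
  shows "(\<Sum>S\<in>V. (cmod (\<Sum>R\<in>U. mu R * \<Gamma> R S))\<^sup>2) \<le> c * (sqnorm U mu)"
proof -
  define v where "v S = (\<Sum>R\<in>U. mu R * \<Gamma> R S)" for S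
  define w where "w R = (\<Sum>S\<in>V. cnj (v S) * \<Gamma> R S)" for R
  define N where "N = (sqnorm V v)"
  define L where "L = (sqnorm U mu)"
  have N0: "N \<ge> 0" by (simp add: N_def sum_nonneg)
  have L0: "L \<ge> 0" by (simp add: L_def sum_nonneg)
  have "complex_of_real N = (\<Sum>S\<in>V. cnj (v S) * v S)"
    unfolding N_def of_real_sum complex_norm_square by (simp add: mult.commute)
  also have "\<dots> = (\<Sum>S\<in>V. \<Sum>R\<in>U. mu R * (cnj (v S) * \<Gamma> R S))"
  proof (intro sum.cong refl)
    fix S
    have "cnj (v S) * v S = cnj (v S) * (\<Sum>R\<in>U. mu R * \<Gamma> R S)" by (simp only: v_def)
    then show "cnj (v S) * v S = (\<Sum>R\<in>U. mu R * (cnj (v S) * \<Gamma> R S))" by (simp add: sum_distrib_left mult_ac)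
  qed
  also have "\<dots> = (\<Sum>R\<in>U. mu R * w R)"
    unfolding w_def sum_distrib_left by (rule sum.swap)
  finally have "N = cmod (\<Sum>R\<in>U. mu R * w R)" using N0 by (metis abs_of_nonneg norm_of_real)
  then have "N\<^sup>2 \<le> L * (sqnorm U w)" using Cauchy_Schwarz_cmod_sum by (simp add: L_def)
  also have "\<dots> \<le> L * (c * N)"
  proof (rule mult_left_mono[OF _ L0])
    show "(sqnorm U w) \<le> c * N"
      using bound[of "\<lambda>S. cnj (v S)"] by (simp add: w_def N_def)
  qed
  finally have "N * N \<le> (c * L) * N" by (simp add: power2_eq_square mult_ac)
  then have "N \<le> c * L"
  proof (cases "N = 0")
    case True then show ?thesis using c L0 by simp
  next
    case False
    with N0 have "N > 0" by simp
    then show ?thesis using \<open>N * N \<le> (c * L) * N\<close> by (rule mult_right_le_imp_le[rotated])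
  qed
  then show ?thesis by (simp add: N_def L_def v_def)
qed

lemma (in recip_charsys) sieve_sf_dual:
  assumes c: "0 \<le> c" and sieve: "sieve_sf \<chi> m n c" shows "sieve_sf \<chi> n m c"
  unfolding sieve_sf_def
proof
  fix lam :: "'a poly set \<Rightarrow> complex"
  have mir: "S \<in> psets h \<Longrightarrow> S \<subseteq> mirr" for S h by (simp add: psets_def)
  have "(\<Sum>S\<in>psets n. (cmod (\<Sum>R\<in>psets m. lam R * chi \<chi> S (\<Prod>R)))\<^sup>2) \<le> c * (sqnorm (psets m) lam)"
    by (rule duality_principle[OF c]) (use sieve in \<open>simp add: sieve_sf_def\<close>)
  also have "(\<Sum>S\<in>psets n. (cmod (\<Sum>R\<in>psets m. lam R * chi \<chi> S (\<Prod>R)))\<^sup>2) = (\<Sum>S\<in>psets n. (cmod (\<Sum>R\<in>psets m. lam R * chi \<chi> R (\<Prod>S)))\<^sup>2)"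
    by (intro sum.cong refl arg_cong[where f = "\<lambda>x. (cmod x)\<^sup>2"]) (simp add: chi_recip[OF mir mir])
  finally show "(\<Sum>R\<in>psets n. (cmod (char_form \<chi> (psets m) lam (\<Prod>R)))\<^sup>2) \<le> c * (sqnorm (psets m) lam)" .
qed

section \<open>Trivial bound, orthogonality, and raising the degree\<close>

lemma (in charsys) sieve_trivial: "sieve \<chi> m n (real CARD('a) ^ m * real CARD('a) ^ n)"
  unfolding sieve_def
proof
  fix lam :: "'a poly set \<Rightarrow> complex"
  define L where "L = (sqnorm (psets n) lam)"
  have L0: "L \<ge> 0" by (simp add: L_def sum_nonneg)
  have "(\<Sum>M\<in>monics m. (cmod (char_form \<chi> (psets n) lam M))\<^sup>2) \<le> (\<Sum>M\<in>(monics m :: 'a poly set). L * real CARD('a) ^ n)"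
  proof (rule sum_mono)
    fix M :: "'a poly"
    have "(\<Sum>S\<in>psets n. (cmod (chi \<chi> S M))\<^sup>2) \<le> (\<Sum>S\<in>(psets n :: 'a poly set set). 1)"
      by (rule sum_mono) (auto simp: psets_def intro!: power_le_one chi_le)
    also have "\<dots> \<le> real CARD('a) ^ n" using card_psets[of n, where ?'a = 'a] by (simp flip: of_nat_power)
    finally have "(\<Sum>S\<in>psets n. (cmod (chi \<chi> S M))\<^sup>2) \<le> real CARD('a) ^ n" .
    then have "L * (\<Sum>S\<in>psets n. (cmod (chi \<chi> S M))\<^sup>2) \<le> L * real CARD('a) ^ n" by (rule mult_left_mono[OF _ L0])
    then show "(cmod (char_form \<chi> (psets n) lam M))\<^sup>2 \<le> L * real CARD('a) ^ n"
      using Cauchy_Schwarz_cmod_sum[of lam "\<lambda>S. chi \<chi> S M" "psets n"] unfolding L_def by (rule order_trans[rotated])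
  qed
  also have "\<dots> = real CARD('a) ^ m * real CARD('a) ^ n * L" by (simp add: card_monics mult_ac)
  finally show "(\<Sum>M\<in>monics m. (cmod (char_form \<chi> (psets n) lam M))\<^sup>2)
     \<le> real CARD('a) ^ m * real CARD('a) ^ n * (sqnorm (psets n) lam)" by (simp only: L_def)
qed

text \<open>The modulus degree \<open>2 * k\<close> never exceeds the degree \<open>m - d\<close> of
  the range, so every dual sum is empty and \<open>Y = 0\<close> is admissible. The crude
  \<open>D\<close> costs nothing, being multiplied by 0.\<close>

lemma (in recip_charsys) sieve_orthogonality:
  assumes "2 * n \<le> m" shows "sieve \<chi> m n (real CARD('a) ^ m)"
proof -
  define D where "D = (\<Sum>S\<in>(psets n :: 'a poly set set). 4 ^ card S :: real)"
  have "sieve \<chi> m n (real CARD('a) ^ m + 2 * real n * D * 0)"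
  proof (rule poisson_sieve)
    show "4 ^ card S \<le> D" if "S \<in> psets n" for S :: "'a poly set"
      unfolding D_def by (rule member_le_sum[OF that]) auto
    show "sieve \<chi> i k (real CARD('a) ^ i * real CARD('a) ^ k)" for i k by (rule sieve_trivial)
  qed (use assms in auto)
  then show ?thesis by simp
qed

text \<open>For \<open>p\<close> outside \<open>S\<close> the value at \<open>p ^ r\<close> has
  modulus 1; the coefficients \<open>lam'\<close> cancel it without a change of norm, and
  \<open>M\<close> may be replaced by \<open>p ^ r * M\<close>.\<close>

lemma (in charsys) sieve_shift_prime_to:
  fixes lam :: "'a poly set \<Rightarrow> complex"
  assumes sieve: "sieve \<chi> (m + r) n c" and p: "p \<in> mirr" "degree p = 1"
    and lam: "\<And>S. S \<in> psets n \<Longrightarrow> p \<in> S \<Longrightarrow> lam S = 0"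
  shows "(\<Sum>M\<in>monics m. (cmod (char_form \<chi> (psets n) lam M))\<^sup>2) \<le> c * (sqnorm (psets n) lam)"
proof -
  define lam' where "lam' S = lam S * cnj (chi \<chi> S (p ^ r))" for S
  have pr: "p ^ r \<in> monics r" using monics_power[OF mirr_monics[OF p(1)], of r] p by simp
  have nrm: "cmod (chi \<chi> S p) = 1" if "S \<in> psets n" "p \<notin> S" for S
  proof (rule chi_norm)
    show "S \<subseteq> mirr" using that by (simp add: psets_def)
    show "\<not> s dvd p" if "s \<in> S" for s using mirr_dvd_eq[of s p] that \<open>S \<subseteq> mirr\<close> p \<open>p \<notin> S\<close> by auto
  qed
  have eq: "lam' S * chi \<chi> S (p ^ r * M) = lam S * chi \<chi> S M" if S: "S \<in> psets n" for S M
  proof (cases "p \<in> S")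
    case True then show ?thesis using lam[OF S] by (simp add: lam'_def)
  next
    case False
    have mir: "S \<subseteq> mirr" using S by (simp add: psets_def)
    have "cmod (chi \<chi> S (p ^ r)) = 1" using nrm[OF S False] by (simp add: chi_power[OF mir] norm_power)
    then have "chi \<chi> S (p ^ r) * cnj (chi \<chi> S (p ^ r)) = 1" using complex_norm_square[of "chi \<chi> S (p ^ r)"] by simp
    then show ?thesis by (simp add: lam'_def chi_mult[OF mir] mult_ac)
  qed
  let ?F = "\<lambda>M. (cmod (char_form \<chi> (psets n) lam' M))\<^sup>2"
  have inj: "inj_on ((*) (p ^ r)) (monics m)" using monics_nz[OF pr] by (auto simp: inj_on_def)
  have "(\<Sum>M\<in>monics m. (cmod (char_form \<chi> (psets n) lam M))\<^sup>2) = (\<Sum>M\<in>monics m. ?F (p ^ r * M))"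
    by (simp add: eq cong: sum.cong)
  also have "\<dots> = (\<Sum>M\<in>(*) (p ^ r) ` monics m. ?F M)" unfolding sum.reindex[OF inj] comp_def ..
  also have "\<dots> \<le> (\<Sum>M\<in>monics (m + r). ?F M)"
    by (rule sum_mono2) (use monics_mult[OF pr] in \<open>auto simp: add.commute\<close>)
  also have "\<dots> \<le> c * (sqnorm (psets n) lam')" using sieve unfolding sieve_def by (rule spec)
  also have "(sqnorm (psets n) lam') = (sqnorm (psets n) lam)"
  proof (intro sum.cong refl)
    fix S :: "'a poly set" assume S: "S \<in> psets n"
    then have mir: "S \<subseteq> mirr" by (simp add: psets_def)
    show "(cmod (lam' S))\<^sup>2 = (cmod (lam S))\<^sup>2"
      using lam[OF S] nrm[OF S] by (cases "p \<in> S") (simp_all add: lam'_def norm_mult chi_power[OF mir] norm_power)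
  qed
  finally show ?thesis .
qed

lemma linear_mirr: "[:0, 1:] \<in> (mirr :: 'a::field poly set)"
  using irreducible_linear_field_poly[of 1 "0::'a"] by (simp add: mirr_def)

text \<open>Multiplication by \<open>t ^ r\<close> embeds the monic polynomials of degree \<open>m\<close> into those of degree \<open>m + r\<close>; this
  only disturbs the sets that contain \<open>t\<close>, from which \<open>t\<close> is removed.\<close>

lemma (in charsys) sieve_shift:
  assumes sieve: "sieve \<chi> (m + r) n c" "n > 0 \<Longrightarrow> sieve \<chi> (m + r) (n - 1) c"
  shows "sieve \<chi> m n (2 * c)"
  unfolding sieve_def
proof
  fix lam :: "'a poly set \<Rightarrow> complex"
  define p where "p = ([:0, 1:] :: 'a poly)"
  have p: "p \<in> mirr" "degree p = 1" using linear_mirr by (auto simp: p_def)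
  define P where "P = (psets n :: 'a poly set set)"
  have finP: "finite P" by (simp add: P_def)
  define l0 where "l0 S = (if p \<in> S then 0 else lam S)" for S
  define l1 where "l1 S = (if p \<in> S then lam S else 0)" for S
  define f0 where "f0 M = (char_form \<chi> P l0 M)" for M
  define f1 where "f1 M = (char_form \<chi> P l1 M)" for M
  have b0: "(\<Sum>M\<in>monics m. (cmod (f0 M))\<^sup>2) \<le> c * (sqnorm P l0)"
    unfolding f0_def P_def by (rule sieve_shift_prime_to[OF sieve(1) p]) (simp add: l0_def)
  have b1: "(\<Sum>M\<in>monics m. (cmod (f1 M))\<^sup>2) \<le> c * (sqnorm P l1)"
  proof (cases "n > 0")
    case False
    then have "p \<notin> S" if "S \<in> P" for S
      using that p by (auto simp: P_def psets_def)
    then show ?thesis by (simp add: f1_def l1_def cong: sum.cong)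
  next
    case True
    define l2 where "l2 S = (if p \<in> S then 0 else lam (insert p S))" for S
    \<comment> \<open>Sets containing \<open>p\<close> correspond to sets of degree
      \<open>n - 1\<close> avoiding \<open>p\<close>, hence the second sieve hypothesis; the factor
      \<open>\<chi> p M\<close> split off has modulus at most 1.\<close>
    have re: "(\<Sum>S\<in>P. if p \<in> S then h S else 0) = (\<Sum>S\<in>psets (n - 1). if p \<in> S then 0 else h (insert p S))"
      for h :: "'a poly set \<Rightarrow> 'b::comm_monoid_add"
    proof -
      have "(\<Sum>S\<in>P. if p \<in> S then h S else 0) = (\<Sum>S\<in>{S\<in>P. p \<in> S}. h S)"
        by (rule sum.inter_filter[OF finP, symmetric])
      also have "\<dots> = (\<Sum>S\<in>{S\<in>psets (n - 1). p \<notin> S}. h (insert p S))"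
      proof (rule sum.reindex_bij_witness[where i = "insert p" and j = "\<lambda>S. S - {p}"], goal_cases)
        case (2 S)
        then show ?case using psets_Diff(1)[of S n "{p}"] p by (simp add: P_def)
      next
        case (4 S)
        then have "{p} \<union> S \<in> psets (1 + (n - 1))" using p by (intro psets_Un) (auto simp: psets_def)
        then show ?case using True by (simp add: P_def)
      qed (auto simp: insert_absorb)
      also have "\<dots> = (\<Sum>S\<in>psets (n - 1). if p \<notin> S then h (insert p S) else 0)"
        by (rule sum.inter_filter[OF finite_psets])
      also have "\<dots> = (\<Sum>S\<in>psets (n - 1). if p \<in> S then 0 else h (insert p S))" by (intro sum.cong refl) simp
      finally show ?thesis .
    qed
    have f1: "f1 M = \<chi> p M * (char_form \<chi> (psets (n - 1)) l2 M)" for M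
    proof -
      have "f1 M = (\<Sum>S\<in>P. if p \<in> S then lam S * chi \<chi> S M else 0)"
        unfolding f1_def by (intro sum.cong refl) (simp add: l1_def)
      also have "\<dots> = (\<Sum>S\<in>psets (n - 1). if p \<in> S then 0 else lam (insert p S) * chi \<chi> (insert p S) M)" by (rule re)
      also have "\<dots> = (\<Sum>S\<in>psets (n - 1). \<chi> p M * (l2 S * chi \<chi> S M))"
        by (intro sum.cong refl) (auto simp: l2_def chi_def psets_def mult_ac)
      finally show ?thesis by (simp add: sum_distrib_left)
    qed
    have "(\<Sum>M\<in>monics m. (cmod (f1 M))\<^sup>2) \<le> (\<Sum>M\<in>monics m. (cmod (char_form \<chi> (psets (n - 1)) l2 M))\<^sup>2)"
    proof (intro sum_mono power_mono)
      fix M show "cmod (f1 M) \<le> cmod (char_form \<chi> (psets (n - 1)) l2 M)"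
        unfolding f1 norm_mult using X_le[OF p(1), of M] by (rule mult_left_le_one_le[rotated 2]) auto
    qed simp
    also have "\<dots> \<le> c * (sqnorm (psets (n - 1)) l2)"
      by (rule sieve_shift_prime_to[OF sieve(2)[OF True] p]) (simp add: l2_def)
    also have "(sqnorm (psets (n - 1)) l2) = (\<Sum>S\<in>psets (n - 1). if p \<in> S then 0 else (cmod (lam (insert p S)))\<^sup>2)"
      by (intro sum.cong refl) (simp add: l2_def)
    also have "\<dots> = (\<Sum>S\<in>P. if p \<in> S then (cmod (lam S))\<^sup>2 else 0)" by (rule re[symmetric])
    also have "\<dots> = (sqnorm P l1)" by (intro sum.cong refl) (simp add: l1_def)
    finally show ?thesis .
  qed
  have "(\<Sum>M\<in>monics m. (cmod (char_form \<chi> P lam M))\<^sup>2) \<le> (\<Sum>M\<in>monics m. 2 * (cmod (f0 M))\<^sup>2 + 2 * (cmod (f1 M))\<^sup>2)"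
  proof (rule sum_mono)
    fix M
    have "(char_form \<chi> P lam M) = f0 M + f1 M"
      unfolding f0_def f1_def sum.distrib[symmetric] by (intro sum.cong refl) (simp add: l0_def l1_def)
    then have "cmod (char_form \<chi> P lam M) \<le> cmod (f0 M) + cmod (f1 M)" by (simp add: norm_triangle_ineq)
    then have "(cmod (char_form \<chi> P lam M))\<^sup>2 \<le> (cmod (f0 M) + cmod (f1 M))\<^sup>2" by (rule power_mono) simp
    moreover have "0 \<le> (cmod (f0 M) - cmod (f1 M))\<^sup>2" by simp
    ultimately show "(cmod (char_form \<chi> P lam M))\<^sup>2 \<le> 2 * (cmod (f0 M))\<^sup>2 + 2 * (cmod (f1 M))\<^sup>2"
      unfolding power2_sum power2_diff by linarith
  qed
  also have "\<dots> = 2 * (\<Sum>M\<in>monics m. (cmod (f0 M))\<^sup>2) + 2 * (\<Sum>M\<in>monics m. (cmod (f1 M))\<^sup>2)"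
    by (simp add: sum.distrib sum_distrib_left)
  also have "\<dots> \<le> 2 * (c * (sqnorm P l0)) + 2 * (c * (sqnorm P l1))"
    by (intro add_mono mult_left_mono b0 b1) auto
  also have "\<dots> = 2 * c * (\<Sum>S\<in>P. (cmod (l0 S))\<^sup>2 + (cmod (l1 S))\<^sup>2)" by (simp add: sum.distrib algebra_simps)
  also have "(\<Sum>S\<in>P. (cmod (l0 S))\<^sup>2 + (cmod (l1 S))\<^sup>2) = (sqnorm P lam)"
    by (intro sum.cong refl) (simp add: l0_def l1_def)
  finally show "(\<Sum>M\<in>monics m. (cmod (char_form \<chi> (psets n) lam M))\<^sup>2) \<le> 2 * c * (sqnorm (psets n) lam)"
    by (simp only: P_def)
qed

section \<open>Decomposition of monic polynomials and the divisor bound\<close>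

lemma monic_square_decomp:
  fixes K :: "'a::field poly"
  assumes "K \<in> monics j"
  shows "\<exists>a b R B. R \<in> psets a \<and> B \<in> monics b \<and> K = \<Prod>R * B\<^sup>2 \<and> a + 2 * b = j"
  using assms
proof (induction j arbitrary: K rule: less_induct)
  case (less j)
  show ?case
  proof (cases "squarefree K")
    case True
    then have "K \<in> sqfree_monic j" using less.prems unfolding sqfree_monic_def monics_def by blast
    then obtain R where "R \<in> psets j" "K = \<Prod>R"
      using bij_betw_imp_surj_on[OF bij_betw_psets[of j]] by (metis imageE)
    then show ?thesis by (intro exI[of _ j] exI[of _ 0] exI[of _ R] exI[of _ 1]) (simp add: monics_def)
  next
    case False
    have K0: "K \<noteq> 0" using less.prems by (rule monics_nz)
    from False obtain x where x: "x\<^sup>2 dvd K" "\<not> is_unit x" by (auto simp: squarefree_def)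
    have "x \<noteq> 0" using x K0 by auto
    then have "degree x > 0" using x(2) is_unit_iff_degree by blast
    then obtain p where p: "p \<in> mirr" "p dvd x" using exists_mirr_dvd by blast
    have "p\<^sup>2 dvd K" using p(2) x(1) by (metis dvd_trans dvd_power_same)
    then obtain K' where K': "K = p\<^sup>2 * K'" by (elim dvdE)
    have p2: "p\<^sup>2 \<in> monics (degree p * 2)" by (rule monics_power[OF mirr_monics[OF p(1)]])
    have "lead_coeff (p\<^sup>2 * K') = 1" using less.prems unfolding K' monics_def by blast
    moreover have "lead_coeff (p\<^sup>2) = 1" using p2 unfolding monics_def by blast
    ultimately have l: "lead_coeff K' = 1" by (rule monic_factor)
    then have "K' \<in> monics (degree K')" by (simp add: monics_def)
    from monics_mult[OF p2 this] have d: "degree p * 2 + degree K' = j"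
      using less.prems unfolding K' monics_def by (metis (mono_tags, lifting) mem_Collect_eq)
    have "degree K' < j" using d mirrD(6)[OF p(1)] by linarith
    from less.IH[OF this \<open>K' \<in> monics (degree K')\<close>] obtain a b R B where
      R: "R \<in> psets a" "B \<in> monics b" "K' = \<Prod>R * B\<^sup>2" "a + 2 * b = degree K'" by blast
    have "p * B \<in> monics (degree p + b)" by (rule monics_mult[OF mirr_monics[OF p(1)] R(2)])
    moreover have "K = \<Prod>R * (p * B)\<^sup>2" unfolding K' R(3) by (simp add: power_mult_distrib mult_ac)
    moreover have "a + 2 * (degree p + b) = j" unfolding d[symmetric] R(4)[symmetric] by simp
    ultimately show ?thesis using R(1) by blast
  qed
qed

text \<open>Two square decompositions: \<open>K = \<Prod>R * E\<^sup>2\<close>, then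
  \<open>E = \<Prod>S * B\<^sup>2\<close>.\<close>

lemma monic_fourth_decomp:
  fixes K :: "'a::field poly"
  assumes "K \<in> monics j"
  obtains a b g R S B where "R \<in> psets a" "S \<in> psets b" "B \<in> monics g" "K = \<Prod>R * (\<Prod>S)\<^sup>2 * B ^ 4" "a + 2 * b + 4 * g = j"
proof -
  obtain a e R E where 1: "R \<in> psets a" "E \<in> monics e" "K = \<Prod>R * E\<^sup>2" "a + 2 * e = j"
    using monic_square_decomp[OF assms] by blast
  obtain b g S B where 2: "S \<in> psets b" "B \<in> monics g" "E = \<Prod>S * B\<^sup>2" "b + 2 * g = e"
    using monic_square_decomp[OF 1(2)] by blast
  show ?thesis
  proof (rule that[OF 1(1) 2(1,2)])
    show "K = \<Prod>R * (\<Prod>S)\<^sup>2 * B ^ 4" unfolding 1(3) 2(3) by (simp add: power_mult_distrib mult_ac)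
    show "a + 2 * b + 4 * g = j" using 1(4) 2(4) by linarith
  qed
qed

text \<open>Every monic \<open>K\<close> is \<open>A B\<^sup>2 G\<^sup>4\<close> with square-free \<open>A\<close> and \<open>B\<close>; one may sum over \<open>A\<close> first, or over \<open>B\<close> first
  with the squared characters.\<close>

lemma (in charsys) sieve_decomp:
  assumes Y: "\<And>a b g. a + 2 * b + 4 * g = j \<Longrightarrow>
     (\<exists>c. sieve_sf \<chi> a k c \<and> real CARD('a) ^ (b + g) * c \<le> Y) \<or>
     (\<exists>c. sieve_sf (\<lambda>p x. (\<chi> p x)\<^sup>2) b k c \<and> real CARD('a) ^ (a + g) * c \<le> Y)" and Y0: "0 \<le> Y"
  shows "sieve \<chi> j k ((real j + 1)\<^sup>2 * Y)"
  unfolding sieve_def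
proof
  fix lam :: "'a poly set \<Rightarrow> complex"
  define q where "q = real CARD('a)"
  define P where "P = (psets k :: 'a poly set set)"
  define L where "L = (sqnorm P lam)"
  define F where "F M = (cmod (char_form \<chi> P lam M))\<^sup>2" for M
  define T where "T = {(b, g). 2 * b + 4 * g \<le> j}"
  define \<phi> where "\<phi> = (\<lambda>(R, S, B). \<Prod>R * (\<Prod>S)\<^sup>2 * B ^ 4 :: 'a poly)"
  define I where "I = (\<lambda>(b, g). (psets (j - 2 * b - 4 * g) :: 'a poly set set) \<times> (psets b :: 'a poly set set) \<times> (monics g :: 'a poly set))"
  have q1: "q \<ge> 1" by (simp add: q_def Suc_leI)
  have L0: "L \<ge> 0" by (simp add: L_def sum_nonneg)
  have mir: "S \<subseteq> mirr" if "S \<in> P" for S using that by (simp add: P_def psets_def)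
  have Tsub: "T \<subseteq> {..j} \<times> {..j}" by (auto simp: T_def)
  then have finT: "finite T" by (rule finite_subset) simp
  have finI: "finite (I t)" for t unfolding I_def case_prod_unfold by (intro finite_cartesian_product finite_psets finite_monics)
  \<comment> \<open>As \<open>F\<close> is nonnegative, it suffices that the parametrisation covers
    \<open>monics j\<close>.\<close>
  have cov: "monics j \<subseteq> (\<lambda>x. \<phi> (snd x)) ` Sigma T I"
  proof
    fix K :: "'a poly" assume "K \<in> monics j"
    then obtain a b g R S B where "R \<in> psets a" "S \<in> psets b" "B \<in> monics g" "K = \<Prod>R * (\<Prod>S)\<^sup>2 * B ^ 4" "a + 2 * b + 4 * g = j"
      by (rule monic_fourth_decomp)
    then have "((b, g), (R, S, B)) \<in> Sigma T I" "K = \<phi> (snd ((b, g), (R, S, B)))"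
      by (auto simp: T_def I_def \<phi>_def)
    then show "K \<in> (\<lambda>x. \<phi> (snd x)) ` Sigma T I" by blast
  qed
  have Fnn: "F M \<ge> 0" for M by (simp add: F_def)
  \<comment> \<open>Factors of \<open>M\<close> that are held fixed are absorbed into the
    coefficients, whose norm does not grow.\<close>
  have Lt: "(\<Sum>S\<in>P. (cmod (lam S * chi \<chi> S w))\<^sup>2) \<le> L" for w
    unfolding L_def
  proof (rule sum_mono)
    fix S assume "S \<in> P"
    then have "cmod (chi \<chi> S w) \<le> 1" by (intro chi_le mir)
    then have "cmod (lam S * chi \<chi> S w) \<le> cmod (lam S)" by (simp add: norm_mult mult_left_le)
    then show "(cmod (lam S * chi \<chi> S w))\<^sup>2 \<le> (cmod (lam S))\<^sup>2" by (rule power_mono) simp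
  qed
  have block: "(\<Sum>x\<in>I t. F (\<phi> x)) \<le> Y * L" if t: "t \<in> T" for t
  proof -
    obtain b g where bg: "t = (b, g)" by (cases t)
    define a where "a = j - 2 * b - 4 * g"
    have ab: "a + 2 * b + 4 * g = j" using t bg by (simp add: T_def a_def)
    have cards: "real (card (psets b :: 'a poly set set)) \<le> q ^ b" for b
      using card_psets[of b, where ?'a = 'a] by (simp add: q_def flip: of_nat_power)
    have I: "(\<Sum>x\<in>I t. F (\<phi> x)) = (\<Sum>R\<in>psets a. \<Sum>S\<in>psets b. \<Sum>B\<in>monics g. F (\<Prod>R * (\<Prod>S)\<^sup>2 * B ^ 4))"
      by (simp add: I_def bg a_def \<phi>_def sum.cartesian_product case_prod_unfold)
    from Y[OF ab] show ?thesis
    proof (elim disjE exE conjE)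
      fix c assume c: "sieve_sf \<chi> a k c" "real CARD('a) ^ (b + g) * c \<le> Y"
      \<comment> \<open>\<open>sieve_sf\<close> does not force \<open>c\<close> to be nonnegative,
        hence \<open>max c 0\<close>.\<close>
      have "(\<Sum>R\<in>psets a. F (\<Prod>R * w)) \<le> max c 0 * L" for w
      proof -
        have "(\<Sum>R\<in>psets a. F (\<Prod>R * w)) = (\<Sum>R\<in>psets a. (cmod (\<Sum>S\<in>P. (lam S * chi \<chi> S w) * chi \<chi> S (\<Prod>R)))\<^sup>2)"
          unfolding F_def by (intro sum.cong refl arg_cong[where f = "\<lambda>x. (cmod x)\<^sup>2"]) (simp add: chi_mult[OF mir] mult_ac)
        also have "\<dots> \<le> c * (\<Sum>S\<in>P. (cmod (lam S * chi \<chi> S w))\<^sup>2)"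
          using spec[OF c(1)[unfolded sieve_sf_def], of "\<lambda>S. lam S * chi \<chi> S w"] by (simp only: P_def)
        also have "\<dots> \<le> max c 0 * L" by (rule mult_mono[OF _ Lt]) (auto simp: sum_nonneg)
        finally show ?thesis .
      qed
      note row = this
      have "(\<Sum>x\<in>I t. F (\<phi> x)) = (\<Sum>S\<in>psets b. \<Sum>B\<in>monics g. \<Sum>R\<in>psets a. F (\<Prod>R * ((\<Prod>S)\<^sup>2 * B ^ 4)))"
        unfolding I by (subst sum_rotate) (simp only: mult.assoc)
      also have "\<dots> \<le> (\<Sum>S\<in>(psets b :: 'a poly set set). \<Sum>B\<in>(monics g :: 'a poly set). max c 0 * L)"
        by (intro sum_mono row)
      also have "\<dots> = real (card (psets b :: 'a poly set set)) * (q ^ g * (max c 0 * L))"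
        by (simp add: card_monics q_def)
      also have "\<dots> \<le> q ^ b * (q ^ g * (max c 0 * L))"
        using L0 q1 by (intro mult_right_mono cards) auto
      also have "\<dots> = (q ^ (b + g) * max c 0) * L" by (simp add: power_add mult_ac)
      also have "\<dots> \<le> Y * L"
        using c(2) Y0 L0 by (intro mult_right_mono) (auto simp: q_def max_def)
      finally show ?thesis .
    next
      fix c assume c: "sieve_sf (\<lambda>p x. (\<chi> p x)\<^sup>2) b k c" "real CARD('a) ^ (a + g) * c \<le> Y"
      have row: "(\<Sum>S\<in>psets b. F (\<Prod>R * (\<Prod>S)\<^sup>2 * B ^ 4)) \<le> max c 0 * L" for R B
      proof -
        define w where "w = \<Prod>R * B ^ 4"
        have "(\<Sum>S\<in>psets b. F (\<Prod>R * (\<Prod>S)\<^sup>2 * B ^ 4)) = (\<Sum>U\<in>psets b. (cmod (\<Sum>S\<in>P. (lam S * chi \<chi> S w) * chi (\<lambda>p x. (\<chi> p x)\<^sup>2) S (\<Prod>U)))\<^sup>2)"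
          unfolding F_def
        proof (intro sum.cong refl arg_cong[where f = "\<lambda>x. (cmod x)\<^sup>2"])
          fix U S :: "'a poly set" assume S: "S \<in> P"
          have "chi (\<lambda>p x. (\<chi> p x)\<^sup>2) S (\<Prod>U) = chi \<chi> S ((\<Prod>U)\<^sup>2)"
            by (simp add: chi_power[OF mir[OF S]]) (simp add: chi_def prod_power_distrib)
          then show "lam S * chi \<chi> S (\<Prod>R * (\<Prod>U)\<^sup>2 * B ^ 4) = (lam S * chi \<chi> S w) * chi (\<lambda>p x. (\<chi> p x)\<^sup>2) S (\<Prod>U)"
            by (simp add: w_def chi_mult[OF mir[OF S]] mult_ac)
        qed
        also have "\<dots> \<le> c * (\<Sum>S\<in>P. (cmod (lam S * chi \<chi> S w))\<^sup>2)"
          using spec[OF c(1)[unfolded sieve_sf_def], of "\<lambda>S. lam S * chi \<chi> S w"] by (simp only: P_def)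
        also have "\<dots> \<le> max c 0 * L" by (rule mult_mono[OF _ Lt]) (auto simp: sum_nonneg)
        finally show ?thesis .
      qed
      have "(\<Sum>x\<in>I t. F (\<phi> x)) = (\<Sum>R\<in>psets a. \<Sum>B\<in>monics g. \<Sum>S\<in>psets b. F (\<Prod>R * (\<Prod>S)\<^sup>2 * B ^ 4))"
        unfolding I by (intro sum.cong refl sum.swap)
      also have "\<dots> \<le> (\<Sum>R\<in>(psets a :: 'a poly set set). \<Sum>B\<in>(monics g :: 'a poly set). max c 0 * L)"
        by (intro sum_mono row)
      also have "\<dots> = real (card (psets a :: 'a poly set set)) * (q ^ g * (max c 0 * L))"
        by (simp add: card_monics q_def)
      also have "\<dots> \<le> q ^ a * (q ^ g * (max c 0 * L))"
        using L0 q1 by (intro mult_right_mono cards) auto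
      also have "\<dots> = (q ^ (a + g) * max c 0) * L" by (simp add: power_add mult_ac)
      also have "\<dots> \<le> Y * L"
        using c(2) Y0 L0 by (intro mult_right_mono) (auto simp: q_def max_def)
      finally show ?thesis .
    qed
  qed
  have "(\<Sum>M\<in>monics j. F M) \<le> (\<Sum>M\<in>(\<lambda>x. \<phi> (snd x)) ` Sigma T I. F M)"
    by (rule sum_mono2[OF _ cov Fnn]) (use finT finI in auto)
  also have "\<dots> \<le> (\<Sum>x\<in>Sigma T I. F (\<phi> (snd x)))"
    using sum_image_le[of "Sigma T I" F "\<lambda>x. \<phi> (snd x)"] finT finI Fnn by (auto simp: comp_def)
  also have "\<dots> = (\<Sum>t\<in>T. \<Sum>x\<in>I t. F (\<phi> x))"
    using sum.Sigma[of T I "\<lambda>t x. F (\<phi> x)"] finT finI by (simp add: case_prod_unfold)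
  also have "\<dots> \<le> (\<Sum>t\<in>T. Y * L)" by (rule sum_mono[OF block])
  also have "\<dots> = real (card T) * (Y * L)" by simp
  also have "\<dots> \<le> (real j + 1)\<^sup>2 * (Y * L)"
  proof (rule mult_right_mono)
    have "card T \<le> card ({..j} \<times> {..j})" by (rule card_mono[OF _ Tsub]) simp
    then have "card T \<le> (j + 1)\<^sup>2" by (simp add: card_cartesian_product power2_eq_square)
    then have "real (card T) \<le> real ((j + 1)\<^sup>2)" by (simp only: of_nat_le_iff)
    then show "real (card T) \<le> (real j + 1)\<^sup>2" by (simp add: add.commute)
  qed (use Y0 L0 in simp)
  finally show "(\<Sum>M\<in>monics j. (cmod (char_form \<chi> (psets k) lam M))\<^sup>2) \<le> (real j + 1)\<^sup>2 * Y * (sqnorm (psets k) lam)"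
    by (simp only: F_def P_def L_def mult.assoc)
qed

text \<open>A prime of degree at least \<open>d\<close> pays for its factor 4 by its own degree,
  since \<open>4 \<le> q powr (\<epsilon> * d)\<close>; the primes of smaller degree, at most
  \<open>N\<close> of them, go into the constant \<open>4 ^ N\<close>.\<close>

lemma divisor_bound:
  assumes \<epsilon>: "\<epsilon> > (0::real)"
  shows "\<exists>C\<ge>1. \<forall>n. \<forall>S\<in>(psets n :: 'a::{field,finite} poly set set). 4 ^ card S \<le> C * real CARD('a) powr (\<epsilon> * real n)"
proof -
  define q where "q = real CARD('a)"
  have q1: "q > 1" using card_mono[of UNIV "{0, 1::'a}"] by (simp add: q_def)
  obtain d :: nat where d: "log q 4 / \<epsilon> \<le> real d" using real_arch_simple by blast
  have d4: "4 \<le> q powr (\<epsilon> * real d)"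
  proof -
    have "log q 4 \<le> \<epsilon> * real d" using d \<epsilon> by (simp add: field_simps)
    then show ?thesis using q1 by (simp add: log_le_iff)
  qed
  define N where "N = card (below d :: 'a poly set)"
  have "4 ^ card S \<le> 4 ^ N * q powr (\<epsilon> * real n)" if S: "S \<in> psets n" for n and S :: "'a poly set"
  proof -
    have fS: "finite S" "sum degree S = n" using S by (auto simp: psets_def)
    define S1 where "S1 = {p\<in>S. degree p < d}"
    define S2 where "S2 = {p\<in>S. \<not> degree p < d}"
    have "card S = card S1 + card S2"
      unfolding S1_def S2_def using fS by (subst card_Un_disjoint[symmetric]) (auto intro: arg_cong[where f = card])
    moreover have "card S1 \<le> N" unfolding N_def S1_def by (rule card_mono[OF finite_below]) (auto simp: below_def)
    moreover have "d * card S2 \<le> n"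
    proof -
      have "d * card S2 = (\<Sum>p\<in>S2. d)" by simp
      also have "\<dots> \<le> sum degree S2" by (rule sum_mono) (simp add: S2_def)
      also have "\<dots> \<le> sum degree S" by (rule sum_mono2) (use fS in \<open>auto simp: S2_def\<close>)
      finally show ?thesis using fS by simp
    qed
    ultimately have c: "card S = card S1 + card S2" "card S1 \<le> N" "d * card S2 \<le> n" by auto
    have "(4::real) ^ card S = 4 ^ card S1 * 4 ^ card S2" by (simp add: c(1) power_add)
    also have "\<dots> \<le> 4 ^ N * (q powr (\<epsilon> * real d)) ^ card S2"
      by (intro mult_mono power_increasing c(2) power_mono d4) auto
    also have "(q powr (\<epsilon> * real d)) ^ card S2 = q powr (\<epsilon> * real (d * card S2))"
      by (simp add: powr_realpow[symmetric] powr_powr mult_ac q_def)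
    also have "4 ^ N * q powr (\<epsilon> * real (d * card S2)) \<le> 4 ^ N * q powr (\<epsilon> * real n)"
      using c(3) \<epsilon> q1 by (intro mult_left_mono powr_mono) (auto simp flip: of_nat_mult)
    finally show ?thesis .
  qed
  then show ?thesis by (intro exI[of _ "4 ^ N"]) (auto simp: q_def)
qed

section \<open>Iteration of the exponent\<close>

text \<open>The square is included because the sum over \<open>B\<close> in
  \<open>A B\<^sup>2 G\<^sup>4\<close> has the squared symbol as its character.\<close>

definition sieve_pair :: "'a::{field,finite} symbol \<Rightarrow> bool" where
  "sieve_pair \<chi> \<longleftrightarrow> recip_charsys \<chi> \<and> recip_charsys (\<lambda>p x. (\<chi> p x)\<^sup>2)"

text \<open>The exponent \<open>4 / 3 + \<delta>\<close> of the last term is the quantity that is improved step by step.\<close>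

definition sieve_bound :: "'a::{field,finite} itself \<Rightarrow> real \<Rightarrow> bool" where
  "sieve_bound _ \<delta> \<longleftrightarrow> (\<forall>\<epsilon>>0. \<exists>C\<ge>0. \<forall>\<chi> :: 'a symbol. sieve_pair \<chi> \<longrightarrow> (\<forall>m n.
     sieve_sf \<chi> m n (C * real CARD('a) powr (\<epsilon> * real (m + n)) *
       (real CARD('a) powr real m + real CARD('a) powr real n + real CARD('a) powr (2 * real (m + n) / 3)
        + real CARD('a) powr ((4 / 3 + \<delta>) * real (min m n))))))"

lemma card_field_gt_1: "real CARD('a::{field,finite}) > 1"
  using card_mono[of UNIV "{0, 1::'a}"] by simp

lemma linear_le_powr:
  assumes q: "(q::real) > 1" and \<epsilon>: "\<epsilon> > 0"
  shows "\<exists>C\<ge>1. \<forall>n. real n + 1 \<le> C * q powr (\<epsilon> * real n)"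
proof -
  define s where "s = \<epsilon> * ln q"
  have s: "s > 0" using assms by (simp add: s_def)
  define C where "C = max 1 (1 / s)"
  have C1: "C \<ge> 1" and C2: "C * s \<ge> 1"
    using s mult_right_mono[of "1 / s" C s] by (auto simp: C_def)
  have "real n + 1 \<le> C * q powr (\<epsilon> * real n)" for n
  proof -
    have "real n + 1 \<le> C * s * real n + C * 1"
      using C1 mult_right_mono[OF C2, of "real n"] by simp
    also have "\<dots> = C * (1 + s * real n)" by (simp add: algebra_simps)
    also have "\<dots> \<le> C * exp (s * real n)"
      using C1 by (intro mult_left_mono exp_ge_add_one_self) auto
    also have "exp (s * real n) = q powr (\<epsilon> * real n)" using q by (simp add: powr_def s_def mult_ac)
    finally show ?thesis .
  qed
  then show ?thesis using C1 by blast
qed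

text \<open>Terms with \<open>b \<le> a\<close> use the hypothesis; for \<open>a < b\<close> the sum over \<open>B\<close> is so short that orthogonality of the
  squared characters suffices.\<close>

lemma sieve_below_diagonal:
  assumes H: "sieve_bound TYPE('a::{field,finite}) \<delta>" and \<delta>: "0 \<le> \<delta>" and \<epsilon>: "\<epsilon> > 0"
  shows "\<exists>C\<ge>0. \<forall>\<chi> :: 'a symbol. sieve_pair \<chi> \<longrightarrow> (\<forall>j k. j \<le> k \<longrightarrow>
     sieve \<chi> j k (C * real CARD('a) powr (\<epsilon> * real (j + k)) *
       (real CARD('a) powr (real k + real j / 3) + real CARD('a) powr ((4 / 3 + \<delta>) * real j))))"
proof -
  define q where "q = real CARD('a)"
  have q1: "q > 1" unfolding q_def by (rule card_field_gt_1)
  define \<alpha> where "\<alpha> = 4 / 3 + \<delta>"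
  have e2: "\<epsilon> / 2 > 0" and e4: "\<epsilon> / 4 > 0" using \<epsilon> by auto
  obtain C0 where C0: "C0 \<ge> 0" and LS0: "\<And>\<chi> :: 'a symbol. \<And>m n. sieve_pair \<chi> \<Longrightarrow>
     sieve_sf \<chi> m n (C0 * q powr (\<epsilon> / 2 * real (m + n)) *
       (q powr real m + q powr real n + q powr (2 * real (m + n) / 3) + q powr (\<alpha> * real (min m n))))"
    using H[unfolded sieve_bound_def, rule_format, OF e2] unfolding q_def \<alpha>_def by blast
  obtain C1 where C1: "C1 \<ge> 1" "\<And>n. real n + 1 \<le> C1 * q powr (\<epsilon> / 4 * real n)"
    using linear_le_powr[OF q1 e4] by blast
  have "sieve \<chi> j k (C1\<^sup>2 * (3 * C0 + 1) * q powr (\<epsilon> * real (j + k)) * (q powr (real k + real j / 3) + q powr (\<alpha> * real j)))"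
    if \<chi>: "sieve_pair \<chi>" and jk: "j \<le> k" for \<chi> :: "'a symbol" and j k
  proof -
    interpret recip_charsys \<chi> using \<chi> by (simp add: sieve_pair_def)
    interpret sq: recip_charsys "\<lambda>p x. (\<chi> p x)\<^sup>2" using \<chi> by (simp add: sieve_pair_def)
    define A where "A = q powr (real k + real j / 3)"
    define B where "B = q powr (\<alpha> * real j)"
    define E where "E = q powr (\<epsilon> / 2 * real (j + k))"
    have nn: "A \<ge> 0" "B \<ge> 0" "E \<ge> 1" using q1 \<epsilon> by (auto simp: A_def B_def E_def intro!: ge_one_powr_ge_zero)
    define Y where "Y = (3 * C0 + 1) * E * (A + B)"
    have Y0: "0 \<le> Y" using nn C0 by (simp add: Y_def)
    have "sieve \<chi> j k ((real j + 1)\<^sup>2 * Y)"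
    proof (rule sieve_decomp[OF _ Y0])
      fix a b g assume abg: "a + 2 * b + 4 * g = j"
      then have abg': "real a + 2 * real b + 4 * real g = real j" by linarith
      have jk': "real j \<le> real k" using jk by simp
      show "(\<exists>c. sieve_sf \<chi> a k c \<and> real CARD('a) ^ (b + g) * c \<le> Y) \<or>
         (\<exists>c. sieve_sf (\<lambda>p x. (\<chi> p x)\<^sup>2) b k c \<and> real CARD('a) ^ (a + g) * c \<le> Y)"
      proof (cases "b \<le> a")
        case True
        then have ba: "real b \<le> real a" by simp
        define S where "S = q powr real a + q powr real k + q powr (2 * real (a + k) / 3) + q powr (\<alpha> * real (min a k))"
        have "q ^ (b + g) * S \<le> 3 * A + B"
        proof -
          have bg: "q ^ (b + g) = q powr (real b + real g)" using q1 by (simp add: powr_realpow[symmetric])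
          have "q powr (real b + real g + real a) \<le> A" unfolding A_def
            using q1 abg' jk' by (intro powr_mono) auto
          \<comment> \<open>From \<open>b \<le> a\<close> follows
            \<open>3 * (b + g) \<le> j\<close>: this term is the source of
            \<open>j / 3\<close>.\<close>
          moreover have "q powr (real b + real g + real k) \<le> A" unfolding A_def
            using q1 abg' ba by (intro powr_mono) auto
          moreover have "q powr (real b + real g + 2 * real (a + k) / 3) \<le> A" unfolding A_def
          proof (rule powr_mono)
            show "real b + real g + 2 * real (a + k) / 3 \<le> real k + real j / 3"
              unfolding of_nat_add distrib_left add_divide_distrib
              using abg' jk' of_nat_0_le_iff[of b, where ?'a = real] of_nat_0_le_iff[of g, where ?'a = real] by linarith
          qed (use q1 in simp)
          moreover have "q powr (real b + real g + \<alpha> * real (min a k)) \<le> B"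
            unfolding B_def
          proof (rule powr_mono)
            \<comment> \<open>As \<open>\<alpha> \<ge> 1\<close>, the drop from \<open>j\<close> to
              \<open>a\<close> in the exponent outweighs the trivial factor with exponent
              \<open>b + g\<close>.\<close>
            have "\<alpha> * real (min a k) \<le> \<alpha> * real a" using \<delta> by (intro mult_left_mono) (auto simp: \<alpha>_def)
            moreover define t where "t = 2 * real b + 4 * real g"
            have "\<alpha> * real j = \<alpha> * real a + \<alpha> * t"
              unfolding abg'[symmetric] t_def by (simp add: algebra_simps)
            moreover have "t \<le> \<alpha> * t"
              using \<delta> mult_right_mono[of 1 \<alpha> t] by (simp add: \<alpha>_def t_def)
            moreover have "real b + real g \<le> t" by (simp add: t_def)
            ultimately show "real b + real g + \<alpha> * real (min a k) \<le> \<alpha> * real j" by linarith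
          qed (use q1 in simp)
          ultimately show ?thesis unfolding S_def bg distrib_left powr_add[symmetric] by linarith
        qed
        have "q powr (\<epsilon> / 2 * real (a + k)) \<le> E" unfolding E_def
          using q1 \<epsilon> abg by (intro powr_mono mult_left_mono) auto
        then have "q ^ (b + g) * (C0 * q powr (\<epsilon> / 2 * real (a + k)) * S) \<le> C0 * E * (3 * A + B)"
        proof -
          have "C0 * q powr (\<epsilon> / 2 * real (a + k)) * (q ^ (b + g) * S) \<le> C0 * E * (3 * A + B)"
            using \<open>q ^ (b + g) * S \<le> 3 * A + B\<close> \<open>q powr (\<epsilon> / 2 * real (a + k)) \<le> E\<close> C0 nn q1
            by (intro mult_mono mult_nonneg_nonneg) (auto simp: S_def)
          then show ?thesis by (simp add: mult_ac)
        qed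
        also have "\<dots> \<le> Y"
        proof -
          have "C0 * (3 * A + B) \<le> (3 * C0 + 1) * (A + B)"
            using C0 nn by (simp add: algebra_simps)
          then have "E * (C0 * (3 * A + B)) \<le> E * ((3 * C0 + 1) * (A + B))" using nn by (intro mult_left_mono) auto
          then show ?thesis by (simp add: Y_def mult_ac)
        qed
        finally show ?thesis using LS0[OF \<chi>, of a k] unfolding S_def q_def by blast
      next
        case False
        then have ab: "real a \<le> real b" by simp
        \<comment> \<open>Orthogonality gives norm \<open>q ^ k\<close> here, and
          \<open>a < b\<close> implies \<open>3 * (a + g) \<le> j\<close>, so the same
          \<open>A\<close> bounds this case.\<close>
        have "2 * b \<le> k" using abg jk by linarith
        from sieve_imp_sieve_sf[OF sq.sieve_orthogonality[OF this]]
        have "sieve_sf (\<lambda>p x. (\<chi> p x)\<^sup>2) b k (q ^ k)"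
          unfolding q_def by (rule sq.sieve_sf_dual[rotated]) simp
        moreover have "q ^ (a + g) * q ^ k \<le> Y"
        proof -
          have "q ^ (a + g) * q ^ k = q powr (real a + real g + real k)"
            using q1 by (simp add: powr_realpow[symmetric] power_add powr_add)
          also have "\<dots> \<le> A" unfolding A_def using q1 abg' ab by (intro powr_mono) auto
          also have "\<dots> = 1 * 1 * A" by simp
          also have "\<dots> \<le> (3 * C0 + 1) * E * (A + B)" using nn C0 by (intro mult_mono) auto
          finally show ?thesis by (simp add: Y_def)
        qed
        ultimately show ?thesis unfolding q_def by blast
      qed
    qed
    then show ?thesis
    proof (rule sieve_mono)
      have "(real j + 1)\<^sup>2 \<le> (C1 * q powr (\<epsilon> / 4 * real j))\<^sup>2" by (rule power_mono[OF C1(2)]) simp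
      also have "\<dots> = C1\<^sup>2 * q powr (\<epsilon> / 2 * real j)"
        by (simp add: power_mult_distrib power2_eq_square powr_add[symmetric])
      also have "\<dots> \<le> C1\<^sup>2 * E" unfolding E_def
        using q1 \<epsilon> by (intro mult_left_mono powr_mono) auto
      finally have "(real j + 1)\<^sup>2 * Y \<le> (C1\<^sup>2 * E) * Y" by (rule mult_right_mono[OF _ Y0])
      also have "\<dots> = C1\<^sup>2 * (3 * C0 + 1) * (E * E) * (A + B)" by (simp add: Y_def mult_ac)
      also have "E * E = q powr (\<epsilon> * real (j + k))" by (simp add: E_def powr_add[symmetric] algebra_simps)
      finally show "(real j + 1)\<^sup>2 * Y \<le> C1\<^sup>2 * (3 * C0 + 1) * q powr (\<epsilon> * real (j + k)) *
          (q powr (real k + real j / 3) + q powr (\<alpha> * real j))" by (simp only: A_def B_def)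
    qed
  qed
  moreover have "C1\<^sup>2 * (3 * C0 + 1) \<ge> 0" using C0 by simp
  ultimately show ?thesis unfolding q_def \<alpha>_def by blast
qed

text \<open>The bound below the diagonal is inserted into \<open>poisson_sieve\<close>. At the
  extreme \<open>k = n\<close>, \<open>d = 0\<close>, \<open>i = 2 * n - m\<close> the prefactor has
  exponent \<open>1 + m - n\<close>; adding \<open>k + i / 3\<close> or
  \<open>(4 / 3 + \<delta>) * i\<close> gives the last two exponents, the surplus 1 being a factor
  \<open>q\<close>.\<close>

lemma sieve_above_diagonal:
  assumes H: "sieve_bound TYPE('a::{field,finite}) \<delta>" and \<delta>: "0 \<le> \<delta>" and \<epsilon>: "\<epsilon> > 0"
  shows "\<exists>C\<ge>0. \<forall>\<chi> :: 'a symbol. sieve_pair \<chi> \<longrightarrow> (\<forall>m n. n \<le> m \<longrightarrow>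
     sieve \<chi> m n (C * real CARD('a) powr (\<epsilon> * real (m + n)) *
       (real CARD('a) powr real m + real CARD('a) powr (2 * real (m + n) / 3)
         + real CARD('a) powr ((5 / 3 + 2 * \<delta>) * real n - (1 / 3 + \<delta>) * real m))))"
proof -
  define q where "q = real CARD('a)"
  have q1: "q > 1" unfolding q_def by (rule card_field_gt_1)
  define \<alpha> where "\<alpha> = 4 / 3 + \<delta>"
  have e3: "\<epsilon> / 3 > 0" using \<epsilon> by auto
  obtain C0 where C0: "C0 \<ge> 0" and LS0: "\<And>\<chi> :: 'a symbol. \<And>j k. sieve_pair \<chi> \<Longrightarrow> j \<le> k \<Longrightarrow>
     sieve \<chi> j k (C0 * q powr (\<epsilon> / 3 * real (j + k)) * (q powr (real k + real j / 3) + q powr (\<alpha> * real j)))"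
    using sieve_below_diagonal[OF H \<delta> e3] unfolding q_def \<alpha>_def by blast
  obtain C1 where C1: "C1 \<ge> 1" "\<And>n. real n + 1 \<le> C1 * q powr (\<epsilon> / 3 * real n)"
    using linear_le_powr[OF q1 e3] by blast
  obtain C2 where C2: "C2 \<ge> 1" "\<And>n S. S \<in> (psets n :: 'a poly set set) \<Longrightarrow> 4 ^ card S \<le> C2 * q powr (\<epsilon> / 3 * real n)"
    using divisor_bound[OF e3, where ?'a = 'a] unfolding q_def by blast
  define C where "C = 1 + 2 * C1 * C2 * q * C0"
  have Cnn: "2 * C1 * C2 * q * C0 \<ge> 0" using C0 C1 C2 q1 by simp
  have "sieve \<chi> m n (C * q powr (\<epsilon> * real (m + n)) * (q powr real m + q powr (2 * real (m + n) / 3)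
         + q powr ((2 * \<alpha> - 1) * real n - (\<alpha> - 1) * real m)))"
    if \<chi>: "sieve_pair \<chi>" and nm: "n \<le> m" for \<chi> :: "'a symbol" and m n
  proof -
    interpret recip_charsys \<chi> using \<chi> by (simp add: sieve_pair_def)
    define A where "A = q powr (2 * real (m + n) / 3)"
    define B where "B = q powr ((2 * \<alpha> - 1) * real n - (\<alpha> - 1) * real m)"
    define E where "E = q powr (\<epsilon> / 3 * real (m + n))"
    have nn: "A \<ge> 0" "B \<ge> 0" "E \<ge> 1" using q1 \<epsilon> by (auto simp: A_def B_def E_def intro!: ge_one_powr_ge_zero)
    define D where "D = C2 * q powr (\<epsilon> / 3 * real n)"
    define Y where "Y = q * C0 * E * (A + B)"
    \<comment> \<open>\<open>poisson_sieve\<close> asks for a bound at every pair; the trivial one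
      is the default for \<open>i > k\<close>, and \<open>ik\<close> below shows that the dual
      degrees stay in \<open>i \<le> k\<close>.\<close>
    define \<beta> where "\<beta> i k = (if i \<le> k then C0 * q powr (\<epsilon> / 3 * real (i + k)) * (q powr (real k + real i / 3) + q powr (\<alpha> * real i)) else q ^ i * q ^ k)" for i k :: nat
    have Y0: "0 \<le> Y" using nn C0 q1 by (simp add: Y_def)
    have D0: "0 \<le> D" using C2 by (simp add: D_def)
    have "sieve \<chi> m n (real CARD('a) ^ m + 2 * real n * D * Y)"
    proof (rule poisson_sieve[OF _ _ _ _ Y0])
      show "4 ^ card S \<le> D" if "S \<in> psets n" for S :: "'a poly set" using C2(2)[OF that] by (simp add: D_def)
      show "sieve \<chi> i k (\<beta> i k)" for i k
        using LS0[OF \<chi>, of i k] sieve_trivial[of i k] by (simp add: \<beta>_def q_def)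
      show "0 \<le> \<beta> i k" for i k using C0 q1 by (simp add: \<beta>_def)
      fix k d i assume k: "0 < k" and kd: "k + d \<le> n" and d: "d \<le> m" and i: "i + (m - d) < 2 * k"
      have ik: "i \<le> k" using kd i nm by linarith
      have kd': "real k \<le> real n - real d" and i': "real i \<le> 2 * real k + real d - real m" using kd i d by linarith+
      have N: "real (2 * k - (m - d)) = 2 * real k + real d - real m" using i d by linarith
      \<comment> \<open>The exponent of \<open>q\<close> in the bound for the dual weight times the
        Gauss sum factor \<open>q ^ k\<close>.\<close>
      define z where "z = 1 - (2 * real k + real d - real m) + real k"
      have pre: "q / q ^ (2 * k - (m - d)) * q ^ k = q powr z"
      proof -
        have "q powr z = q powr 1 / q powr real (2 * k - (m - d)) * q powr real k"
          by (simp only: z_def N powr_add powr_diff)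
        moreover have "q powr real (2 * k - (m - d)) = q ^ (2 * k - (m - d))" "q powr real k = q ^ k"
          using q1 by (simp_all only: powr_realpow)
        ultimately show ?thesis using q1 by simp
      qed
      have "q powr z * q powr (real k + real i / 3) \<le> q * A"
      proof -
        have "q powr z * q powr (real k + real i / 3) = q powr (z + (real k + real i / 3))" by (simp add: powr_add)
        also have "\<dots> \<le> q powr (1 + 2 * real (m + n) / 3)"
        proof (rule powr_mono)
          have "0 \<le> real d" by simp
          then show "z + (real k + real i / 3) \<le> 1 + 2 * real (m + n) / 3"
            unfolding of_nat_add z_def distrib_left add_divide_distrib using kd' i' by linarith
        qed (use q1 in simp)
        finally show ?thesis using q1 by (simp add: A_def powr_add)
      qed
      moreover have "q powr z * q powr (\<alpha> * real i) \<le> q * B"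
      proof -
        have "q powr z * q powr (\<alpha> * real i) = q powr (z + \<alpha> * real i)" by (simp add: powr_add)
        also have "\<dots> \<le> q powr (1 + ((2 * \<alpha> - 1) * real n - (\<alpha> - 1) * real m))"
        proof (rule powr_mono)
          have 1: "\<alpha> * real i \<le> \<alpha> * (2 * real k + real d - real m)" using i' \<delta> by (intro mult_left_mono) (auto simp: \<alpha>_def)
          have 2: "(2 * \<alpha> - 1) * real k \<le> (2 * \<alpha> - 1) * (real n - real d)" using kd' \<delta> by (intro mult_left_mono) (auto simp: \<alpha>_def)
          have 3: "0 \<le> \<alpha> * real d" using \<delta> by (simp add: \<alpha>_def)
          show "z + \<alpha> * real i \<le> 1 + ((2 * \<alpha> - 1) * real n - (\<alpha> - 1) * real m)"
            using 1 2 3 unfolding z_def by (simp add: algebra_simps)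
        qed (use q1 in simp)
        finally show ?thesis using q1 by (simp add: B_def powr_add)
      qed
      ultimately have h1: "q powr z * (q powr (real k + real i / 3) + q powr (\<alpha> * real i)) \<le> q * (A + B)"
        by (simp add: distrib_left)
      have "q powr (\<epsilon> / 3 * real (i + k)) \<le> E" unfolding E_def
        using q1 \<epsilon> ik kd nm by (intro powr_mono mult_left_mono) auto
      then have h2: "C0 * q powr (\<epsilon> / 3 * real (i + k)) \<le> C0 * E" by (rule mult_left_mono[OF _ C0])
      have "(C0 * q powr (\<epsilon> / 3 * real (i + k))) * (q powr z * (q powr (real k + real i / 3) + q powr (\<alpha> * real i))) \<le> (C0 * E) * (q * (A + B))"
        by (rule mult_mono[OF h2 h1]) (use C0 nn in auto)
      then show "real CARD('a) / real CARD('a) ^ (2 * k - (m - d)) * real CARD('a) ^ k * \<beta> i k \<le> Y"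
        using ik pre by (simp add: \<beta>_def Y_def q_def[symmetric] mult_ac)
    qed
    then show ?thesis
    proof (rule sieve_mono)
      have "\<epsilon> * real (m + n) = \<epsilon> / 3 * real (m + n) + \<epsilon> / 3 * real (m + n) + \<epsilon> / 3 * real (m + n)" by simp
      then have E3: "q powr (\<epsilon> * real (m + n)) = E * E * E" by (simp only: E_def powr_add)
      have En: "q powr (\<epsilon> / 3 * real n) \<le> E" unfolding E_def using q1 \<epsilon> by (intro powr_mono) auto
      have n1: "real n \<le> C1 * E"
      proof -
        have "real n \<le> C1 * q powr (\<epsilon> / 3 * real n)" using C1(2)[of n] by linarith
        also have "\<dots> \<le> C1 * E" using En C1 by (intro mult_left_mono) auto
        finally show ?thesis .
      qed
      have DE: "D \<le> C2 * E" unfolding D_def using En C2 by (intro mult_left_mono) auto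
      have "2 * real n * D * Y \<le> 2 * (C1 * E) * (C2 * E) * Y"
        using n1 DE D0 Y0 nn C1 by (intro mult_right_mono mult_mono) auto
      also have "\<dots> = (2 * C1 * C2 * q * C0) * (E * E * E) * (A + B)" by (simp add: Y_def mult_ac)
      also have "\<dots> \<le> (2 * C1 * C2 * q * C0) * (E * E * E) * (q powr real m + A + B)"
        using Cnn nn by (intro mult_left_mono) auto
      finally have 1: "2 * real n * D * Y \<le> (2 * C1 * C2 * q * C0) * (E * E * E) * (q powr real m + A + B)" .
      have "1 * 1 * 1 \<le> E * E * E" using nn by (intro mult_mono) auto
      then have EEE: "1 \<le> E * E * E" by simp
      have "q powr real m \<le> 1 * (q powr real m + A + B)" using nn by simp
      also have "\<dots> \<le> (E * E * E) * (q powr real m + A + B)" using EEE nn by (intro mult_right_mono) auto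
      finally have 2: "q ^ m \<le> (E * E * E) * (q powr real m + A + B)" using q1 by (simp add: powr_realpow)
      show "real CARD('a) ^ m + 2 * real n * D * Y \<le> C * q powr (\<epsilon> * real (m + n)) * (q powr real m + q powr (2 * real (m + n) / 3)
         + q powr ((2 * \<alpha> - 1) * real n - (\<alpha> - 1) * real m))"
        using 1 2 unfolding E3 A_def[symmetric] B_def[symmetric] q_def[symmetric] C_def by (simp add: distrib_right)
    qed
  qed
  moreover have "C \<ge> 0" using Cnn by (simp add: C_def)
  moreover have "2 * \<alpha> - 1 = 5 / 3 + 2 * \<delta>" "\<alpha> - 1 = 1 / 3 + \<delta>" by (simp_all add: \<alpha>_def)
  ultimately show ?thesis unfolding q_def by (auto intro!: exI[of _ C])
qed

text \<open>The target is symmetric in \<open>m\<close> and \<open>n\<close>, so the half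
  \<open>n \<le> m\<close> gives the other one through \<open>sieve_sf_dual\<close>.\<close>

lemma sieve_bound_by_symmetry:
  fixes \<delta> :: real
  assumes key: "\<And>\<epsilon>. \<epsilon> > 0 \<Longrightarrow> \<exists>C\<ge>0. \<forall>\<chi> :: 'a::{field,finite} symbol. sieve_pair \<chi> \<longrightarrow> (\<forall>m n. n \<le> m \<longrightarrow>
     sieve \<chi> m n (C * real CARD('a) powr (\<epsilon> * real (m + n)) *
       (real CARD('a) powr real m + real CARD('a) powr (2 * real (m + n) / 3)
        + real CARD('a) powr ((4 / 3 + \<delta>) * real n))))"
  shows "sieve_bound TYPE('a) \<delta>"
  unfolding sieve_bound_def
proof (intro allI impI)
  fix \<epsilon> :: real assume \<epsilon>: "\<epsilon> > 0"
  define q where "q = real CARD('a)"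
  obtain C where C: "C \<ge> 0" and sieve: "\<And>\<chi> :: 'a symbol. \<And>m n. sieve_pair \<chi> \<Longrightarrow> n \<le> m \<Longrightarrow>
     sieve \<chi> m n (C * q powr (\<epsilon> * real (m + n)) *
       (q powr real m + q powr (2 * real (m + n) / 3) + q powr ((4 / 3 + \<delta>) * real n)))"
    using key[OF \<epsilon>] unfolding q_def by blast
  define T where "T m n = C * q powr (\<epsilon> * real (m + n)) *
       (q powr real m + q powr real n + q powr (2 * real (m + n) / 3) + q powr ((4 / 3 + \<delta>) * real (min m n)))" for m n
  have T0: "T m n \<ge> 0" for m n using C by (simp add: T_def)
  have Tsym: "T m n = T n m" for m n by (simp add: T_def add_ac min.commute)
  have ge: "sieve_sf \<chi> m n (T m n)" if \<chi>: "sieve_pair \<chi>" and nm: "n \<le> m" for \<chi> :: "'a symbol" and m n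
  proof (rule sieve_sf_mono[OF sieve_imp_sieve_sf[OF sieve[OF \<chi> nm]]])
    show "C * q powr (\<epsilon> * real (m + n)) *
       (q powr real m + q powr (2 * real (m + n) / 3) + q powr ((4 / 3 + \<delta>) * real n)) \<le> T m n"
      unfolding T_def using C nm by (intro mult_left_mono) (auto simp: min_def)
  qed
  have "sieve_sf \<chi> m n (T m n)" if \<chi>: "sieve_pair \<chi>" for \<chi> :: "'a symbol" and m n
  proof (cases "n \<le> m")
    case True
    then show ?thesis by (rule ge[OF \<chi>])
  next
    case False
    then have "sieve_sf \<chi> n m (T m n)" using ge[OF \<chi>, of m n] Tsym[of m n] by simp
    moreover have "recip_charsys \<chi>" using \<chi> by (simp add: sieve_pair_def)
    ultimately show ?thesis using recip_charsys.sieve_sf_dual T0 by blast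
  qed
  then show "\<exists>C\<ge>0. \<forall>\<chi> :: 'a symbol. sieve_pair \<chi> \<longrightarrow> (\<forall>m n.
     sieve_sf \<chi> m n (C * real CARD('a) powr (\<epsilon> * real (m + n)) *
       (real CARD('a) powr real m + real CARD('a) powr real n + real CARD('a) powr (2 * real (m + n) / 3)
        + real CARD('a) powr ((4 / 3 + \<delta>) * real (min m n)))))"
    using C unfolding T_def q_def by blast
qed

text \<open>As \<open>4 / 3 + 2 / 3 = 2\<close>, the extra term is \<open>q ^ (2 * n)\<close>:
  \<open>sieve_shift\<close> raises \<open>m\<close> to \<open>max m (2 * n)\<close>, where
  orthogonality applies.\<close>

lemma sieve_bound_initial: "sieve_bound TYPE('a::{field,finite}) (2 / 3)"
proof (rule sieve_bound_by_symmetry)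
  fix \<epsilon> :: real assume \<epsilon>: "\<epsilon> > 0"
  define q where "q = real CARD('a)"
  have q1: "q > 1" unfolding q_def by (rule card_field_gt_1)
  have "sieve \<chi> m n (2 * q powr (\<epsilon> * real (m + n)) * (q powr real m + q powr (2 * real (m + n) / 3) + q powr ((4 / 3 + 2 / 3) * real n)))"
    if \<chi>: "sieve_pair \<chi>" for \<chi> :: "'a symbol" and m n
  proof -
    interpret recip_charsys \<chi> using \<chi> by (simp add: sieve_pair_def)
    define r where "r = max m (2 * n) - m"
    have mr: "m + r = max m (2 * n)" by (simp add: r_def)
    have "sieve \<chi> m n (2 * real CARD('a) ^ (m + r))"
      by (rule sieve_shift; rule sieve_orthogonality) (simp_all add: mr)
    then show ?thesis
    proof (rule sieve_mono)
      have "real CARD('a) ^ (m + r) = q powr real (max m (2 * n))"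
        using q1 by (simp add: mr powr_realpow q_def)
      also have "\<dots> \<le> q powr real m + q powr (2 * real (m + n) / 3) + q powr ((4 / 3 + 2 / 3) * real n)"
        by (cases "m \<le> 2 * n") (auto simp: max_def)
      also have "\<dots> \<le> q powr (\<epsilon> * real (m + n)) * (q powr real m + q powr (2 * real (m + n) / 3) + q powr ((4 / 3 + 2 / 3) * real n))"
        using mult_right_mono[OF ge_one_powr_ge_zero[of q "\<epsilon> * real (m + n)"], of "q powr real m + q powr (2 * real (m + n) / 3) + q powr ((4 / 3 + 2 / 3) * real n)"] q1 \<epsilon> by simp
      finally show "2 * real CARD('a) ^ (m + r) \<le> 2 * q powr (\<epsilon> * real (m + n)) *
          (q powr real m + q powr (2 * real (m + n) / 3) + q powr ((4 / 3 + 2 / 3) * real n))" by simp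
    qed
  qed
  then show "\<exists>C\<ge>0. \<forall>\<chi> :: 'a symbol. sieve_pair \<chi> \<longrightarrow> (\<forall>m n. n \<le> m \<longrightarrow>
     sieve \<chi> m n (C * real CARD('a) powr (\<epsilon> * real (m + n)) *
       (real CARD('a) powr real m + real CARD('a) powr (2 * real (m + n) / 3)
        + real CARD('a) powr ((4 / 3 + 2 / 3) * real n))))"
    unfolding q_def by (intro exI[of _ 2]) auto
qed

text \<open>The larger degree \<open>m\<close> is first raised to about \<open>(1 + \<delta>) n\<close>, which balances the last two terms of
  \<open>sieve_above_diagonal\<close>.\<close>

lemma sieve_bound_step:
  assumes H: "sieve_bound TYPE('a::{field,finite}) \<delta>" and \<delta>: "0 \<le> \<delta>" "\<delta> \<le> 2 / 3"
  shows "sieve_bound TYPE('a) (2 / 3 * \<delta>)"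
proof (rule sieve_bound_by_symmetry)
  fix \<epsilon> :: real assume \<epsilon>: "\<epsilon> > 0"
  define q where "q = real CARD('a)"
  have q1: "q > 1" unfolding q_def by (rule card_field_gt_1)
  define \<alpha> where "\<alpha> = 4 / 3 + 2 / 3 * \<delta>"
  have e2: "\<epsilon> / 2 > 0" using \<epsilon> by simp
  obtain C where C: "C \<ge> 0" and LS0: "\<And>\<chi> :: 'a symbol. \<And>m n. sieve_pair \<chi> \<Longrightarrow> n \<le> m \<Longrightarrow>
     sieve \<chi> m n (C * q powr (\<epsilon> / 2 * real (m + n)) *
       (q powr real m + q powr (2 * real (m + n) / 3) + q powr ((5 / 3 + 2 * \<delta>) * real n - (1 / 3 + \<delta>) * real m)))"
    using sieve_above_diagonal[OF H \<delta>(1) e2] unfolding q_def by blast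
  have "sieve \<chi> m n (6 * q * C * q powr (\<epsilon> * real (m + n)) * (q powr real m + q powr (2 * real (m + n) / 3) + q powr (\<alpha> * real n)))"
    if \<chi>: "sieve_pair \<chi>" and nm: "n \<le> m" for \<chi> :: "'a symbol" and m n
  proof -
    interpret recip_charsys \<chi> using \<chi> by (simp add: sieve_pair_def)
    define M where "M = max m (nat \<lceil>(1 + \<delta>) * real n\<rceil>)"
    have Mm: "m \<le> M" by (simp add: M_def)
    have Mge: "(1 + \<delta>) * real n \<le> real M" unfolding M_def by linarith
    \<comment> \<open>Raising the degree at most doubles it, which the passage from
      \<open>\<epsilon> / 2\<close> to \<epsilon> absorbs.\<close>
    have M2: "M \<le> 2 * m"
    proof -
      have "(1 + \<delta>) * real n \<le> 2 * real n" using \<delta> by (intro mult_right_mono) auto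
      then have "\<lceil>(1 + \<delta>) * real n\<rceil> \<le> 2 * int n" by (simp add: ceiling_le_iff)
      then have "nat \<lceil>(1 + \<delta>) * real n\<rceil> \<le> 2 * n" by linarith
      then show ?thesis unfolding M_def using nm by (intro max.boundedI) linarith+
    qed
    have Mle: "M = m \<or> real M \<le> (1 + \<delta>) * real n + 1"
    proof (cases "M = m")
      case False
      then have "M = nat \<lceil>(1 + \<delta>) * real n\<rceil>" by (simp add: M_def max_def split: if_splits)
      moreover have "0 \<le> (1 + \<delta>) * real n" using \<delta> by simp
      ultimately have "real M < (1 + \<delta>) * real n + 1" by linarith
      then show ?thesis by simp
    qed simp
    define W where "W = q powr real m + q powr (2 * real (m + n) / 3) + q powr (\<alpha> * real n)"
    define c where "c = 3 * q * C * q powr (\<epsilon> * real (m + n)) * W"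
    \<comment> \<open>Stated for every \<open>k \<le> n\<close> because \<open>sieve_shift\<close>
      needs it at \<open>n\<close> and at \<open>n - 1\<close>.\<close>
    have bound: "C * q powr (\<epsilon> / 2 * real (M + k)) *
       (q powr real M + q powr (2 * real (M + k) / 3) + q powr ((5 / 3 + 2 * \<delta>) * real k - (1 / 3 + \<delta>) * real M)) \<le> c"
      if k: "k \<le> n" for k
    proof -
      have kn: "real k \<le> real n" using k by simp
      \<comment> \<open>The ceiling in \<open>M\<close> can cost one degree, that is, a factor
        \<open>q\<close>.\<close>
      have up: "q powr x \<le> q * q powr y" if "x \<le> 1 + y" for x y
      proof -
        have "q powr x \<le> q powr (1 + y)" using q1 that by (intro powr_mono) auto
        then show ?thesis using q1 by (simp add: powr_add)
      qed
      have nn: "q powr real m \<ge> 0" "q powr (2 * real (m + n) / 3) \<ge> 0" "q powr (\<alpha> * real n) \<ge> 0" by auto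
      have WW: "q * q powr real m \<le> q * W" "q * q powr (2 * real (m + n) / 3) \<le> q * W" "q * q powr (\<alpha> * real n) \<le> q * W"
        using q1 nn by (auto simp: W_def)
      have "\<delta> * real n \<le> 1 * real n" using \<delta> by (intro mult_right_mono) auto
      then have \<delta>n: "\<delta> * real n \<le> real n" "0 \<le> \<delta> * real n" "0 \<le> \<delta> * (\<delta> * real n)" using \<delta> by simp_all
      have \<alpha>n: "\<alpha> * real n = 4 / 3 * real n + 2 / 3 * (\<delta> * real n)" by (simp add: \<alpha>_def algebra_simps)
      have Mn: "(1 + \<delta>) * real n = real n + \<delta> * real n" by (simp add: algebra_simps)
      have 1: "q powr real M \<le> q * W"
      proof (cases "M = m")
        case True
        have "q powr real M \<le> q * q powr real m" by (rule up) (simp add: True)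
        then show ?thesis using WW(1) by linarith
      next
        case False
        have "real M \<le> 1 + \<alpha> * real n" using False Mle \<delta>n unfolding \<alpha>n Mn by auto
        from up[OF this] show ?thesis using WW(3) by linarith
      qed
      have 2: "q powr (2 * real (M + k) / 3) \<le> q * W"
      proof (cases "M = m")
        case True
        have "q powr (2 * real (M + k) / 3) \<le> q * q powr (2 * real (m + n) / 3)"
          by (rule up) (use kn True in \<open>simp add: add_divide_distrib distrib_left\<close>)
        then show ?thesis using WW(2) by linarith
      next
        case False
        have "2 * real (M + k) / 3 \<le> 1 + \<alpha> * real n" using False Mle \<delta>n kn unfolding \<alpha>n Mn
          by (auto simp: add_divide_distrib distrib_left)
        from up[OF this] show ?thesis using WW(3) by linarith
      qed
      have 3: "q powr ((5 / 3 + 2 * \<delta>) * real k - (1 / 3 + \<delta>) * real M) \<le> q * W"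
      proof -
        have a: "(5 / 3 + 2 * \<delta>) * real k \<le> (5 / 3 + 2 * \<delta>) * real n" using kn \<delta> by (intro mult_left_mono) auto
        have b: "(1 / 3 + \<delta>) * ((1 + \<delta>) * real n) \<le> (1 / 3 + \<delta>) * real M" using Mge \<delta> by (intro mult_left_mono) auto
        \<comment> \<open>At \<open>M = (1 + \<delta>) * n\<close> this exponent falls short of
          \<open>\<alpha> * n\<close> by \<open>\<delta>\<^sup>2 * n\<close>, whereas
          \<open>2 * (M + n) / 3\<close> equals \<open>\<alpha> * n\<close> and so determines the
          factor \<open>2 / 3\<close> in front of \<delta>.\<close>
        have e: "(5 / 3 + 2 * \<delta>) * real n - (1 / 3 + \<delta>) * ((1 + \<delta>) * real n) = \<alpha> * real n - \<delta> * (\<delta> * real n)"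
          by (simp add: \<alpha>_def algebra_simps)
        have "(5 / 3 + 2 * \<delta>) * real k - (1 / 3 + \<delta>) * real M \<le> 1 + \<alpha> * real n"
          using a b e \<delta>n(3) by linarith
        from up[OF this] show ?thesis using WW(3) by linarith
      qed
      have "q powr (\<epsilon> / 2 * real (M + k)) \<le> q powr (\<epsilon> * real (m + n))"
      proof (rule powr_mono)
        have "real M \<le> 2 * real m" "real k \<le> real n" using M2 k by linarith+
        then have "real (M + k) \<le> 2 * real (m + n)" unfolding of_nat_add distrib_left by linarith
        then have "\<epsilon> / 2 * real (M + k) \<le> \<epsilon> / 2 * (2 * real (m + n))" using \<epsilon> by (intro mult_left_mono) auto
        moreover have "\<epsilon> / 2 * (2 * x) = \<epsilon> * x" for x by simp
        ultimately show "\<epsilon> / 2 * real (M + k) \<le> \<epsilon> * real (m + n)" by (simp only:)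
      qed (use q1 in simp)
      then have h1: "C * q powr (\<epsilon> / 2 * real (M + k)) \<le> C * q powr (\<epsilon> * real (m + n))" by (rule mult_left_mono[OF _ C])
      have h2: "q powr real M + q powr (2 * real (M + k) / 3) + q powr ((5 / 3 + 2 * \<delta>) * real k - (1 / 3 + \<delta>) * real M) \<le> 3 * (q * W)"
        using 1 2 3 by linarith
      have "C * q powr (\<epsilon> / 2 * real (M + k)) * (q powr real M + q powr (2 * real (M + k) / 3) + q powr ((5 / 3 + 2 * \<delta>) * real k - (1 / 3 + \<delta>) * real M))
          \<le> C * q powr (\<epsilon> * real (m + n)) * (3 * (q * W))"
        by (rule mult_mono[OF h1 h2]) (use C in auto)
      then show ?thesis by (simp add: c_def mult_ac)
    qed
    have "sieve \<chi> m n (2 * c)"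
    proof (rule sieve_shift)
      have MM: "m + (M - m) = M" using Mm by simp
      show "sieve \<chi> (m + (M - m)) n c" unfolding MM
        by (rule sieve_mono[OF LS0[OF \<chi>] bound]) (use nm Mm in auto)
      show "sieve \<chi> (m + (M - m)) (n - 1) c" unfolding MM
        by (rule sieve_mono[OF LS0[OF \<chi>] bound]) (use nm Mm in auto)
    qed
    then show ?thesis by (simp add: c_def W_def mult.assoc)
  qed
  moreover have "6 * q * C \<ge> 0" using C q1 by simp
  ultimately show "\<exists>C\<ge>0. \<forall>\<chi> :: 'a symbol. sieve_pair \<chi> \<longrightarrow> (\<forall>m n. n \<le> m \<longrightarrow>
     sieve \<chi> m n (C * real CARD('a) powr (\<epsilon> * real (m + n)) *
       (real CARD('a) powr real m + real CARD('a) powr (2 * real (m + n) / 3)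
        + real CARD('a) powr ((4 / 3 + 2 / 3 * \<delta>) * real n))))"
    unfolding q_def \<alpha>_def by blast
qed

lemma sieve_bound_power: "sieve_bound TYPE('a::{field,finite}) ((2 / 3) ^ Suc k)"
proof (induction k)
  case 0
  then show ?case using sieve_bound_initial by simp
next
  case (Suc k)
  have "((2::real) / 3) ^ Suc k \<le> (2 / 3) ^ 1" by (rule power_decreasing) auto
  then show ?case using sieve_bound_step[OF Suc] by simp
qed

text \<open>Once \<open>\<delta> \<le> \<epsilon> / 2\<close>, the extra term is absorbed:
  \<open>min m n\<close> is at most the mean of \<open>m\<close> and \<open>n\<close>, so
  \<open>4 / 3 * min m n\<close> is at most \<open>2 * (m + n) / 3\<close>, and the excess is at
  most \<open>\<epsilon> / 2 * (m + n)\<close>.\<close>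

lemma abstract_large_sieve:
  assumes \<epsilon>: "\<epsilon> > 0"
  shows "\<exists>C. \<forall>\<chi> :: 'a::{field,finite} symbol. sieve_pair \<chi> \<longrightarrow> (\<forall>m n.
     sieve_sf \<chi> m n (C * real CARD('a) powr (\<epsilon> * real (m + n)) *
       (real CARD('a) ^ m + real CARD('a) ^ n + real CARD('a) powr (2 * real (m + n) / 3))))"
proof -
  define q where "q = real CARD('a)"
  have q1: "q > 1" unfolding q_def by (rule card_field_gt_1)
  have e2: "\<epsilon> / 2 > 0" using \<epsilon> by simp
  obtain k where k: "((2::real) / 3) ^ k < \<epsilon> / 2" using real_arch_pow_inv[OF e2, of "2 / 3"] by auto
  define \<delta> where "\<delta> = ((2::real) / 3) ^ Suc k"
  have "\<delta> \<le> (2 / 3) ^ k" unfolding \<delta>_def by (rule power_decreasing) auto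
  then have "\<delta> \<le> \<epsilon> / 2" using k by linarith
  moreover have "0 \<le> \<delta>" by (simp add: \<delta>_def)
  ultimately have \<delta>: "0 \<le> \<delta>" "\<delta> \<le> \<epsilon> / 2" by blast+
  obtain C where C: "C \<ge> 0" and sieve: "\<And>\<chi> :: 'a symbol. \<And>m n. sieve_pair \<chi> \<Longrightarrow>
     sieve_sf \<chi> m n (C * q powr (\<epsilon> / 2 * real (m + n)) *
       (q powr real m + q powr real n + q powr (2 * real (m + n) / 3) + q powr ((4 / 3 + \<delta>) * real (min m n))))"
    using sieve_bound_power[where ?'a = 'a and k = k, unfolded sieve_bound_def, rule_format, OF e2]
    unfolding q_def \<delta>_def by blast
  have "sieve_sf \<chi> m n (2 * C * q powr (\<epsilon> * real (m + n)) * (q ^ m + q ^ n + q powr (2 * real (m + n) / 3)))"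
    if \<chi>: "sieve_pair \<chi>" for \<chi> :: "'a symbol" and m n
  proof (rule sieve_sf_mono[OF sieve[OF \<chi>]])
    define W where "W = q ^ m + q ^ n + q powr (2 * real (m + n) / 3)"
    define E where "E = q powr (\<epsilon> / 2 * real (m + n))"
    have E1: "E \<ge> 1" unfolding E_def using q1 \<epsilon> by (intro ge_one_powr_ge_zero) auto
    have W0: "W \<ge> 0" "q powr (2 * real (m + n) / 3) \<le> W" using q1 by (auto simp: W_def)
    have EE: "q powr (\<epsilon> * real (m + n)) = E * E"
    proof -
      have "\<epsilon> * real (m + n) = \<epsilon> / 2 * real (m + n) + \<epsilon> / 2 * real (m + n)" by simp
      then show ?thesis by (simp only: E_def powr_add)
    qed
    have "q powr ((4 / 3 + \<delta>) * real (min m n)) \<le> q powr (2 * real (m + n) / 3 + \<epsilon> / 2 * real (m + n))"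
    proof (rule powr_mono)
      have "4 / 3 * real (min m n) \<le> 2 * real (m + n) / 3" by (simp add: min_def)
      moreover have "\<delta> * real (min m n) \<le> \<epsilon> / 2 * real (m + n)" using \<delta> by (intro mult_mono) auto
      ultimately show "(4 / 3 + \<delta>) * real (min m n) \<le> 2 * real (m + n) / 3 + \<epsilon> / 2 * real (m + n)"
        unfolding distrib_right by linarith
    qed (use q1 in simp)
    also have "\<dots> = q powr (2 * real (m + n) / 3) * E" by (simp only: powr_add E_def)
    also have "\<dots> \<le> W * E" using W0 E1 by (intro mult_right_mono) auto
    finally have "q powr ((4 / 3 + \<delta>) * real (min m n)) \<le> W * E" .
    moreover have "W \<le> W * E" using mult_left_mono[OF E1 W0(1)] by simp
    moreover have "q powr real m + q powr real n + q powr (2 * real (m + n) / 3) = W"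
      using q1 by (simp add: W_def powr_realpow)
    ultimately have "q powr real m + q powr real n + q powr (2 * real (m + n) / 3) + q powr ((4 / 3 + \<delta>) * real (min m n)) \<le> 2 * (W * E)"
      by linarith
    then have "C * E * (q powr real m + q powr real n + q powr (2 * real (m + n) / 3) + q powr ((4 / 3 + \<delta>) * real (min m n))) \<le> C * E * (2 * (W * E))"
      using C E1 by (intro mult_left_mono) auto
    also have "\<dots> = 2 * C * (E * E) * W" by (simp add: mult_ac)
    finally show "C * q powr (\<epsilon> / 2 * real (m + n)) *
       (q powr real m + q powr real n + q powr (2 * real (m + n) / 3) + q powr ((4 / 3 + \<delta>) * real (min m n)))
       \<le> 2 * C * q powr (\<epsilon> * real (m + n)) * (q ^ m + q ^ n + q powr (2 * real (m + n) / 3))"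
      by (simp only: E_def EE W_def)
  qed
  then show ?thesis unfolding q_def by blast
qed

section \<open>Evaluation at roots and the reciprocity law\<close>

text \<open>Evaluation at a root of \<open>p\<close> models the residue field modulo
  \<open>p\<close>; with the roots of all primes in one algebraic closure, two primes can be
  compared.\<close>

definition ev :: "'a::field alg_closure \<Rightarrow> 'a poly \<Rightarrow> 'a alg_closure" where
  "ev \<alpha> f = poly (map_poly to_ac f) \<alpha>"

lemma ev_0 [simp]: "ev \<alpha> 0 = 0"
  by (simp add: ev_def)

lemma ev_pCons [simp]: "ev \<alpha> (pCons c f) = to_ac c + \<alpha> * ev \<alpha> f"
  by (simp add: ev_def map_poly_pCons)

lemma ev_add: "ev \<alpha> (f + g) = ev \<alpha> f + ev \<alpha> g"
proof (induction f arbitrary: g)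
  case (pCons c f)
  then show ?case by (cases g) (simp add: algebra_simps)
qed simp

lemma ev_const_mult: "ev \<alpha> ([:c:] * g) = to_ac c * ev \<alpha> g"
  by (induction g) (simp_all add: algebra_simps)

lemma ev_mult: "ev \<alpha> (f * g) = ev \<alpha> f * ev \<alpha> g"
proof (induction f)
  case (pCons c f)
  have "pCons c f * g = [:c:] * g + pCons 0 (f * g)" by simp
  then have "ev \<alpha> (pCons c f * g) = to_ac c * ev \<alpha> g + \<alpha> * (ev \<alpha> f * ev \<alpha> g)"
    by (simp only: ev_add ev_const_mult ev_pCons to_ac_0 add_0 pCons.IH)
  then show ?case by (simp add: algebra_simps)
qed simp

lemma ev_1 [simp]: "ev \<alpha> 1 = 1"
  by (simp add: one_pCons)

lemma ev_power: "ev \<alpha> (f ^ n) = ev \<alpha> f ^ n"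
  by (induction n) (simp_all add: ev_mult)

lemma ev_minus: "ev \<alpha> (- f) = - ev \<alpha> f"
  using ev_add[of \<alpha> f "- f"] by (simp add: eq_neg_iff_add_eq_0 add.commute)

lemma ev_diff: "ev \<alpha> (f - g) = ev \<alpha> f - ev \<alpha> g"
  using ev_add[of \<alpha> f "- g"] by (simp add: ev_minus)

text \<open>Up to a unit, \<open>p\<close> is the minimal polynomial of \<alpha>: a nonzero
  polynomial of least degree vanishing at \<alpha> divides every other one, in particular the
  irreducible \<open>p\<close>.\<close>

lemma ev_eq_0_iff:
  fixes p :: "'a::field poly"
  assumes p: "p \<in> mirr" and \<alpha>: "ev \<alpha> p = 0"
  shows "ev \<alpha> f = 0 \<longleftrightarrow> p dvd f"
proof
  assume "p dvd f"
  then show "ev \<alpha> f = 0" using \<alpha> by (auto simp: ev_mult elim!: dvdE)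
next
  assume f: "ev \<alpha> f = 0"
  define P where "P n \<longleftrightarrow> (\<exists>g. g \<noteq> 0 \<and> ev \<alpha> g = 0 \<and> degree g = n)" for n
  have "P (degree p)" using \<alpha> mirrD(3)[OF p] by (auto simp: P_def)
  then have "P (LEAST n. P n)" by (rule LeastI)
  then obtain g where g: "g \<noteq> 0" "ev \<alpha> g = 0" "degree g = (LEAST n. P n)" by (auto simp: P_def)
  have dv: "g dvd h" if h: "ev \<alpha> h = 0" for h
  proof (rule ccontr)
    assume "\<not> g dvd h"
    then have nz: "h mod g \<noteq> 0" by (simp add: dvd_eq_mod_eq_0)
    have "h = h div g * g + h mod g" by simp
    then have "ev \<alpha> h = ev \<alpha> (h div g) * ev \<alpha> g + ev \<alpha> (h mod g)" by (metis ev_add ev_mult)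
    then have "ev \<alpha> (h mod g) = 0" using h g by simp
    then have "P (degree (h mod g))" using nz by (auto simp: P_def)
    then have "degree g \<le> degree (h mod g)" unfolding g(3) by (rule Least_le)
    then show False using degree_mod_less'[OF g(1) nz] by simp
  qed
  obtain w where w: "p = g * w" using dv[OF \<alpha>] by (elim dvdE)
  have "is_unit g \<or> is_unit w" using mirrD(2)[OF p] w Factorial_Ring.irreducibleD by blast
  moreover have "\<not> is_unit g"
  proof
    assume "is_unit g"
    then obtain h where "1 = g * h" by (elim dvdE)
    then have "ev \<alpha> 1 = ev \<alpha> g * ev \<alpha> h" by (metis ev_mult)
    then show False using g by simp
  qed
  ultimately have "p dvd g" using w by (metis dvd_mult_unit_iff dvd_refl)
  then show "p dvd f" using dv[OF f] dvd_trans by blast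
qed

lemma ev_eq_iff:
  "p \<in> mirr \<Longrightarrow> ev \<alpha> p = 0 \<Longrightarrow> ev \<alpha> f = ev \<alpha> g \<longleftrightarrow> p dvd f - g"
  using ev_eq_0_iff[of p \<alpha> "f - g"] by (simp add: ev_diff)

lemma exists_root:
  assumes "p \<in> mirr" shows "\<exists>\<alpha>. ev \<alpha> p = 0"
proof -
  have "degree (map_poly to_ac p) = degree p" by (rule degree_map_poly) simp
  then have "degree (map_poly to_ac p) > 0" using mirrD(6)[OF assms] by simp
  then show ?thesis unfolding ev_def by (rule alg_closed_imp_poly_has_root)
qed

section \<open>Finite fields inside the closure, Frobenius and conjugate roots\<close>

lemma card_power_roots:
  fixes c :: "'b::field"
  assumes "n > 0" shows "finite {x::'b. x ^ n = c}" "card {x::'b. x ^ n = c} \<le> n"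
proof -
  define P where "P = monom 1 n - [:c:]"
  have d: "degree P = n" unfolding P_def using assms
    by (subst diff_conv_add_uminus, subst degree_add_eq_left) (auto simp: degree_monom_eq)
  then have nz: "P \<noteq> 0" using assms by auto
  have e: "{x. x ^ n = c} = {x. poly P x = 0}" by (simp add: P_def poly_monom)
  show "finite {x::'b. x ^ n = c}" unfolding e by (rule poly_roots_finite[OF nz])
  show "card {x::'b. x ^ n = c} \<le> n" unfolding e using card_poly_roots_bound[OF nz] d by simp
qed

lemma card_power_eq_self_roots:
  assumes "n > 1" shows "finite {x::'b::field. x ^ n = x}" "card {x::'b. x ^ n = x} \<le> n"
proof -
  define P where "P = (monom 1 n - monom 1 1 :: 'b poly)"
  have d: "degree P = n" unfolding P_def using assms
    by (subst diff_conv_add_uminus, subst degree_add_eq_left) (auto simp: degree_monom_eq)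
  then have nz: "P \<noteq> 0" using assms by auto
  have e: "{x. x ^ n = x} = {x. poly P x = 0}" by (simp add: P_def poly_monom)
  show "finite {x::'b. x ^ n = x}" unfolding e by (rule poly_roots_finite[OF nz])
  show "card {x::'b. x ^ n = x} \<le> n" unfolding e using card_poly_roots_bound[OF nz] d by simp
qed

text \<open>Multiplication by \<open>x\<close> permutes the nonzero elements of \<open>V\<close>;
  compare their products. It serves both the base field and the residue fields.\<close>

lemma finite_subfield_power:
  fixes V :: "'b::field set"
  assumes V: "finite V" "\<And>x y. x \<in> V \<Longrightarrow> y \<in> V \<Longrightarrow> x * y \<in> V" "0 \<in> V" and x: "x \<in> V" "x \<noteq> 0"
  shows "x ^ (card V - 1) = 1"
proof -
  let ?W = "V - {0}"
  have inj: "inj_on ((*) x) ?W" using x by (auto simp: inj_on_def)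
  have "(*) x ` ?W \<subseteq> ?W" using V x by auto
  then have "(*) x ` ?W = ?W" using inj V by (intro endo_inj_surj) auto
  then have "prod (\<lambda>y. y) ?W = prod (\<lambda>y. y) ((*) x ` ?W)" by simp
  also have "\<dots> = (\<Prod>y\<in>?W. x * y)" unfolding prod.reindex[OF inj] comp_def ..
  also have "\<dots> = x ^ (card V - 1) * prod (\<lambda>y. y) ?W" using V by (simp add: prod.distrib)
  finally have "(x ^ (card V - 1) - 1) * prod (\<lambda>y. y) ?W = 0" by (simp add: algebra_simps)
  moreover have "prod (\<lambda>y. y) ?W \<noteq> 0" using V by simp
  ultimately show ?thesis by simp
qed

lemma field_power_card: "x ^ CARD('a) = (x::'a::{field,finite})"
proof (cases "x = 0")
  case False
  have "x ^ (CARD('a) - 1) = 1" by (rule finite_subfield_power) (use False in auto)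
  moreover have "x ^ CARD('a) = x * x ^ (CARD('a) - 1)" by (simp flip: power_Suc)
  ultimately show ?thesis by simp
qed simp

lemma ev_image_below:
  fixes p :: "'a::{field,finite} poly"
  assumes p: "p \<in> mirr" and \<alpha>: "ev \<alpha> p = 0"
  shows "card (ev \<alpha> ` below (degree p)) = CARD('a) ^ degree p" "ev \<alpha> f \<in> ev \<alpha> ` below (degree p)"
proof -
  have "inj_on (ev \<alpha>) (below (degree p))"
  proof (rule inj_onI)
    fix f g assume fg: "f \<in> below (degree p)" "g \<in> below (degree p)" "ev \<alpha> f = ev \<alpha> g"
    then have "p dvd f - g" using ev_eq_iff[OF p \<alpha>] by simp
    then have "f mod p = g mod p" by (simp add: mod_eq_dvd_iff)
    then show "f = g" using fg by (simp add: below_mod)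
  qed
  then show "card (ev \<alpha> ` below (degree p)) = CARD('a) ^ degree p" by (simp add: card_image card_below)
  have "p dvd f - f mod p" by (simp add: mod_eq_dvd_iff[symmetric])
  then have "ev \<alpha> f = ev \<alpha> (f mod p)" using ev_eq_iff[OF p \<alpha>] by blast
  then show "ev \<alpha> f \<in> ev \<alpha> ` below (degree p)" using mod_below[OF mirrD(3)[OF p]] by blast
qed

lemma ev_fermat:
  fixes p :: "'a::{field,finite} poly"
  assumes p: "p \<in> mirr" and \<alpha>: "ev \<alpha> p = 0" and f: "\<not> p dvd f"
  shows "ev \<alpha> f ^ (CARD('a) ^ degree p - 1) = 1"
proof -
  let ?V = "ev \<alpha> ` below (degree p)"
  have "ev \<alpha> f ^ (card ?V - 1) = 1"
  proof (rule finite_subfield_power)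
    show "x * y \<in> ?V" if "x \<in> ?V" "y \<in> ?V" for x y
      using that ev_image_below(2)[OF p \<alpha>] by (auto simp: ev_mult[symmetric])
    show "0 \<in> ?V" using ev_image_below(2)[OF p \<alpha>, of 0] by simp
    show "ev \<alpha> f \<in> ?V" by (rule ev_image_below(2)[OF p \<alpha>])
    show "ev \<alpha> f \<noteq> 0" using f ev_eq_0_iff[OF p \<alpha>] by simp
  qed simp
  then show ?thesis by (simp add: ev_image_below(1)[OF p \<alpha>])
qed

lemma to_ac_power_card: "to_ac c ^ CARD('a) = to_ac (c::'a::{field,finite})"
  using field_power_card[of c] by (simp flip: to_ac_power)

text \<open>A polynomial of degree below \<open>q\<close> that vanishes on the \<open>q\<close> elements of the base field is zero;
  used twice this gives additivity of the \<open>q\<close>-th power without knowing that \<open>q\<close> is a power of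
  the characteristic.\<close>

lemma frobenius_add:
  fixes x y :: "'a::{field,finite} alg_closure"
  shows "(x + y) ^ CARD('a) = x ^ CARD('a) + y ^ CARD('a)"
proof -
  define q where "q = CARD('a)"
  have q1: "q > 1" using card_field_gt_1[where ?'a = 'a] by (simp add: q_def)
  have van: "(z + y) ^ q = z ^ q + y ^ q" if "\<And>c. (to_ac c + y) ^ q = to_ac c ^ q + y ^ q" for y z :: "'a alg_closure"
  proof -
    define P where "P = [:y, 1:] ^ q - monom 1 q - [:y ^ q:]"
    have cq: "coeff ([:y, 1:] ^ q) q = 1"
      using lead_coeff_power[of "[:y, 1:]" q] by (simp add: degree_power_eq)
    have dq: "degree ([:y, 1:] ^ q) = q" by (simp add: degree_power_eq)
    have "degree P < q"
    proof (rule degree_lessI)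
      show "P \<noteq> 0 \<or> q > 0" using q1 by simp
      show "\<forall>k\<ge>q. coeff P k = 0"
      proof (intro allI impI)
        fix k assume "q \<le> k"
        then show "coeff P k = 0"
          using q1 cq dq by (cases "k = q") (auto simp: P_def coeff_eq_0 coeff_pCons split: nat.splits)
      qed
    qed
    have "P = 0"
    proof (rule ccontr)
      assume nz: "P \<noteq> 0"
      have "range to_ac \<subseteq> {x. poly P x = 0}"
        using that by (auto simp: P_def poly_monom add.commute)
      then have "card (range (to_ac :: 'a \<Rightarrow> _)) \<le> card {x. poly P x = 0}"
        by (intro card_mono poly_roots_finite[OF nz])
      also have "\<dots> \<le> degree P" by (rule card_poly_roots_bound[OF nz])
      finally show False using \<open>degree P < q\<close> by (simp add: card_image inj_to_ac q_def)
    qed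
    then have "poly P z = 0" by simp
    then show ?thesis by (simp add: P_def poly_monom add.commute diff_eq_eq)
  qed
  have base: "(to_ac b + to_ac c) ^ q = to_ac b ^ q + to_ac c ^ q" for b c :: 'a
    using to_ac_power_card[of "b + c"] by (simp add: q_def to_ac_power_card)
  have "(z + to_ac c) ^ q = z ^ q + to_ac c ^ q" for z :: "'a alg_closure" and c
    by (rule van) (rule base)
  then have "(to_ac c + y) ^ q = to_ac c ^ q + y ^ q" for c by (metis add.commute)
  then show ?thesis unfolding q_def[symmetric] by (rule van)
qed

lemma ev_frobenius: "ev \<alpha> f ^ CARD('a) = ev (\<alpha> ^ CARD('a)) (f :: 'a::{field,finite} poly)"
  by (induction f) (simp_all add: frobenius_add power_mult_distrib to_ac_power_card)

lemma ev_frobenius_iter: "ev \<alpha> f ^ (CARD('a) ^ i) = ev (\<alpha> ^ (CARD('a) ^ i)) (f :: 'a::{field,finite} poly)"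
  by (induction i) (simp_all add: power_mult mult.commute[of "CARD('a)"] ev_frobenius)

text \<open>The conjugates \<open>\<alpha> ^ (q ^ i)\<close> with \<open>i < degree p\<close> are
  distinct roots of \<open>p\<close>; two monic polynomials of degree \<open>d\<close> that agree at
  \<open>d\<close> points are equal.\<close>

lemma mirr_factorisation:
  fixes p :: "'a::{field,finite} poly"
  assumes p: "p \<in> mirr" and \<alpha>: "ev \<alpha> p = 0"
  shows "ev z p = (\<Prod>i<degree p. z - \<alpha> ^ (CARD('a) ^ i))"
proof -
  define q where "q = CARD('a)"
  define d where "d = degree p"
  have q1: "q > 1" using card_field_gt_1[where ?'a = 'a] by (simp add: q_def)
  have fixd: "\<alpha> ^ (q ^ d) = \<alpha>"
  proof (cases "p dvd [:0, 1:]")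
    case True
    then have "\<alpha> = 0" using ev_eq_0_iff[OF p \<alpha>, of "[:0, 1:]"] by simp
    then show ?thesis using q1 by simp
  next
    case False
    from ev_fermat[OF p \<alpha> False] have "\<alpha> ^ (q ^ d - 1) = 1" by (simp add: q_def d_def)
    moreover have "\<alpha> ^ (q ^ d) = \<alpha> * \<alpha> ^ (q ^ d - 1)" using q1 by (simp flip: power_Suc)
    ultimately show ?thesis by simp
  qed
  \<comment> \<open>A shorter period would put all \<open>q ^ d\<close> values of polynomials at
    \<alpha> among the at most \<open>q ^ r\<close> solutions of
    \<open>x ^ (q ^ r) = x\<close>.\<close>
  have noshort: "\<alpha> ^ (q ^ r) \<noteq> \<alpha>" if r: "0 < r" "r < d" for r
  proof
    assume a: "\<alpha> ^ (q ^ r) = \<alpha>"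
    have qr: "q ^ r > 1" using one_less_power[OF q1 r(1)] .
    have "ev \<alpha> ` below d \<subseteq> {x. x ^ (q ^ r) = x}"
      using a ev_frobenius_iter[of \<alpha> _ r] by (auto simp: q_def)
    then have "card (ev \<alpha> ` below d) \<le> card {x::'a alg_closure. x ^ (q ^ r) = x}"
      by (intro card_mono card_power_eq_self_roots(1) qr)
    also have "\<dots> \<le> q ^ r" by (rule card_power_eq_self_roots(2)[OF qr])
    finally have "q ^ d \<le> q ^ r" using ev_image_below(1)[OF p \<alpha>] by (simp add: d_def q_def)
    then show False using r q1 by simp
  qed
  have inj: "inj_on (\<lambda>i. \<alpha> ^ (q ^ i)) {..<d}"
  proof -
    have False if ij: "i < j" "j < d" "\<alpha> ^ (q ^ i) = \<alpha> ^ (q ^ j)" for i j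
    proof -
      have pw: "(x ^ (q ^ a)) ^ (q ^ b) = x ^ (q ^ (a + b))" for x :: "'a alg_closure" and a b
        by (simp add: power_mult[symmetric] power_add)
      \<comment> \<open>Applying Frobenius \<open>d - i\<close> more times turns the coincidence
        into a period \<open>j - i\<close> of \<alpha>.\<close>
      have "i + (d - i) = d" "j + (d - i) = d + (j - i)" using ij(1,2) by simp_all
      then have "\<alpha> = (\<alpha> ^ (q ^ i)) ^ (q ^ (d - i))" by (simp only: pw fixd)
      also have "\<dots> = (\<alpha> ^ (q ^ j)) ^ (q ^ (d - i))" by (simp only: ij)
      also have "\<dots> = (\<alpha> ^ (q ^ d)) ^ (q ^ (j - i))"
        unfolding pw \<open>j + (d - i) = d + (j - i)\<close> ..
      also have "\<dots> = \<alpha> ^ (q ^ (j - i))" by (simp only: fixd)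
      finally have "\<alpha> ^ (q ^ (j - i)) = \<alpha>" by (rule sym)
      moreover have "0 < j - i" "j - i < d" using ij(1,2) by auto
      ultimately show False using noshort by blast
    qed
    then show ?thesis by (intro linorder_inj_onI) (auto simp: eq_commute)
  qed
  define P where "P = map_poly to_ac p"
  define Q where "Q = (\<Prod>i<d. [:- (\<alpha> ^ (q ^ i)), 1:])"
  have P: "degree P = d" "coeff P d = 1"
    using mirrD(1)[OF p] by (simp_all add: P_def d_def degree_map_poly coeff_map_poly)
  have dQ: "degree Q = d" unfolding Q_def by (subst degree_prod_sum_eq) auto
  have "lead_coeff Q = 1" unfolding Q_def by (simp add: lead_coeff_prod)
  then have Q: "coeff Q d = 1" using dQ by simp
  have "P = Q"
  proof (rule ccontr)
    assume "P \<noteq> Q"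
    then have nz: "P - Q \<noteq> 0" by simp
    have "degree (P - Q) \<le> d" using P dQ by (intro degree_diff_le) auto
    moreover have "degree (P - Q) \<noteq> d"
    proof
      assume "degree (P - Q) = d"
      then have "lead_coeff (P - Q) = 0" using P Q by simp
      then show False using nz by (metis leading_coeff_0_iff)
    qed
    ultimately have lt: "degree (P - Q) < d" by simp
    have "(\<lambda>i. \<alpha> ^ (q ^ i)) ` {..<d} \<subseteq> {x. poly (P - Q) x = 0}"
    proof clarify
      fix i assume i: "i < d"
      have "poly P (\<alpha> ^ (q ^ i)) = 0"
      proof -
        have "(0::'a alg_closure) ^ (q ^ i) = 0" using q1 by (simp add: power_0_left)
        then have "ev (\<alpha> ^ (q ^ i)) p = 0" using ev_frobenius_iter[of \<alpha> p i] \<alpha> unfolding q_def by (simp only:)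
        then show ?thesis by (simp only: P_def ev_def)
      qed
      moreover have "poly Q (\<alpha> ^ (q ^ i)) = 0"
        using i by (auto simp: Q_def poly_prod intro!: bexI[of _ i])
      ultimately show "poly (P - Q) (\<alpha> ^ (q ^ i)) = 0" by simp
    qed
    then have "card ((\<lambda>i. \<alpha> ^ (q ^ i)) ` {..<d}) \<le> card {x. poly (P - Q) x = 0}"
      by (intro card_mono poly_roots_finite[OF nz])
    also have "\<dots> \<le> degree (P - Q)" by (rule card_poly_roots_bound[OF nz])
    finally show False using lt by (simp add: card_image[OF inj])
  qed
  have "ev z p = poly P z" by (simp add: P_def ev_def)
  also have "\<dots> = (\<Prod>i<d. z - \<alpha> ^ (q ^ i))" unfolding \<open>P = Q\<close> Q_def by (simp add: poly_prod)
  finally show ?thesis by (simp add: d_def q_def)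
qed

lemma ev_norm:
  fixes p :: "'a::{field,finite} poly"
  shows "ev \<alpha> f ^ (\<Sum>i<d. CARD('a) ^ i) = (\<Prod>i<d. ev (\<alpha> ^ (CARD('a) ^ i)) (f :: 'a poly))"
  by (simp add: power_sum ev_frobenius_iter)

text \<open>By \<open>ev_norm\<close> and \<open>mirr_factorisation\<close> both sides are powers of
  a resultant, the product of the differences of the roots of \<open>p\<close> and \<open>r\<close>;
  the two orders differ by a sign, which the even \<open>u\<close> removes.\<close>

lemma norm_reciprocity:
  fixes p r :: "'a::{field,finite} poly"
  assumes p: "p \<in> mirr" "ev \<alpha> p = 0" and r: "r \<in> mirr" "ev \<beta> r = 0" and u: "even u"
  shows "ev \<alpha> r ^ ((\<Sum>i<degree p. CARD('a) ^ i) * u) = ev \<beta> p ^ ((\<Sum>i<degree r. CARD('a) ^ i) * u)"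
proof -
  let ?q = "CARD('a)"
  have 1: "ev \<alpha> r ^ (\<Sum>i<degree p. ?q ^ i) = (\<Prod>i<degree p. \<Prod>j<degree r. \<alpha> ^ (?q ^ i) - \<beta> ^ (?q ^ j))"
    by (subst ev_norm) (simp only: mirr_factorisation[OF r])
  have 2: "ev \<beta> p ^ (\<Sum>j<degree r. ?q ^ j) = (\<Prod>i<degree p. \<Prod>j<degree r. \<beta> ^ (?q ^ j) - \<alpha> ^ (?q ^ i))"
    by (subst prod.swap, subst ev_norm) (simp only: mirr_factorisation[OF p])
  have sq: "(x - y) ^ u = (y - x) ^ u" for x y :: "'a alg_closure"
    using u power_minus_even[of u "x - y"] by simp
  show ?thesis unfolding power_mult 1 2 prod_power_distrib by (simp only: sq)
qed

section \<open>The residue symbol\<close>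

lemma recip_charsys_square:
  assumes "recip_charsys \<chi>" and nt: "\<And>p. p \<in> mirr \<Longrightarrow> \<exists>v. \<not> p dvd v \<and> (\<chi> p v)\<^sup>2 \<noteq> 1"
  shows "recip_charsys (\<lambda>p x. (\<chi> p x)\<^sup>2)"
proof -
  interpret recip_charsys \<chi> by fact
  show ?thesis
  proof (unfold_locales, goal_cases)
    case (1 p x y) then show ?case by (simp add: X_mult power_mult_distrib)
  next
    case (2 p x y) then show ?case by (metis X_cong)
  next
    case (3 p x) then show ?case by (simp add: X_zero)
  next
    case (4 p x) then show ?case by (simp add: X_norm norm_power)
  next
    case (5 p) then show ?case by (rule nt)
  next
    case (6 p r) then show ?case by (metis X_recip)
  next
    case (7 p u)
    from X_const[OF this] show ?case by (simp add: power_mult[symmetric] mult.commute)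
  qed
qed

locale residue_symbol_setting =
  fixes \<Omega> :: "'a::{field,finite} \<Rightarrow> complex" and l :: nat
  assumes l: "l \<ge> 3" and q_cong: "[CARD('a) = 1] (mod (2 * l))"
    and \<Omega>: "\<Omega> \<in> iso (roots_of_unity_group l) (roots_of_unity_group l)"
begin

lemma \<Omega>_mult: "x \<in> roots_of_unity l \<Longrightarrow> y \<in> roots_of_unity l \<Longrightarrow> \<Omega> (x * y) = \<Omega> x * \<Omega> y"
  using \<Omega> by (auto simp: iso_def hom_def roots_of_unity_group_def)

lemma \<Omega>_bij: "bij_betw \<Omega> (roots_of_unity l) (roots_of_unity l)"
  using \<Omega> by (auto simp: iso_def roots_of_unity_group_def)

lemma \<Omega>_root: "x \<in> roots_of_unity l \<Longrightarrow> \<Omega> x \<in> roots_of_unity l"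
  using \<Omega>_bij by (auto simp: bij_betw_def)

lemma one_root: "1 \<in> roots_of_unity l"
  by (simp add: roots_of_unity_def)

lemma root_mult: "x \<in> roots_of_unity l \<Longrightarrow> y \<in> roots_of_unity l \<Longrightarrow> x * y \<in> roots_of_unity l"
  by (simp add: roots_of_unity_def power_mult_distrib)

lemma root_power: "x \<in> roots_of_unity l \<Longrightarrow> x ^ n \<in> roots_of_unity l"
  by (simp add: roots_of_unity_def) (metis power_mult mult.commute power_one)

lemma \<Omega>_1: "\<Omega> 1 = 1"
proof -
  have "\<Omega> 1 \<noteq> 0" using \<Omega>_root[OF one_root] l by (auto simp: roots_of_unity_def power_0_left)
  then show ?thesis using \<Omega>_mult[OF one_root one_root] by simp
qed

lemma \<Omega>_power: "x \<in> roots_of_unity l \<Longrightarrow> \<Omega> (x ^ n) = \<Omega> x ^ n"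
  by (induction n) (simp_all add: \<Omega>_1 \<Omega>_mult root_power)

lemma \<Omega>_norm: "x \<in> roots_of_unity l \<Longrightarrow> cmod (\<Omega> x) = 1"
proof -
  assume "x \<in> roots_of_unity l"
  then have "cmod (\<Omega> x) ^ l = 1" using \<Omega>_root by (simp add: roots_of_unity_def norm_power[symmetric])
  then show ?thesis using l power_eq_1_iff[of "cmod (\<Omega> x)" l] by simp
qed

lemma card_roots: "card (roots_of_unity l :: 'a set) = l"
proof -
  have "card (roots_of_unity l :: 'a set) = card (roots_of_unity l :: complex set)"
    by (rule bij_betw_same_card[OF \<Omega>_bij])
  also have "\<dots> = l"
    using bij_betw_same_card[OF bij_betw_roots_unity[of l]] l by (simp add: roots_of_unity_def)
  finally show ?thesis .
qed

lemma q_minus_1: obtains h where "CARD('a) - 1 = l * (2 * h)"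
proof -
  have "2 * l dvd CARD('a) - 1"
    using q_cong card_field_gt_1[where ?'a = 'a] by (simp add: cong_altdef_nat cong_sym_eq)
  then obtain k where "CARD('a) - 1 = 2 * l * k" by (elim dvdE)
  then show ?thesis using that[of k] by (simp only: mult_ac)
qed

definition u where "u = (CARD('a) - 1) div l"

lemma u: "CARD('a) - 1 = l * u" "even u"
proof -
  obtain h where h: "CARD('a) - 1 = l * (2 * h)" by (rule q_minus_1)
  then have "u = 2 * h" using l by (simp add: u_def)
  then show "CARD('a) - 1 = l * u" "even u" using h by simp_all
qed

text \<open>The exponent \<open>(q ^ d - 1) / l\<close> of the symbol, as the norm exponent
  \<open>1 + q + ... + q ^ (d - 1)\<close> times \<open>u = (q - 1) / l\<close>; the congruence
  modulo \<open>2 * l\<close> makes \<open>u\<close> even.\<close>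

definition s :: "nat \<Rightarrow> nat" where "s d = (\<Sum>i<d. CARD('a) ^ i) * u"

lemma exponent: "CARD('a) ^ d - 1 = l * s d"
proof -
  have "int (CARD('a) ^ d - 1) = int CARD('a) ^ d - 1"
    by (simp add: of_nat_diff)
  also have "\<dots> = (int CARD('a) - 1) * (\<Sum>i<d. int CARD('a) ^ i)" by (rule power_diff_1_eq)
  also have "int CARD('a) - 1 = int l * int u"
    using u(1) card_field_gt_1[where ?'a = 'a] by (metis of_nat_1 of_nat_diff of_nat_mult less_imp_le of_nat_le_iff one_le_card_finite Suc_leI One_nat_def zero_less_card_finite)
  finally have "int (CARD('a) ^ d - 1) = int (l * s d)"
    by (simp add: s_def mult_ac)
  then show ?thesis by (simp only: of_nat_eq_iff)
qed

lemma exponent_div: "(CARD('a) ^ d - 1) div l = s d"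
  using exponent[of d] l by simp

lemma symbol_value:
  fixes a p :: "'a poly"
  assumes p: "p \<in> mirr" and \<alpha>: "ev \<alpha> p = 0" and a: "\<not> p dvd a"
    and \<omega>: "\<omega> \<in> roots_of_unity l" and e: "ev \<alpha> a ^ s (degree p) = to_ac \<omega>"
  shows "residue_symbol_irred \<Omega> l a p = \<Omega> \<omega>"
proof -
  have cg: "[a ^ s (degree p) = [:c:]] (mod p) \<longleftrightarrow> c = \<omega>" for c
  proof -
    have "[a ^ s (degree p) = [:c:]] (mod p) \<longleftrightarrow> p dvd a ^ s (degree p) - [:c:]"
      by (rule cong_iff_dvd_diff)
    also have "\<dots> \<longleftrightarrow> ev \<alpha> (a ^ s (degree p)) = ev \<alpha> [:c:]" by (rule ev_eq_iff[OF p \<alpha>, symmetric])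
    also have "\<dots> \<longleftrightarrow> c = \<omega>" by (auto simp: ev_power e)
    finally show ?thesis .
  qed
  have inv: "inv_into (roots_of_unity l) \<Omega> (\<Omega> \<omega>) = \<omega>"
    using \<omega> \<Omega>_bij by (simp add: bij_betw_def)
  have "(THE \<xi>. \<xi> \<in> roots_of_unity l \<and> inv_into (roots_of_unity l) \<Omega> \<xi> = \<omega>) = \<Omega> \<omega>"
  proof (rule the_equality)
    show "\<Omega> \<omega> \<in> roots_of_unity l \<and> inv_into (roots_of_unity l) \<Omega> (\<Omega> \<omega>) = \<omega>" using inv \<Omega>_root[OF \<omega>] by simp
    fix \<xi> assume "\<xi> \<in> roots_of_unity l \<and> inv_into (roots_of_unity l) \<Omega> \<xi> = \<omega>"
    then show "\<xi> = \<Omega> \<omega>" using \<Omega>_bij by (metis bij_betw_def f_inv_into_f)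
  qed
  then show ?thesis unfolding residue_symbol_irred_def exponent_div cg using a by simp
qed

text \<open>The base field already contains \<open>l\<close> solutions of \<open>x ^ l = 1\<close>,
  the maximal number in the closure, so the root of unity supplied by Fermat's theorem lies in
  it.\<close>

lemma symbol_exists:
  fixes a p :: "'a poly"
  assumes p: "p \<in> mirr" and \<alpha>: "ev \<alpha> p = 0" and a: "\<not> p dvd a"
  obtains \<omega> where "\<omega> \<in> roots_of_unity l" "ev \<alpha> a ^ s (degree p) = to_ac \<omega>"
proof -
  let ?R = "to_ac ` (roots_of_unity l :: 'a set)"
  have l0: "l > 0" using l by simp
  have sub: "?R \<subseteq> {x. x ^ l = 1}" by (auto simp: roots_of_unity_def simp flip: to_ac_power)
  have "card ?R = l" using card_roots by (simp add: card_image inj_on_def)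
  then have "?R = {x. x ^ l = 1}"
    using card_power_roots[OF l0, of "1 :: 'a alg_closure"] card_mono[OF _ sub] sub
    by (intro card_subset_eq) auto
  moreover have "(ev \<alpha> a ^ s (degree p)) ^ l = 1"
    using ev_fermat[OF p \<alpha> a] by (simp only: exponent power_mult[symmetric] mult.commute)
  ultimately have "ev \<alpha> a ^ s (degree p) \<in> ?R" by blast
  then show ?thesis using that by blast
qed

section \<open>The residue symbol as a character system\<close>

definition \<chi> :: "'a symbol" where
  "\<chi> p x = residue_symbol_irred \<Omega> l x p"

lemma \<chi>_zero: "p dvd x \<Longrightarrow> \<chi> p x = 0"
  by (simp add: \<chi>_def residue_symbol_irred_def)

lemma \<chi>_mult:
  assumes p: "p \<in> mirr" shows "\<chi> p (x * y) = \<chi> p x * \<chi> p y"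
proof (cases "p dvd x \<or> p dvd y")
  case True
  then have "p dvd x * y" by auto
  then show ?thesis using True by (auto simp: \<chi>_zero)
next
  case False
  then have xy: "\<not> p dvd x" "\<not> p dvd y" "\<not> p dvd x * y"
    using mirrD(4)[OF p] by (auto simp: prime_elem_dvd_mult_iff)
  obtain \<alpha> where \<alpha>: "ev \<alpha> p = 0" using exists_root[OF p] by blast
  obtain v where v: "v \<in> roots_of_unity l" "ev \<alpha> x ^ s (degree p) = to_ac v" by (rule symbol_exists[OF p \<alpha> xy(1)])
  obtain w where w: "w \<in> roots_of_unity l" "ev \<alpha> y ^ s (degree p) = to_ac w" by (rule symbol_exists[OF p \<alpha> xy(2)])
  have "ev \<alpha> (x * y) ^ s (degree p) = to_ac (v * w)" using v w by (simp add: ev_mult power_mult_distrib)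
  from symbol_value[OF p \<alpha> xy(3) root_mult[OF v(1) w(1)] this]
  show ?thesis using symbol_value[OF p \<alpha> xy(1) v] symbol_value[OF p \<alpha> xy(2) w] \<Omega>_mult[OF v(1) w(1)]
    by (simp add: \<chi>_def)
qed

lemma \<chi>_cong:
  assumes p: "p \<in> mirr" and d: "p dvd x - y" shows "\<chi> p x = \<chi> p y"
proof (cases "p dvd x")
  case True
  then have "p dvd y" using d by (metis dvd_diff_right_iff dvd_diff_commute)
  then show ?thesis using True by (simp add: \<chi>_zero)
next
  case False
  then have y: "\<not> p dvd y" using d by (metis diff_add_cancel dvd_add)
  obtain \<alpha> where \<alpha>: "ev \<alpha> p = 0" using exists_root[OF p] by blast
  obtain v where v: "v \<in> roots_of_unity l" "ev \<alpha> x ^ s (degree p) = to_ac v" by (rule symbol_exists[OF p \<alpha> False])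
  have "ev \<alpha> y = ev \<alpha> x" using ev_eq_iff[OF p \<alpha>, of x y] d by simp
  then show ?thesis using symbol_value[OF p \<alpha> False v] symbol_value[OF p \<alpha> y v(1)] v(2) by (simp add: \<chi>_def)
qed

lemma \<chi>_norm:
  assumes p: "p \<in> mirr" and x: "\<not> p dvd x" shows "cmod (\<chi> p x) = 1"
proof -
  obtain \<alpha> where \<alpha>: "ev \<alpha> p = 0" using exists_root[OF p] by blast
  obtain v where v: "v \<in> roots_of_unity l" "ev \<alpha> x ^ s (degree p) = to_ac v" by (rule symbol_exists[OF p \<alpha> x])
  show ?thesis using symbol_value[OF p \<alpha> x v] \<Omega>_norm[OF v(1)] by (simp add: \<chi>_def)
qed

text \<open>If the square were trivial, all \<open>l * s (degree p)\<close> nonzero residues would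
  satisfy \<open>x ^ (2 * s (degree p)) = 1\<close>, which has at most
  \<open>2 * s (degree p)\<close> solutions; this contradicts \<open>l \<ge> 3\<close>.\<close>

lemma \<chi>_square_nontrivial:
  assumes p: "p \<in> mirr" shows "\<exists>v. \<not> p dvd v \<and> (\<chi> p v)\<^sup>2 \<noteq> 1"
proof (rule ccontr)
  assume "\<not> ?thesis"
  then have triv: "(\<chi> p v)\<^sup>2 = 1" if "\<not> p dvd v" for v using that by blast
  obtain \<alpha> where \<alpha>: "ev \<alpha> p = 0" using exists_root[OF p] by blast
  let ?V = "ev \<alpha> ` below (degree p)"
  let ?n = "2 * s (degree p)"
  have "?V - {0} \<subseteq> {x. x ^ ?n = 1}"
  proof
    fix x assume "x \<in> ?V - {0}"
    then obtain f where f: "x = ev \<alpha> f" "x \<noteq> 0" by blast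
    then have nd: "\<not> p dvd f" using ev_eq_0_iff[OF p \<alpha>] by simp
    obtain v where v: "v \<in> roots_of_unity l" "ev \<alpha> f ^ s (degree p) = to_ac v" by (rule symbol_exists[OF p \<alpha> nd])
    have "\<Omega> (v ^ 2) = \<Omega> 1" using triv[OF nd] symbol_value[OF p \<alpha> nd v] by (simp add: \<chi>_def \<Omega>_power[OF v(1)] \<Omega>_1)
    then have "v ^ 2 = 1" using \<Omega>_bij root_power[OF v(1)] one_root by (auto simp: bij_betw_def dest: inj_onD)
    have "x ^ ?n = (ev \<alpha> f ^ s (degree p)) ^ 2" by (simp only: f(1) power_mult[symmetric] mult.commute)
    also have "\<dots> = to_ac (v ^ 2)" by (simp only: v(2) to_ac_power)
    finally show "x \<in> {x. x ^ ?n = 1}" using \<open>v ^ 2 = 1\<close> by simp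
  qed
  moreover have e: "CARD('a) ^ degree p - 1 = l * s (degree p)" by (rule exponent)
  have big: "CARD('a) ^ degree p > 1"
    using card_field_gt_1[where ?'a = 'a] mirrD(6)[OF p] by (intro one_less_power) auto
  then have s0: "s (degree p) > 0" using e by (intro Nat.gr0I) simp
  then have n0: "?n > 0" by simp
  ultimately have "card (?V - {0}) \<le> ?n"
    using card_power_roots[OF n0, of "1 :: 'a alg_closure"] card_mono le_trans by blast
  moreover have "0 \<in> ?V" using ev_image_below(2)[OF p \<alpha>, of 0] by simp
  then have "card (?V - {0}) = CARD('a) ^ degree p - 1"
    using ev_image_below(1)[OF p \<alpha>] by (simp add: card_Diff_singleton)
  ultimately have "l * s (degree p) \<le> 2 * s (degree p)" using e by linarith
  then show False using s0 l by simp
qed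

lemma \<chi>_recip:
  assumes p: "p \<in> mirr" and r: "r \<in> mirr" shows "\<chi> p r = \<chi> r p"
proof (cases "p = r")
  case False
  then have nd: "\<not> p dvd r" "\<not> r dvd p" using mirr_dvd_eq p r by blast+
  obtain \<alpha> where \<alpha>: "ev \<alpha> p = 0" using exists_root[OF p] by blast
  obtain \<beta> where \<beta>: "ev \<beta> r = 0" using exists_root[OF r] by blast
  obtain v where v: "v \<in> roots_of_unity l" "ev \<alpha> r ^ s (degree p) = to_ac v" by (rule symbol_exists[OF p \<alpha> nd(1)])
  have "ev \<beta> p ^ s (degree r) = to_ac v"
    using norm_reciprocity[OF p \<alpha> r \<beta> u(2)] v(2) by (simp only: s_def)
  then show ?thesis using symbol_value[OF p \<alpha> nd(1) v] symbol_value[OF r \<beta> nd(2) v(1)] by (simp add: \<chi>_def)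
qed simp

text \<open>Frobenius fixes \<open>c\<close>, so the norm of the constant is
  \<open>c ^ degree p\<close>.\<close>

lemma \<chi>_const:
  assumes p: "p \<in> mirr" and c: "c \<noteq> 0"
  shows "\<chi> p [:c:] = \<Omega> (c ^ u) ^ degree p"
proof -
  obtain \<alpha> where \<alpha>: "ev \<alpha> p = 0" using exists_root[OF p] by blast
  have nd: "\<not> p dvd [:c:]" using ev_eq_0_iff[OF p \<alpha>, of "[:c:]"] c by simp
  have cq: "c ^ (CARD('a) ^ i) = c" for i
    by (induction i) (simp_all add: power_mult field_power_card mult.commute[of "CARD('a)"])
  have "c ^ (CARD('a) - 1) = 1"
    by (rule finite_subfield_power) (use c in auto)
  then have "c ^ (l * u) = 1" unfolding u(1) .
  then have w: "c ^ u \<in> roots_of_unity l" by (simp add: roots_of_unity_def power_mult[symmetric] mult.commute)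
  have "c ^ (\<Sum>i<degree p. CARD('a) ^ i) = c ^ degree p" by (simp add: power_sum cq)
  then have "c ^ s (degree p) = (c ^ u) ^ degree p" by (simp add: s_def power_mult) (simp add: power_mult[symmetric] mult.commute)
  then have "ev \<alpha> [:c:] ^ s (degree p) = to_ac ((c ^ u) ^ degree p)" by (simp flip: to_ac_power)
  from symbol_value[OF p \<alpha> nd root_power[OF w] this] show ?thesis by (simp add: \<chi>_def \<Omega>_power[OF w])
qed

lemma sieve_pair_\<chi>: "sieve_pair \<chi>"
proof -
  have "recip_charsys \<chi>"
  proof (unfold_locales, goal_cases)
    case (1 p x y) then show ?case by (rule \<chi>_mult)
  next
    case (2 p x y) then show ?case by (rule \<chi>_cong)
  next
    case (3 p x) then show ?case by (intro \<chi>_zero)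
  next
    case (4 p x) then show ?case by (rule \<chi>_norm)
  next
    case (5 p) then show ?case using \<chi>_square_nontrivial by (metis power_one)
  next
    case (6 p r) then show ?case by (rule \<chi>_recip)
  next
    case (7 p c) then show ?case by (simp add: \<chi>_const linear_mirr)
  qed
  then show ?thesis unfolding sieve_pair_def using recip_charsys_square \<chi>_square_nontrivial by blast
qed

lemma residue_symbol_pset:
  assumes S: "S \<in> psets n" shows "residue_symbol \<Omega> l M (\<Prod>S) = chi \<chi> S M"
proof -
  have fin: "finite S" "S \<subseteq> mirr" using S by (auto simp: psets_def)
  have "{p. lead_coeff p = 1 \<and> irreducible p \<and> p dvd \<Prod>S} = S"
    using mirr_not_dvd_prod[OF fin] fin by (auto simp: mirr_def dvd_prodI)
  then show ?thesis unfolding residue_symbol_def chi_def \<chi>_def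
    by (auto intro!: prod.cong simp: irred_exponent_pset[OF S])
qed

lemma large_sieve_sum:
  "(\<Sum>M\<in>sqfree_monic m. (cmod (\<Sum>N\<in>sqfree_monic n. lam N * residue_symbol \<Omega> l M N))\<^sup>2) =
   (\<Sum>R\<in>psets m. (cmod (\<Sum>S\<in>psets n. lam (\<Prod>S) * chi \<chi> S (\<Prod>R)))\<^sup>2)"
proof -
  have "(\<Sum>N\<in>sqfree_monic n. lam N * residue_symbol \<Omega> l M N) = (\<Sum>S\<in>psets n. lam (\<Prod>S) * chi \<chi> S M)" for M
    by (subst sum.reindex_bij_betw[OF bij_betw_psets, symmetric]) (simp add: residue_symbol_pset cong: sum.cong)
  then show ?thesis
    by (subst sum.reindex_bij_betw[OF bij_betw_psets, symmetric]) simp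
qed

end

theorem theorem1p4:
  fixes l q :: nat and \<epsilon> :: real
  assumes "l \<ge> 3"
    and "CARD('a::{field,finite}) = q"
    and "[q = 1] (mod (2 * l))"
    and "\<epsilon> > 0"
  shows "\<exists>C::real. \<forall>\<Omega> \<in> iso (roots_of_unity_group l :: 'a monoid) (roots_of_unity_group l).
           \<forall>(lam :: 'a poly \<Rightarrow> complex) (m::nat) (n::nat).
             (\<Sum>M\<in>sqfree_monic m.
                (cmod (\<Sum>N\<in>sqfree_monic n. lam N * residue_symbol \<Omega> l M N))\<^sup>2)
             \<le> C * real q powr (\<epsilon> * real (m + n))
                 * (real q ^ m + real q ^ n + real q powr (2 * real (m + n) / 3))
                 * (\<Sum>N\<in>sqfree_monic n. (cmod (lam N))\<^sup>2)"
proof -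
  \<comment> \<open>Uniformity of \<open>abstract_large_sieve\<close> over all symbols lets
    \<open>C\<close> be chosen before \<Omega>.\<close>
  obtain C where C: "\<And>\<chi> :: 'a symbol. \<And>m n. sieve_pair \<chi> \<Longrightarrow>
     sieve_sf \<chi> m n (C * real CARD('a) powr (\<epsilon> * real (m + n)) *
       (real CARD('a) ^ m + real CARD('a) ^ n + real CARD('a) powr (2 * real (m + n) / 3)))"
    using abstract_large_sieve[OF assms(4), where ?'a = 'a] by blast
  show ?thesis
  proof (rule exI[of _ C], intro ballI allI)
    fix \<Omega> :: "'a \<Rightarrow> complex" and lam :: "'a poly \<Rightarrow> complex" and m n :: nat
    assume \<Omega>: "\<Omega> \<in> iso (roots_of_unity_group l :: 'a monoid) (roots_of_unity_group l)"
    interpret residue_symbol_setting \<Omega> l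
      using assms \<Omega> by unfold_locales simp_all
    have "(\<Sum>S\<in>psets n. (cmod (lam (\<Prod>S)))\<^sup>2) = (\<Sum>N\<in>sqfree_monic n. (cmod (lam N))\<^sup>2)"
      by (rule sum.reindex_bij_betw[OF bij_betw_psets])
    then show "(\<Sum>M\<in>sqfree_monic m. (cmod (\<Sum>N\<in>sqfree_monic n. lam N * residue_symbol \<Omega> l M N))\<^sup>2)
             \<le> C * real q powr (\<epsilon> * real (m + n))
                 * (real q ^ m + real q ^ n + real q powr (2 * real (m + n) / 3))
                 * (\<Sum>N\<in>sqfree_monic n. (cmod (lam N))\<^sup>2)"
      using spec[OF C[OF sieve_pair_\<chi>, of m n, unfolded sieve_sf_def], of "\<lambda>S. lam (\<Prod>S)"]
      unfolding large_sieve_sum assms(2) by simp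
  qed
qed

end
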